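(* For every data-system $\mathcal D$, the intrinsic theory $\mathbf{IT}(\mathcal D)$ is interpretable in $\mathbf{PRA}^*$: there is a translation $\varphi\mapsto\varphi^*$ of formulas of $\mathbf{IT}(\mathcal D)$ into formulas of $\mathbf{PRA}^*$ which commutes with the propositional connectives, sends object variables to unary function variables, relativizes quantifiers to a fixed primitive recursive formula $\mathit{Htm}$, and such that $\varphi^*$ is provable in $\mathbf{PRA}^*$ whenever the closed formula $\varphi$ is provable in $\mathbf{IT}(\mathcal D)$.
   Context: A constructor vocabulary $\mathcal C$ is a finite set of constructors (function symbols with arities $\ge0$). A constructor-statement for $x$ is $\exists y_1\dots y_r(x=\mathbf c(y_1,\dots,y_r)\wedge\mathbf Q_1(y_1)\wedge\cdots\wedge\mathbf Q_r(y_r))$ with distinct $y_i$ and unary type-identifiers $\mathbf Q_i$. A data-system $\mathcal D$ is a finite sequence of bundles $\vec{\mathbf D}_1,\dots,\vec{\mathbf D}_k$ of type-identifiers, each inductive or coinductive; an inductive bundle $\vec{\mathbf D}_i$ has construction rules $\forall\vec y(\mathbf Q_1(y_1)\wedge\cdots\wedge\mathbf Q_r(y_r)\rightarrow\mathbf D(\mathbf c(\vec y)))$ with $\mathbf D$ in $\vec{\mathbf D}_i$ and $\mathbf Q_j$ in $\vec{\mathbf D}_1,\dots,\vec{\mathbf D}_i$; a coinductive bundle has for each of its $\mathbf D$ a deconstruction rule $\forall x(\mathbf D(x)\rightarrow\psi_1\vee\cdots\vee\psi_l)$ with $\psi_j$ constructor-statements for $x$ over types in $\vec{\mathbf D}_1,\dots,\vec{\mathbf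 D}_i$. $\mathbf{IT}(\mathcal D)$ is the classical first-order theory over a vocabulary containing the constructors, the type-identifiers of $\mathcal D$ and free program-function identifiers, whose axioms are: Separation (constructors injective with pairwise disjoint ranges); the construction and deconstruction rules of $\mathcal D$; Induction $\mathrm{Const}[\vec\varphi]\rightarrow\bigwedge_i\forall x(\mathbf D_i(x)\rightarrow\varphi_i[x])$ for each inductive bundle $(\mathbf D_1,\dots,\mathbf D_m)$ and formulas $\vec\varphi$, with $\mathrm{Const}[\vec\varphi]$ the conjunction of the bundle's construction rules with each $\mathbf D_j(\mathbf t)$ replaced by $\varphi_j[\mathbf t]$; Coinduction $\mathrm{Decomp}[\vec\varphi]\rightarrow\bigwedge_i\forall x(\varphi_i[x]\rightarrow\mathbf D_i(x))$ for each coinductive bundle, with $\mathrm{Decomp}[\vec\varphi]$ the conjunction of its deconstruction rules with each $\mathbf D_j(\mathbf t)$ replaced by $\varphi_j[\mathbf t]$. $\mathbf{PRA}$ is classical first-order arithmetic with symbols and defining equations for all primitive recursive functions, the axioms that successor is injective and $0$ is not a successor, and induction for all formulas. $\mathbf{PRA}^*$ extends $\mathbf{PRA}$ with variables and quantifiers for numeric functions, free variables for functionals (maps from numeric functions to numeric functions), identifiers for all primitive recursive functionals, terms built by type-correct composition and application, the Explicit Definition schema $\forall\vec f\,\exists g\,\forall\vec x\,g(\vec x)=\mathbf t[\vec x,\vec f]$ for every term $\mathbf t$ (and no other function-existence axioms), and induction for all formulas of the extended language. $\mathit{Htm}[g]$ is a primitive recursive formula stating that the unary function $g$ represents a hyper-term,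 where (via a primitive recursive sequence coding and numeric codes $\mathbf c^\sharp$ of constructors) $g$ represents a possibly infinite constructor tree $t$ if $g(a)=\mathbf c^\sharp$ for every address $a$ of $t$, $\mathbf c$ the constructor at $a$. *)

theory Defs
  imports Main "HOL-Library.Nat_Bijection"
begin

section \<open>Data-systems\<close>

text \<open>
  The list of constructors only serves as a presentation of a finite set; its order and
  repetitions are irrelevant.
\<close>

record 'c vocabulary =
  ctors :: "'c list"
  arity :: "'c \<Rightarrow> nat"

text \<open>
  A triple \<open>(c, [Q\<^sub>1,\<dots>,Q\<^sub>r], D)\<close> is the construction rule
  \<open>\<forall>y\<^sub>1\<dots>y\<^sub>r (Q\<^sub>1(y\<^sub>1) \<and> \<dots> \<and> Q\<^sub>r(y\<^sub>r) \<longrightarrow> D(c(y\<^sub>1,\<dots>,y\<^sub>r)))\<close>; a pair \<open>(c, [Q\<^sub>1,\<dots>,Q\<^sub>r])\<close> is the constructor-statement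
  \<open>\<exists>y\<^sub>1\<dots>y\<^sub>r (x = c(y\<^sub>1,\<dots>,y\<^sub>r) \<and> Q\<^sub>1(y\<^sub>1) \<and> \<dots> \<and> Q\<^sub>r(y\<^sub>r))\<close>.  A coinductive bundle lists each of its
  type-identifiers together with the disjuncts of its deconstruction rule.
\<close>

datatype ('c, 'd) ty_bundle =
    Inductive "'d list" "('c \<times> 'd list \<times> 'd) list"
  | Coinductive "('d \<times> ('c \<times> 'd list) list) list"

fun bundle_types :: "('c, 'd) ty_bundle \<Rightarrow> 'd list" where
  "bundle_types (Inductive Ds R) = Ds"
| "bundle_types (Coinductive R) = map fst R"

definition types :: "('c, 'd) ty_bundle list \<Rightarrow> 'd set" where
  "types S = set (concat (map bundle_types S))"

fun bundle_ok :: "'c vocabulary \<Rightarrow> 'd set \<Rightarrow> ('c, 'd) ty_bundle \<Rightarrow> bool" where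
  "bundle_ok V T (Inductive Ds R) \<longleftrightarrow>
     (\<forall>(c, Qs, D) \<in> set R.
        D \<in> set Ds \<and> c \<in> set (ctors V) \<and> length Qs = arity V c \<and> set Qs \<subseteq> T)"
| "bundle_ok V T (Coinductive R) \<longleftrightarrow>
     (\<forall>(D, \<psi>s) \<in> set R. \<forall>(c, Qs) \<in> set \<psi>s.
        c \<in> set (ctors V) \<and> length Qs = arity V c \<and> set Qs \<subseteq> T)"

definition data_system :: "'c vocabulary \<Rightarrow> ('c, 'd) ty_bundle list \<Rightarrow> bool" where
  "data_system V S \<longleftrightarrow>
     distinct (concat (map bundle_types S)) \<and>
     (\<forall>i < length S. bundle_ok V (types (take (Suc i) S)) (S ! i))"


section \<open>The intrinsic theory of a data-system\<close>

text \<open>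
  Variables are de Bruijn indices, in terms as well as in formulas; the indices not bound by a
  quantifier are the free variables.  \<open>Fn f ts\<close> applies the program-function identifier
  with name \<open>f\<close> and arity \<open>length ts\<close>, so that there are
  infinitely many identifiers of every arity.
\<close>

datatype 'c itm = IVar nat | Con 'c "'c itm list" | Fn nat "'c itm list"

datatype ('c, 'd) ifm =
    IFalse
  | IEq "'c itm" "'c itm"
  | ITy 'd "'c itm"
  | IImp "('c, 'd) ifm" "('c, 'd) ifm"
  | IAnd "('c, 'd) ifm" "('c, 'd) ifm"
  | IOr "('c, 'd) ifm" "('c, 'd) ifm"
  | IAll "('c, 'd) ifm"
  | IEx "('c, 'd) ifm"

abbreviation INot :: "('c, 'd) ifm \<Rightarrow> ('c, 'd) ifm" where
  "INot \<phi> \<equiv> IImp \<phi> IFalse"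

definition IConj :: "('c, 'd) ifm list \<Rightarrow> ('c, 'd) ifm" where
  "IConj \<phi>s = foldr IAnd \<phi>s (INot IFalse)"

definition IDisj :: "('c, 'd) ifm list \<Rightarrow> ('c, 'd) ifm" where
  "IDisj \<phi>s = foldr IOr \<phi>s IFalse"

definition IAlls :: "nat \<Rightarrow> ('c, 'd) ifm \<Rightarrow> ('c, 'd) ifm" where
  "IAlls r = IAll ^^ r"

definition IExs :: "nat \<Rightarrow> ('c, 'd) ifm \<Rightarrow> ('c, 'd) ifm" where
  "IExs r = IEx ^^ r"

fun itm_ok :: "'c vocabulary \<Rightarrow> 'c itm \<Rightarrow> bool" where
  "itm_ok V (IVar n) \<longleftrightarrow> True"
| "itm_ok V (Con c ts) \<longleftrightarrow>
     c \<in> set (ctors V) \<and> length ts = arity V c \<and> (\<forall>t \<in> set ts. itm_ok V t)"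
| "itm_ok V (Fn f ts) \<longleftrightarrow> (\<forall>t \<in> set ts. itm_ok V t)"

primrec ifm_ok :: "'c vocabulary \<Rightarrow> ('c, 'd) ty_bundle list \<Rightarrow> ('c, 'd) ifm \<Rightarrow> bool" where
  "ifm_ok V S IFalse \<longleftrightarrow> True"
| "ifm_ok V S (IEq s t) \<longleftrightarrow> itm_ok V s \<and> itm_ok V t"
| "ifm_ok V S (ITy D t) \<longleftrightarrow> D \<in> types S \<and> itm_ok V t"
| "ifm_ok V S (IImp \<phi> \<psi>) \<longleftrightarrow> ifm_ok V S \<phi> \<and> ifm_ok V S \<psi>"
| "ifm_ok V S (IAnd \<phi> \<psi>) \<longleftrightarrow> ifm_ok V S \<phi> \<and> ifm_ok V S \<psi>"
| "ifm_ok V S (IOr \<phi> \<psi>) \<longleftrightarrow> ifm_ok V S \<phi> \<and> ifm_ok V S \<psi>"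
| "ifm_ok V S (IAll \<phi>) \<longleftrightarrow> ifm_ok V S \<phi>"
| "ifm_ok V S (IEx \<phi>) \<longleftrightarrow> ifm_ok V S \<phi>"

fun itm_fv :: "'c itm \<Rightarrow> nat set" where
  "itm_fv (IVar n) = {n}"
| "itm_fv (Con c ts) = (\<Union>t \<in> set ts. itm_fv t)"
| "itm_fv (Fn f ts) = (\<Union>t \<in> set ts. itm_fv t)"

primrec ifm_fv :: "('c, 'd) ifm \<Rightarrow> nat set" where
  "ifm_fv IFalse = {}"
| "ifm_fv (IEq s t) = itm_fv s \<union> itm_fv t"
| "ifm_fv (ITy D t) = itm_fv t"
| "ifm_fv (IImp \<phi> \<psi>) = ifm_fv \<phi> \<union> ifm_fv \<psi>"
| "ifm_fv (IAnd \<phi> \<psi>) = ifm_fv \<phi> \<union> ifm_fv \<psi>"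
| "ifm_fv (IOr \<phi> \<psi>) = ifm_fv \<phi> \<union> ifm_fv \<psi>"
| "ifm_fv (IAll \<phi>) = {n. Suc n \<in> ifm_fv \<phi>}"
| "ifm_fv (IEx \<phi>) = {n. Suc n \<in> ifm_fv \<phi>}"

definition iclosed :: "('c, 'd) ifm \<Rightarrow> bool" where
  "iclosed \<phi> \<longleftrightarrow> ifm_fv \<phi> = {}"

fun itm_subst :: "(nat \<Rightarrow> 'c itm) \<Rightarrow> 'c itm \<Rightarrow> 'c itm" where
  "itm_subst \<sigma> (IVar n) = \<sigma> n"
| "itm_subst \<sigma> (Con c ts) = Con c (map (itm_subst \<sigma>) ts)"
| "itm_subst \<sigma> (Fn f ts) = Fn f (map (itm_subst \<sigma>) ts)"

definition iup :: "(nat \<Rightarrow> 'c itm) \<Rightarrow> nat \<Rightarrow> 'c itm" where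
  "iup \<sigma> n = (case n of 0 \<Rightarrow> IVar 0 | Suc m \<Rightarrow> itm_subst (\<lambda>k. IVar (Suc k)) (\<sigma> m))"

primrec ifm_subst :: "(nat \<Rightarrow> 'c itm) \<Rightarrow> ('c, 'd) ifm \<Rightarrow> ('c, 'd) ifm" where
  "ifm_subst \<sigma> IFalse = IFalse"
| "ifm_subst \<sigma> (IEq s t) = IEq (itm_subst \<sigma> s) (itm_subst \<sigma> t)"
| "ifm_subst \<sigma> (ITy D t) = ITy D (itm_subst \<sigma> t)"
| "ifm_subst \<sigma> (IImp \<phi> \<psi>) = IImp (ifm_subst \<sigma> \<phi>) (ifm_subst \<sigma> \<psi>)"
| "ifm_subst \<sigma> (IAnd \<phi> \<psi>) = IAnd (ifm_subst \<sigma> \<phi>) (ifm_subst \<sigma> \<psi>)"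
| "ifm_subst \<sigma> (IOr \<phi> \<psi>) = IOr (ifm_subst \<sigma> \<phi>) (ifm_subst \<sigma> \<psi>)"
| "ifm_subst \<sigma> (IAll \<phi>) = IAll (ifm_subst (iup \<sigma>) \<phi>)"
| "ifm_subst \<sigma> (IEx \<phi>) = IEx (ifm_subst (iup \<sigma>) \<phi>)"

text \<open>
  \<open>iinst r \<phi> t\<close> is \<open>\<phi>[t]\<close>, the index 0 of \<open>\<phi>\<close> being the argument place, for use
  under \<open>r\<close> quantifiers that are not part of \<open>\<phi>\<close>: the remaining
  free variables of \<open>\<phi>\<close> are shifted by \<open>r\<close>.
\<close>

definition iinst :: "nat \<Rightarrow> ('c, 'd) ifm \<Rightarrow> 'c itm \<Rightarrow> ('c, 'd) ifm" where
  "iinst r \<phi> t = ifm_subst (\<lambda>n. case n of 0 \<Rightarrow> t | Suc m \<Rightarrow> IVar (m + r)) \<phi>"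

definition ilift :: "('c, 'd) ifm \<Rightarrow> ('c, 'd) ifm" where
  "ilift \<phi> = ifm_subst (\<lambda>n. IVar (Suc n)) \<phi>"

text \<open>
  The rules of a bundle, with every \<open>D(t)\<close> replaced by \<open>\<Phi>\<^sub>D[t]\<close>.
\<close>

definition construction_rule ::
  "('d \<Rightarrow> ('c, 'd) ifm) \<Rightarrow> 'c \<times> 'd list \<times> 'd \<Rightarrow> ('c, 'd) ifm" where
  "construction_rule \<Phi> = (\<lambda>(c, Qs, D).
     let r = length Qs; ys = map IVar (rev [0..<r]) in
       IAlls r (IImp (IConj (map2 (\<lambda>Q y. iinst r (\<Phi> Q) y) Qs ys))
                     (iinst r (\<Phi> D) (Con c ys))))"

text \<open>The variable \<open>x\<close> of a constructor-statement has index 0 outside the statement.\<close>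

definition constructor_statement ::
  "('d \<Rightarrow> ('c, 'd) ifm) \<Rightarrow> 'c \<times> 'd list \<Rightarrow> ('c, 'd) ifm" where
  "constructor_statement \<Phi> = (\<lambda>(c, Qs).
     let r = length Qs; ys = map IVar (rev [0..<r]) in
       IExs r (IAnd (IEq (IVar r) (Con c ys))
                    (IConj (map2 (\<lambda>Q y. iinst (Suc r) (\<Phi> Q) y) Qs ys))))"

definition deconstruction_rule ::
  "('d \<Rightarrow> ('c, 'd) ifm) \<Rightarrow> 'd \<times> ('c \<times> 'd list) list \<Rightarrow> ('c, 'd) ifm" where
  "deconstruction_rule \<Phi> = (\<lambda>(D, \<psi>s).
     IAll (IImp (iinst 1 (\<Phi> D) (IVar 0)) (IDisj (map (constructor_statement \<Phi>) \<psi>s))))"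

definition type_atom :: "'d \<Rightarrow> ('c, 'd) ifm" where
  "type_atom D = ITy D (IVar 0)"

definition replacing :: "'d list \<Rightarrow> ('d \<Rightarrow> ('c, 'd) ifm) \<Rightarrow> 'd \<Rightarrow> ('c, 'd) ifm" where
  "replacing Ds \<phi> D = (if D \<in> set Ds then \<phi> D else type_atom D)"

inductive it_axiom ::
  "'c vocabulary \<Rightarrow> ('c, 'd) ty_bundle list \<Rightarrow> ('c, 'd) ifm \<Rightarrow> bool"
  for V :: "'c vocabulary" and S :: "('c, 'd) ty_bundle list" where
  sep_injective:
    "c \<in> set (ctors V) \<Longrightarrow> r = arity V c \<Longrightarrow>
     xs = map IVar [0..<r] \<Longrightarrow> ys = map IVar [r..<r + r] \<Longrightarrow>
     it_axiom V S (IAlls (r + r) (IImp (IEq (Con c xs) (Con c ys)) (IConj (map2 IEq xs ys))))"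
| sep_disjoint:
    "c \<in> set (ctors V) \<Longrightarrow> c' \<in> set (ctors V) \<Longrightarrow> c \<noteq> c' \<Longrightarrow> r = arity V c \<Longrightarrow> r' = arity V c' \<Longrightarrow>
     xs = map IVar [0..<r] \<Longrightarrow> ys = map IVar [r..<r + r'] \<Longrightarrow>
     it_axiom V S (IAlls (r + r') (INot (IEq (Con c xs) (Con c' ys))))"
| construction:
    "Inductive Ds R \<in> set S \<Longrightarrow> \<rho> \<in> set R \<Longrightarrow> it_axiom V S (construction_rule type_atom \<rho>)"
| deconstruction:
    "Coinductive R \<in> set S \<Longrightarrow> \<rho> \<in> set R \<Longrightarrow> it_axiom V S (deconstruction_rule type_atom \<rho>)"
| induction:
    "Inductive Ds R \<in> set S \<Longrightarrow> (\<And>D. D \<in> set Ds \<Longrightarrow> ifm_ok V S (\<phi> D)) \<Longrightarrow>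
     it_axiom V S
       (IImp (IConj (map (construction_rule (replacing Ds \<phi>)) R))
             (IConj (map (\<lambda>D. IAll (IImp (ITy D (IVar 0)) (\<phi> D))) Ds)))"
| coinduction:
    "Coinductive R \<in> set S \<Longrightarrow> Ds = map fst R \<Longrightarrow> (\<And>D. D \<in> set Ds \<Longrightarrow> ifm_ok V S (\<phi> D)) \<Longrightarrow>
     it_axiom V S
       (IImp (IConj (map (deconstruction_rule (replacing Ds \<phi>)) R))
             (IConj (map (\<lambda>D. IAll (IImp (\<phi> D) (ITy D (IVar 0)))) Ds)))"

text \<open>Natural deduction for classical logic with equality; contexts are finite lists.\<close>

inductive it_proves ::
  "'c vocabulary \<Rightarrow> ('c, 'd) ty_bundle list \<Rightarrow> ('c, 'd) ifm list \<Rightarrow> ('c, 'd) ifm \<Rightarrow> bool"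
  for V :: "'c vocabulary" and S :: "('c, 'd) ty_bundle list" where
  I_axiom: "it_axiom V S \<phi> \<Longrightarrow> it_proves V S \<Gamma> \<phi>"
| I_hyp: "\<phi> \<in> set \<Gamma> \<Longrightarrow> ifm_ok V S \<phi> \<Longrightarrow> it_proves V S \<Gamma> \<phi>"
| I_classical:
    "ifm_ok V S \<phi> \<Longrightarrow> it_proves V S (INot \<phi> # \<Gamma>) IFalse \<Longrightarrow> it_proves V S \<Gamma> \<phi>"
| I_impI:
    "ifm_ok V S \<phi> \<Longrightarrow> it_proves V S (\<phi> # \<Gamma>) \<psi> \<Longrightarrow> it_proves V S \<Gamma> (IImp \<phi> \<psi>)"
| I_impE: "it_proves V S \<Gamma> (IImp \<phi> \<psi>) \<Longrightarrow> it_proves V S \<Gamma> \<phi> \<Longrightarrow> it_proves V S \<Gamma> \<psi>"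
| I_andI: "it_proves V S \<Gamma> \<phi> \<Longrightarrow> it_proves V S \<Gamma> \<psi> \<Longrightarrow> it_proves V S \<Gamma> (IAnd \<phi> \<psi>)"
| I_andE1: "it_proves V S \<Gamma> (IAnd \<phi> \<psi>) \<Longrightarrow> it_proves V S \<Gamma> \<phi>"
| I_andE2: "it_proves V S \<Gamma> (IAnd \<phi> \<psi>) \<Longrightarrow> it_proves V S \<Gamma> \<psi>"
| I_orI1: "ifm_ok V S \<psi> \<Longrightarrow> it_proves V S \<Gamma> \<phi> \<Longrightarrow> it_proves V S \<Gamma> (IOr \<phi> \<psi>)"
| I_orI2: "ifm_ok V S \<phi> \<Longrightarrow> it_proves V S \<Gamma> \<psi> \<Longrightarrow> it_proves V S \<Gamma> (IOr \<phi> \<psi>)"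
| I_orE:
    "it_proves V S \<Gamma> (IOr \<phi> \<psi>) \<Longrightarrow> it_proves V S (\<phi> # \<Gamma>) \<chi> \<Longrightarrow> it_proves V S (\<psi> # \<Gamma>) \<chi> \<Longrightarrow>
     it_proves V S \<Gamma> \<chi>"
| I_allI: "it_proves V S (map ilift \<Gamma>) \<phi> \<Longrightarrow> it_proves V S \<Gamma> (IAll \<phi>)"
| I_allE: "it_proves V S \<Gamma> (IAll \<phi>) \<Longrightarrow> itm_ok V t \<Longrightarrow> it_proves V S \<Gamma> (iinst 0 \<phi> t)"
| I_exI:
    "ifm_ok V S \<phi> \<Longrightarrow> itm_ok V t \<Longrightarrow> it_proves V S \<Gamma> (iinst 0 \<phi> t) \<Longrightarrow> it_proves V S \<Gamma> (IEx \<phi>)"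
| I_exE:
    "it_proves V S \<Gamma> (IEx \<phi>) \<Longrightarrow> it_proves V S (\<phi> # map ilift \<Gamma>) (ilift \<psi>) \<Longrightarrow>
     it_proves V S \<Gamma> \<psi>"
| I_refl: "itm_ok V t \<Longrightarrow> it_proves V S \<Gamma> (IEq t t)"
| I_replace:
    "ifm_ok V S \<phi> \<Longrightarrow> it_proves V S \<Gamma> (IEq s t) \<Longrightarrow> it_proves V S \<Gamma> (iinst 0 \<phi> s) \<Longrightarrow>
     it_proves V S \<Gamma> (iinst 0 \<phi> t)"


section \<open>Primitive recursive functionals\<close>

text \<open>
  Identifiers for the functionals mapping functions \<open>f\<^sub>0,\<dots>,f\<^sub>p\<^sub>-\<^sub>1\<close> of arities \<open>ks\<close> to a function of arity \<open>m\<close> that is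
  primitive recursive uniformly in \<open>f\<^sub>0,\<dots>,f\<^sub>p\<^sub>-\<^sub>1\<close>; \<open>PArg i\<close> stands for \<open>f\<^sub>i\<close>.  The
  primitive recursive functions are the case \<open>ks = []\<close>.  Recursion is on the first argument,
  and the step takes as arguments the predecessor, the previous value and the parameters.
\<close>

datatype prfl =
  PZero | PSucc | PProj nat | PArg nat | PComp prfl "prfl list" | PRec prfl prfl

fun prfl_ok :: "nat list \<Rightarrow> nat \<Rightarrow> prfl \<Rightarrow> bool" where
  "prfl_ok ks m PZero \<longleftrightarrow> True"
| "prfl_ok ks m PSucc \<longleftrightarrow> m = 1"
| "prfl_ok ks m (PProj i) \<longleftrightarrow> i < m"
| "prfl_ok ks m (PArg i) \<longleftrightarrow> i < length ks \<and> m = ks ! i"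
| "prfl_ok ks m (PComp p qs) \<longleftrightarrow> prfl_ok ks (length qs) p \<and> (\<forall>q \<in> set qs. prfl_ok ks m q)"
| "prfl_ok ks m (PRec p q) \<longleftrightarrow> m \<noteq> 0 \<and> prfl_ok ks (m - 1) p \<and> prfl_ok ks (Suc m) q"


section \<open>The language of \<open>PRA\<^sup>*\<close>\<close>

text \<open>
  Function terms: \<open>FVar k n\<close> is the function variable of arity \<open>k\<close> and de Bruijn index \<open>n\<close>,
  indices being counted separately for each arity and for numeric variables.
  \<open>Prim p ks m fs\<close> and \<open>Fnl F ks m fs\<close> apply to \<open>fs\<close> a primitive recursive
  functional, respectively a free functional variable with name \<open>F\<close>, of the type with
  argument arities \<open>ks\<close> and value arity \<open>m\<close>.
\<close>

datatype ftm =
    FVar nat nat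
  | Prim prfl "nat list" nat "ftm list"
  | Fnl nat "nat list" nat "ftm list"

datatype ntm = NVar nat | NApp ftm "ntm list"

datatype pfm =
    PFalse
  | PEq ntm ntm
  | PImp pfm pfm
  | PAnd pfm pfm
  | POr pfm pfm
  | PAllN pfm
  | PExN pfm
  | PAllF nat pfm
  | PExF nat pfm

abbreviation PNot :: "pfm \<Rightarrow> pfm" where
  "PNot \<phi> \<equiv> PImp \<phi> PFalse"

definition PDisj :: "pfm list \<Rightarrow> pfm" where
  "PDisj \<phi>s = foldr POr \<phi>s PFalse"

definition PAllNs :: "nat \<Rightarrow> pfm \<Rightarrow> pfm" where
  "PAllNs k = PAllN ^^ k"

definition Papp :: "prfl \<Rightarrow> ntm list \<Rightarrow> ntm" where
  "Papp p ts = NApp (Prim p [] (length ts) []) ts"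

definition NZero :: ntm where
  "NZero = Papp PZero []"

definition NSuc :: "ntm \<Rightarrow> ntm" where
  "NSuc t = Papp PSucc [t]"

primrec numeral_tm :: "nat \<Rightarrow> ntm" where
  "numeral_tm 0 = NZero"
| "numeral_tm (Suc n) = NSuc (numeral_tm n)"

fun farity :: "ftm \<Rightarrow> nat" where
  "farity (FVar k n) = k"
| "farity (Prim p ks m fs) = m"
| "farity (Fnl F ks m fs) = m"

fun ftm_ok :: "ftm \<Rightarrow> bool" where
  "ftm_ok (FVar k n) \<longleftrightarrow> True"
| "ftm_ok (Prim p ks m fs) \<longleftrightarrow> prfl_ok ks m p \<and> map farity fs = ks \<and> (\<forall>f \<in> set fs. ftm_ok f)"
| "ftm_ok (Fnl F ks m fs) \<longleftrightarrow> map farity fs = ks \<and> (\<forall>f \<in> set fs. ftm_ok f)"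

fun ntm_ok :: "ntm \<Rightarrow> bool" where
  "ntm_ok (NVar n) \<longleftrightarrow> True"
| "ntm_ok (NApp f ts) \<longleftrightarrow> ftm_ok f \<and> length ts = farity f \<and> (\<forall>t \<in> set ts. ntm_ok t)"

primrec pfm_ok :: "pfm \<Rightarrow> bool" where
  "pfm_ok PFalse \<longleftrightarrow> True"
| "pfm_ok (PEq s t) \<longleftrightarrow> ntm_ok s \<and> ntm_ok t"
| "pfm_ok (PImp \<phi> \<psi>) \<longleftrightarrow> pfm_ok \<phi> \<and> pfm_ok \<psi>"
| "pfm_ok (PAnd \<phi> \<psi>) \<longleftrightarrow> pfm_ok \<phi> \<and> pfm_ok \<psi>"
| "pfm_ok (POr \<phi> \<psi>) \<longleftrightarrow> pfm_ok \<phi> \<and> pfm_ok \<psi>"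
| "pfm_ok (PAllN \<phi>) \<longleftrightarrow> pfm_ok \<phi>"
| "pfm_ok (PExN \<phi>) \<longleftrightarrow> pfm_ok \<phi>"
| "pfm_ok (PAllF k \<phi>) \<longleftrightarrow> pfm_ok \<phi>"
| "pfm_ok (PExF k \<phi>) \<longleftrightarrow> pfm_ok \<phi>"

datatype pvar = NumV nat | FunV nat nat | FnlV nat "nat list" nat

fun ftm_fv :: "ftm \<Rightarrow> pvar set" where
  "ftm_fv (FVar k n) = {FunV k n}"
| "ftm_fv (Prim p ks m fs) = (\<Union>f \<in> set fs. ftm_fv f)"
| "ftm_fv (Fnl F ks m fs) = insert (FnlV F ks m) (\<Union>f \<in> set fs. ftm_fv f)"

fun ntm_fv :: "ntm \<Rightarrow> pvar set" where
  "ntm_fv (NVar n) = {NumV n}"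
| "ntm_fv (NApp f ts) = ftm_fv f \<union> (\<Union>t \<in> set ts. ntm_fv t)"

fun nshift :: "pvar \<Rightarrow> pvar" where
  "nshift (NumV n) = NumV (Suc n)"
| "nshift v = v"

fun fshift :: "nat \<Rightarrow> pvar \<Rightarrow> pvar" where
  "fshift k (FunV j n) = FunV j (if j = k then Suc n else n)"
| "fshift k v = v"

primrec pfm_fv :: "pfm \<Rightarrow> pvar set" where
  "pfm_fv PFalse = {}"
| "pfm_fv (PEq s t) = ntm_fv s \<union> ntm_fv t"
| "pfm_fv (PImp \<phi> \<psi>) = pfm_fv \<phi> \<union> pfm_fv \<psi>"
| "pfm_fv (PAnd \<phi> \<psi>) = pfm_fv \<phi> \<union> pfm_fv \<psi>"
| "pfm_fv (POr \<phi> \<psi>) = pfm_fv \<phi> \<union> pfm_fv \<psi>"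
| "pfm_fv (PAllN \<phi>) = {v. nshift v \<in> pfm_fv \<phi>}"
| "pfm_fv (PExN \<phi>) = {v. nshift v \<in> pfm_fv \<phi>}"
| "pfm_fv (PAllF k \<phi>) = {v. fshift k v \<in> pfm_fv \<phi>}"
| "pfm_fv (PExF k \<phi>) = {v. fshift k v \<in> pfm_fv \<phi>}"

text \<open>
  Simultaneous substitution \<open>\<sigma>\<close> for numeric and \<open>\<tau>\<close> for function variables.  Function
  terms contain no numeric variables, so a numeric quantifier does not affect \<open>\<tau>\<close>.
\<close>

fun ftm_subst :: "(nat \<Rightarrow> nat \<Rightarrow> ftm) \<Rightarrow> ftm \<Rightarrow> ftm" where
  "ftm_subst \<tau> (FVar k n) = \<tau> k n"
| "ftm_subst \<tau> (Prim p ks m fs) = Prim p ks m (map (ftm_subst \<tau>) fs)"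
| "ftm_subst \<tau> (Fnl F ks m fs) = Fnl F ks m (map (ftm_subst \<tau>) fs)"

fun ntm_subst :: "(nat \<Rightarrow> ntm) \<Rightarrow> (nat \<Rightarrow> nat \<Rightarrow> ftm) \<Rightarrow> ntm \<Rightarrow> ntm" where
  "ntm_subst \<sigma> \<tau> (NVar n) = \<sigma> n"
| "ntm_subst \<sigma> \<tau> (NApp f ts) = NApp (ftm_subst \<tau> f) (map (ntm_subst \<sigma> \<tau>) ts)"

definition fren :: "nat \<Rightarrow> nat \<Rightarrow> nat \<Rightarrow> ftm" where
  "fren k j n = FVar j (if j = k then Suc n else n)"

definition nup :: "(nat \<Rightarrow> ntm) \<Rightarrow> nat \<Rightarrow> ntm" where
  "nup \<sigma> n = (case n of 0 \<Rightarrow> NVar 0 | Suc m \<Rightarrow> ntm_subst (\<lambda>i. NVar (Suc i)) FVar (\<sigma> m))"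

definition fup :: "nat \<Rightarrow> (nat \<Rightarrow> nat \<Rightarrow> ftm) \<Rightarrow> nat \<Rightarrow> nat \<Rightarrow> ftm" where
  "fup k \<tau> j n =
     (if j = k then (case n of 0 \<Rightarrow> FVar k 0 | Suc m \<Rightarrow> ftm_subst (fren k) (\<tau> k m))
      else ftm_subst (fren k) (\<tau> j n))"

primrec pfm_subst :: "(nat \<Rightarrow> ntm) \<Rightarrow> (nat \<Rightarrow> nat \<Rightarrow> ftm) \<Rightarrow> pfm \<Rightarrow> pfm" where
  "pfm_subst \<sigma> \<tau> PFalse = PFalse"
| "pfm_subst \<sigma> \<tau> (PEq s t) = PEq (ntm_subst \<sigma> \<tau> s) (ntm_subst \<sigma> \<tau> t)"
| "pfm_subst \<sigma> \<tau> (PImp \<phi> \<psi>) = PImp (pfm_subst \<sigma> \<tau> \<phi>) (pfm_subst \<sigma> \<tau> \<psi>)"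
| "pfm_subst \<sigma> \<tau> (PAnd \<phi> \<psi>) = PAnd (pfm_subst \<sigma> \<tau> \<phi>) (pfm_subst \<sigma> \<tau> \<psi>)"
| "pfm_subst \<sigma> \<tau> (POr \<phi> \<psi>) = POr (pfm_subst \<sigma> \<tau> \<phi>) (pfm_subst \<sigma> \<tau> \<psi>)"
| "pfm_subst \<sigma> \<tau> (PAllN \<phi>) = PAllN (pfm_subst (nup \<sigma>) \<tau> \<phi>)"
| "pfm_subst \<sigma> \<tau> (PExN \<phi>) = PExN (pfm_subst (nup \<sigma>) \<tau> \<phi>)"
| "pfm_subst \<sigma> \<tau> (PAllF k \<phi>) =
     PAllF k (pfm_subst (\<lambda>n. ntm_subst NVar (fren k) (\<sigma> n)) (fup k \<tau>) \<phi>)"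
| "pfm_subst \<sigma> \<tau> (PExF k \<phi>) =
     PExF k (pfm_subst (\<lambda>n. ntm_subst NVar (fren k) (\<sigma> n)) (fup k \<tau>) \<phi>)"

definition ninst :: "pfm \<Rightarrow> ntm \<Rightarrow> pfm" where
  "ninst \<phi> t = pfm_subst (\<lambda>n. case n of 0 \<Rightarrow> t | Suc m \<Rightarrow> NVar m) FVar \<phi>"

text \<open>Substitution for index 0 of the function variables of arity \<open>farity f\<close>.\<close>

definition finst :: "pfm \<Rightarrow> ftm \<Rightarrow> pfm" where
  "finst \<phi> f = pfm_subst NVar
     (\<lambda>k n. if k = farity f then (case n of 0 \<Rightarrow> f | Suc m \<Rightarrow> FVar k m) else FVar k n) \<phi>"

definition nlift :: "pfm \<Rightarrow> pfm" where
  "nlift \<phi> = pfm_subst (\<lambda>n. NVar (Suc n)) FVar \<phi>"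

definition flift :: "nat \<Rightarrow> pfm \<Rightarrow> pfm" where
  "flift k \<phi> = pfm_subst NVar (fren k) \<phi>"


section \<open>Axioms and deduction in \<open>PRA\<^sup>*\<close>\<close>

text \<open>
  Axioms hold for all values of their free variables, so universal closures are left implicit; in
  particular the quantifiers over the parameters of Explicit Definition.  There, all numeric
  variables of the term are bound by the displayed quantifiers.
\<close>

inductive pra_axiom :: "pfm \<Rightarrow> bool" where
  def_zero:
    "ntm_ok (NApp (Prim PZero ks m fs) ts) \<Longrightarrow>
     pra_axiom (PEq (NApp (Prim PZero ks m fs) ts) NZero)"
| def_succ:
    "ntm_ok (NApp (Prim PSucc ks 1 fs) [t]) \<Longrightarrow>
     pra_axiom (PEq (NApp (Prim PSucc ks 1 fs) [t]) (NSuc t))"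
| def_proj:
    "ntm_ok (NApp (Prim (PProj i) ks m fs) ts) \<Longrightarrow>
     pra_axiom (PEq (NApp (Prim (PProj i) ks m fs) ts) (ts ! i))"
| def_arg:
    "ntm_ok (NApp (Prim (PArg i) ks m fs) ts) \<Longrightarrow>
     pra_axiom (PEq (NApp (Prim (PArg i) ks m fs) ts) (NApp (fs ! i) ts))"
| def_comp:
    "ntm_ok (NApp (Prim (PComp p qs) ks m fs) ts) \<Longrightarrow>
     pra_axiom (PEq (NApp (Prim (PComp p qs) ks m fs) ts)
       (NApp (Prim p ks (length qs) fs) (map (\<lambda>q. NApp (Prim q ks m fs) ts) qs)))"
| def_rec_zero:
    "ntm_ok (NApp (Prim (PRec p q) ks (Suc m) fs) (NZero # ts)) \<Longrightarrow>
     pra_axiom (PEq (NApp (Prim (PRec p q) ks (Suc m) fs) (NZero # ts))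
       (NApp (Prim p ks m fs) ts))"
| def_rec_succ:
    "ntm_ok (NApp (Prim (PRec p q) ks (Suc m) fs) (NSuc t # ts)) \<Longrightarrow>
     pra_axiom (PEq (NApp (Prim (PRec p q) ks (Suc m) fs) (NSuc t # ts))
       (NApp (Prim q ks (Suc (Suc m)) fs)
          (t # NApp (Prim (PRec p q) ks (Suc m) fs) (t # ts) # ts)))"
| succ_injective:
    "ntm_ok s \<Longrightarrow> ntm_ok t \<Longrightarrow> pra_axiom (PImp (PEq (NSuc s) (NSuc t)) (PEq s t))"
| succ_nonzero:
    "ntm_ok t \<Longrightarrow> pra_axiom (PNot (PEq (NSuc t) NZero))"
| nat_induction:
    "pfm_ok \<phi> \<Longrightarrow>
     pra_axiom
       (PImp (ninst \<phi> NZero)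
         (PImp
           (PAllN (PImp \<phi>
              (pfm_subst (\<lambda>n. case n of 0 \<Rightarrow> NSuc (NVar 0) | Suc m \<Rightarrow> NVar (Suc m)) FVar \<phi>)))
           (PAllN \<phi>)))"
| explicit_definition:
    "ntm_ok t \<Longrightarrow> (\<And>n. NumV n \<in> ntm_fv t \<Longrightarrow> n < k) \<Longrightarrow>
     pra_axiom
       (PExF k (PAllNs k (PEq (NApp (FVar k 0) (map NVar (rev [0..<k])))
                              (ntm_subst NVar (fren k) t))))"

text \<open>
  Natural deduction for classical two-sorted logic.  Equality is primitive between numbers;
  equality of functions is extensional, whence the rule \<open>P_ext\<close>.  In the absence of quantifiers
  over functionals, functional variables are never eliminated or substituted.
\<close>

inductive pra_proves :: "pfm list \<Rightarrow> pfm \<Rightarrow> bool" where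
  P_axiom: "pra_axiom \<phi> \<Longrightarrow> pra_proves \<Gamma> \<phi>"
| P_hyp: "\<phi> \<in> set \<Gamma> \<Longrightarrow> pfm_ok \<phi> \<Longrightarrow> pra_proves \<Gamma> \<phi>"
| P_classical: "pfm_ok \<phi> \<Longrightarrow> pra_proves (PNot \<phi> # \<Gamma>) PFalse \<Longrightarrow> pra_proves \<Gamma> \<phi>"
| P_impI: "pfm_ok \<phi> \<Longrightarrow> pra_proves (\<phi> # \<Gamma>) \<psi> \<Longrightarrow> pra_proves \<Gamma> (PImp \<phi> \<psi>)"
| P_impE: "pra_proves \<Gamma> (PImp \<phi> \<psi>) \<Longrightarrow> pra_proves \<Gamma> \<phi> \<Longrightarrow> pra_proves \<Gamma> \<psi>"
| P_andI: "pra_proves \<Gamma> \<phi> \<Longrightarrow> pra_proves \<Gamma> \<psi> \<Longrightarrow> pra_proves \<Gamma> (PAnd \<phi> \<psi>)"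
| P_andE1: "pra_proves \<Gamma> (PAnd \<phi> \<psi>) \<Longrightarrow> pra_proves \<Gamma> \<phi>"
| P_andE2: "pra_proves \<Gamma> (PAnd \<phi> \<psi>) \<Longrightarrow> pra_proves \<Gamma> \<psi>"
| P_orI1: "pfm_ok \<psi> \<Longrightarrow> pra_proves \<Gamma> \<phi> \<Longrightarrow> pra_proves \<Gamma> (POr \<phi> \<psi>)"
| P_orI2: "pfm_ok \<phi> \<Longrightarrow> pra_proves \<Gamma> \<psi> \<Longrightarrow> pra_proves \<Gamma> (POr \<phi> \<psi>)"
| P_orE:
    "pra_proves \<Gamma> (POr \<phi> \<psi>) \<Longrightarrow> pra_proves (\<phi> # \<Gamma>) \<chi> \<Longrightarrow> pra_proves (\<psi> # \<Gamma>) \<chi> \<Longrightarrow>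
     pra_proves \<Gamma> \<chi>"
| P_allNI: "pra_proves (map nlift \<Gamma>) \<phi> \<Longrightarrow> pra_proves \<Gamma> (PAllN \<phi>)"
| P_allNE: "pra_proves \<Gamma> (PAllN \<phi>) \<Longrightarrow> ntm_ok t \<Longrightarrow> pra_proves \<Gamma> (ninst \<phi> t)"
| P_exNI: "pfm_ok \<phi> \<Longrightarrow> ntm_ok t \<Longrightarrow> pra_proves \<Gamma> (ninst \<phi> t) \<Longrightarrow> pra_proves \<Gamma> (PExN \<phi>)"
| P_exNE:
    "pra_proves \<Gamma> (PExN \<phi>) \<Longrightarrow> pra_proves (\<phi> # map nlift \<Gamma>) (nlift \<psi>) \<Longrightarrow> pra_proves \<Gamma> \<psi>"
| P_allFI: "pra_proves (map (flift k) \<Gamma>) \<phi> \<Longrightarrow> pra_proves \<Gamma> (PAllF k \<phi>)"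
| P_allFE:
    "pra_proves \<Gamma> (PAllF k \<phi>) \<Longrightarrow> ftm_ok f \<Longrightarrow> farity f = k \<Longrightarrow> pra_proves \<Gamma> (finst \<phi> f)"
| P_exFI:
    "pfm_ok \<phi> \<Longrightarrow> ftm_ok f \<Longrightarrow> farity f = k \<Longrightarrow> pra_proves \<Gamma> (finst \<phi> f) \<Longrightarrow>
     pra_proves \<Gamma> (PExF k \<phi>)"
| P_exFE:
    "pra_proves \<Gamma> (PExF k \<phi>) \<Longrightarrow> pra_proves (\<phi> # map (flift k) \<Gamma>) (flift k \<psi>) \<Longrightarrow>
     pra_proves \<Gamma> \<psi>"
| P_refl: "ntm_ok t \<Longrightarrow> pra_proves \<Gamma> (PEq t t)"
| P_replace:
    "pfm_ok \<phi> \<Longrightarrow> pra_proves \<Gamma> (PEq s t) \<Longrightarrow> pra_proves \<Gamma> (ninst \<phi> s) \<Longrightarrow>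
     pra_proves \<Gamma> (ninst \<phi> t)"
| P_ext:
    "pfm_ok \<phi> \<Longrightarrow> ftm_ok f \<Longrightarrow> ftm_ok g \<Longrightarrow> farity f = k \<Longrightarrow> farity g = k \<Longrightarrow>
     xs = map NVar (rev [0..<k]) \<Longrightarrow> pra_proves \<Gamma> (PAllNs k (PEq (NApp f xs) (NApp g xs))) \<Longrightarrow>
     pra_proves \<Gamma> (finst \<phi> f) \<Longrightarrow> pra_proves \<Gamma> (finst \<phi> g)"


section \<open>Primitive recursive coding of addresses\<close>

text \<open>
  An address is a finite sequence of numbers, read from the root and coded by \<open>list_encode\<close>; the
  root is 0.  The value of each identifier is given by the lemmas at the end of this section.
\<close>

definition p_one :: prfl where "p_one = PComp PSucc [PZero]"
definition p_add :: prfl where "p_add = PRec (PProj 0) (PComp PSucc [PProj 1])"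
definition p_pred :: prfl where "p_pred = PRec PZero (PProj 0)"
definition p_sub :: prfl where  \<comment> \<open>maps \<open>n, x\<close> to the truncated difference \<open>x - n\<close>\<close>
  "p_sub = PRec (PProj 0) (PComp p_pred [PProj 1])"
definition p_is0 :: prfl where "p_is0 = PComp p_sub [PProj 0, p_one]"
definition p_tri :: prfl where
  "p_tri = PRec PZero (PComp p_add [PProj 1, PComp PSucc [PProj 0]])"
definition p_pair :: prfl where
  "p_pair = PComp p_add [PComp p_tri [PComp p_add [PProj 0, PProj 1]], PProj 0]"
definition p_diag :: prfl where  \<comment> \<open>the largest \<open>s\<close> with \<open>triangle s \<le> n\<close>\<close>
  "p_diag = PRec PZero
     (PComp p_add [PProj 1,
        PComp p_is0 [PComp p_sub [PComp PSucc [PProj 0], PComp p_tri [PComp PSucc [PProj 1]]]]])"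
definition p_fst :: prfl where "p_fst = PComp p_sub [PComp p_tri [p_diag], PProj 0]"
definition p_snd :: prfl where "p_snd = PComp p_sub [p_fst, p_diag]"
definition p_cons :: prfl where "p_cons = PComp PSucc [p_pair]"
definition p_hd :: prfl where "p_hd = PComp p_fst [p_pred]"
definition p_tl :: prfl where "p_tl = PComp p_snd [p_pred]"
definition p_drop :: prfl where "p_drop = PRec (PProj 0) (PComp p_tl [PProj 1])"
definition p_nth :: prfl where "p_nth = PComp p_hd [p_drop]"
definition p_segment :: prfl where  \<comment> \<open>maps \<open>m, n, xs\<close> to \<open>drop (n - m) (take n xs)\<close>\<close>
  "p_segment = PRec PZero
     (PComp p_cons
        [PComp p_nth [PComp p_sub [PComp PSucc [PProj 0], PProj 2], PProj 3], PProj 1])"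
definition p_take :: prfl where "p_take = PComp p_segment [PProj 0, PProj 0, PProj 1]"

text \<open>The intended meaning of the identifiers, for functions \<open>fs\<close> of the argument arities.\<close>

fun prfl_eval :: "(nat list \<Rightarrow> nat) list \<Rightarrow> prfl \<Rightarrow> nat list \<Rightarrow> nat" where
  "prfl_eval fs PZero xs = 0"
| "prfl_eval fs PSucc xs = Suc (hd xs)"
| "prfl_eval fs (PProj i) xs = xs ! i"
| "prfl_eval fs (PArg i) xs = (fs ! i) xs"
| "prfl_eval fs (PComp p qs) xs = prfl_eval fs p (map (\<lambda>q. prfl_eval fs q xs) qs)"
| "prfl_eval fs (PRec p q) xs =
     rec_nat (prfl_eval fs p (tl xs)) (\<lambda>n y. prfl_eval fs q (n # y # tl xs)) (hd xs)"


lemma eval_one: "prfl_eval fs p_one xs = 1"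
  by (simp add: p_one_def)

lemma eval_add: "prfl_eval fs p_add [m, n] = m + n"
  by (induction m) (simp_all add: p_add_def)

lemma eval_pred: "prfl_eval fs p_pred [n] = n - 1"
  by (cases n) (simp_all add: p_pred_def)

lemma eval_sub: "prfl_eval fs p_sub [n, m] = m - n"
  by (induction n) (simp_all add: p_sub_def eval_pred)

lemma eval_is0: "prfl_eval fs p_is0 [n] = (if n = 0 then 1 else 0)"
  by (simp add: p_is0_def eval_sub eval_one)

lemma eval_tri: "prfl_eval fs p_tri [n] = triangle n"
  by (induction n) (simp_all add: p_tri_def eval_add)

lemma eval_pair: "prfl_eval fs p_pair [m, n] = prod_encode (m, n)"
  by (simp add: p_pair_def eval_add eval_tri prod_encode_def)

lemma triangle_mono: "m \<le> n \<Longrightarrow> triangle m \<le> triangle n"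
  unfolding triangle_def by (intro div_le_mono mult_le_mono) simp_all

lemma eval_diag_bounds:
  "triangle (prfl_eval fs p_diag [n]) \<le> n \<and> n < triangle (Suc (prfl_eval fs p_diag [n]))"
proof (induction n)
  case 0
  then show ?case by (simp add: p_diag_def)
next
  case (Suc n)
  define s where "s = prfl_eval fs p_diag [n]"
  have "prfl_eval fs p_diag [Suc n] = s + (if triangle (Suc s) \<le> Suc n then 1 else 0)"
    by (simp add: p_diag_def s_def eval_add eval_is0 eval_sub eval_tri)
  with Suc show ?case by (auto simp: s_def[symmetric])
qed

lemma eval_diag: "prfl_eval fs p_diag [prod_encode (m, n)] = m + n"
proof -
  define s where "s = prfl_eval fs p_diag [prod_encode (m, n)]"
  have 1: "triangle s \<le> triangle (m + n) + m" "triangle (m + n) + m < triangle (Suc s)"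
    using eval_diag_bounds[of fs "prod_encode (m, n)"] by (simp_all add: s_def prod_encode_def)
  have "triangle (Suc (m + n)) > triangle (m + n) + m" by simp
  then have "s < Suc (m + n)"
    using 1 triangle_mono[of "Suc (m + n)" s] by (meson leD leI le_trans less_le_trans)
  moreover have "m + n < Suc s"
    using 1 triangle_mono[of "Suc s" "m + n"] by (meson leD leI le_add1 le_trans)
  ultimately show ?thesis by (simp add: s_def)
qed

lemma eval_fst: "prfl_eval fs p_fst [prod_encode (m, n)] = m"
  by (simp add: p_fst_def eval_sub eval_tri eval_diag) (simp add: prod_encode_def)

lemma eval_snd: "prfl_eval fs p_snd [prod_encode (m, n)] = n"
  by (simp add: p_snd_def eval_sub eval_fst eval_diag)

lemma eval_cons: "prfl_eval fs p_cons [i, list_encode xs] = list_encode (i # xs)"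
  by (simp add: p_cons_def eval_pair)

lemma eval_hd: "prfl_eval fs p_hd [list_encode (i # xs)] = i"
  by (simp add: p_hd_def eval_pred eval_fst)

lemma eval_tl: "prfl_eval fs p_tl [list_encode xs] = list_encode (tl xs)"
proof (cases xs)
  case Nil
  have "prfl_eval fs p_snd [0] = 0"
    using eval_snd[of fs 0 0] by (simp add: prod_encode_def)
  with Nil show ?thesis by (simp add: p_tl_def eval_pred)
next
  case (Cons i ys)
  then show ?thesis by (simp add: p_tl_def eval_pred eval_snd)
qed

lemma eval_drop: "prfl_eval fs p_drop [n, list_encode xs] = list_encode (drop n xs)"
proof (induction n)
  case 0
  then show ?case by (simp add: p_drop_def)
next
  case (Suc n)
  then show ?case by (simp add: p_drop_def eval_tl tl_drop drop_Suc)
qed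

lemma eval_nth:
  assumes "n < length xs"
  shows "prfl_eval fs p_nth [n, list_encode xs] = xs ! n"
proof -
  have "prfl_eval fs p_nth [n, list_encode xs] =
      prfl_eval fs p_hd [list_encode (xs ! n # drop (Suc n) xs)]"
    using assms by (simp add: p_nth_def eval_drop Cons_nth_drop_Suc del: list_encode.simps)
  then show ?thesis by (simp only: eval_hd)
qed

lemma eval_segment:
  assumes "n \<le> length xs" "m \<le> n"
  shows "prfl_eval fs p_segment [m, n, list_encode xs] = list_encode (drop (n - m) (take n xs))"
  using assms(2)
proof (induction m)
  case 0
  then show ?case by (simp add: p_segment_def)
next
  case (Suc m)
  have "prfl_eval fs p_segment [Suc m, n, list_encode xs] =
      prfl_eval fs p_cons [prfl_eval fs p_nth [n - Suc m, list_encode xs],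
        prfl_eval fs p_segment [m, n, list_encode xs]]"
    by (simp add: p_segment_def eval_sub)
  also have "\<dots> = list_encode (xs ! (n - Suc m) # drop (n - m) (take n xs))"
    using Suc assms by (simp only: Suc_leD eval_cons) (subst eval_nth, auto)
  also have "xs ! (n - Suc m) # drop (n - m) (take n xs) = drop (n - Suc m) (take n xs)"
    using Suc assms Cons_nth_drop_Suc[of "n - Suc m" "take n xs"]
    by (simp add: Suc_diff_Suc Suc_le_lessD)
  finally show ?case .
qed

lemma eval_take:
  "n \<le> length xs \<Longrightarrow> prfl_eval fs p_take [n, list_encode xs] = list_encode (take n xs)"
  using eval_segment[of n xs n fs] by (simp add: p_take_def)

lemma prfl_ok_coding:
  "prfl_ok [] 2 p_take" "prfl_ok [] 2 p_nth" "prfl_ok [] 2 p_drop" "prfl_ok [] 2 p_cons"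
  "prfl_ok [] 2 p_sub"
  by (auto simp: p_take_def p_segment_def p_nth_def p_drop_def p_cons_def p_pair_def p_tri_def
      p_add_def p_sub_def p_hd_def p_tl_def p_fst_def p_snd_def p_diag_def p_is0_def p_one_def
      p_pred_def nth_Cons')


section \<open>Hyper-terms\<close>

text \<open>
  The code of a constructor \<open>c\<close> is the parameter \<open>sharp c\<close>.  The formula \<open>Adr\<close> says of a function
  term \<open>g\<close> and a number \<open>a = list_encode [i\<^sub>0,\<dots>,i\<^sub>l\<^sub>-\<^sub>1]\<close>, free of the quantified variable 0, that \<open>a\<close> is an
  address of the tree represented by \<open>g\<close>: for all \<open>n < l\<close>, \<open>g\<close> has at \<open>list_encode [i\<^sub>0,\<dots>,i\<^sub>n\<^sub>-\<^sub>1]\<close> the code of a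
  constructor whose arity exceeds \<open>i\<^sub>n\<close>.  The condition \<open>n < l\<close> is expressed by
  \<open>drop n a \<noteq> 0\<close>, and the redundant bound \<open>n < a\<close> makes the quantifier bounded.  The values of \<open>g\<close>
  outside the addresses are irrelevant.
\<close>

definition nlift_tm :: "ntm \<Rightarrow> ntm" where
  "nlift_tm t = ntm_subst (\<lambda>n. NVar (Suc n)) FVar t"

definition Adr :: "'c vocabulary \<Rightarrow> ('c \<Rightarrow> nat) \<Rightarrow> ftm \<Rightarrow> ntm \<Rightarrow> pfm" where
  "Adr V sharp g a =
     (let n = NVar 0; a' = nlift_tm a in
      PAllN
        (PImp (PEq (Papp p_sub [a', NSuc n]) NZero)
        (PImp (PNot (PEq (Papp p_drop [n, a']) NZero))
          (PDisj (map (\<lambda>c.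
             PAnd (PEq (NApp g [Papp p_take [n, a']]) (numeral_tm (sharp c)))
                  (PEq (Papp p_sub [numeral_tm (arity V c), NSuc (Papp p_nth [n, a'])]) NZero))
             (ctors V))))))"

definition Htm :: "'c vocabulary \<Rightarrow> ('c \<Rightarrow> nat) \<Rightarrow> ftm \<Rightarrow> pfm" where
  "Htm V sharp g =
     PAllN (PImp (Adr V sharp g (NVar 0))
       (PDisj (map (\<lambda>c. PEq (NApp g [NVar 0]) (numeral_tm (sharp c))) (ctors V))))"

text \<open>For functions \<open>g\<close> and \<open>h\<close> representing hyper-terms: they represent the same hyper-term.\<close>

definition SameHtm :: "'c vocabulary \<Rightarrow> ('c \<Rightarrow> nat) \<Rightarrow> ftm \<Rightarrow> ftm \<Rightarrow> pfm" where
  "SameHtm V sharp g h =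
     PAllN (PImp (Adr V sharp g (NVar 0)) (PEq (NApp g [NVar 0]) (NApp h [NVar 0])))"


section \<open>The interpretation\<close>

text \<open>
  A translation is determined by primitive recursive functionals \<open>K c\<close> interpreting the
  constructors, a primitive recursive functional \<open>N\<close> mapping all unary functions
  to functions that represent hyper-terms, and formulas \<open>T D\<close> interpreting the type-identifiers,
  with the unary function variable of index 0 as argument place.  A program-function identifier is
  interpreted by the functional variable of the same name; since a functional need not
  map hyper-terms to hyper-terms, nor respect different representations of a hyper-term, its
  arguments and value are normalized by \<open>N\<close>.
\<close>

fun tr_tm :: "('c \<Rightarrow> prfl) \<Rightarrow> prfl \<Rightarrow> 'c itm \<Rightarrow> ftm" where
  "tr_tm K N (IVar n) = FVar 1 n"
| "tr_tm K N (Con c ts) = Prim (K c) (replicate (length ts) 1) 1 (map (tr_tm K N) ts)"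
| "tr_tm K N (Fn f ts) =
     Prim N [1] 1
       [Fnl f (replicate (length ts) 1) 1 (map (\<lambda>t. Prim N [1] 1 [tr_tm K N t]) ts)]"

primrec tr_fm ::
  "'c vocabulary \<Rightarrow> ('c \<Rightarrow> nat) \<Rightarrow> ('c \<Rightarrow> prfl) \<Rightarrow> prfl \<Rightarrow> ('d \<Rightarrow> pfm) \<Rightarrow> ('c, 'd) ifm \<Rightarrow> pfm" where
  "tr_fm V sharp K N T IFalse = PFalse"
| "tr_fm V sharp K N T (IEq s t) = SameHtm V sharp (tr_tm K N s) (tr_tm K N t)"
| "tr_fm V sharp K N T (ITy D t) = finst (T D) (tr_tm K N t)"
| "tr_fm V sharp K N T (IImp \<phi> \<psi>) = PImp (tr_fm V sharp K N T \<phi>) (tr_fm V sharp K N T \<psi>)"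
| "tr_fm V sharp K N T (IAnd \<phi> \<psi>) = PAnd (tr_fm V sharp K N T \<phi>) (tr_fm V sharp K N T \<psi>)"
| "tr_fm V sharp K N T (IOr \<phi> \<psi>) = POr (tr_fm V sharp K N T \<phi>) (tr_fm V sharp K N T \<psi>)"
| "tr_fm V sharp K N T (IAll \<phi>) =
     PAllF 1 (PImp (Htm V sharp (FVar 1 0)) (tr_fm V sharp K N T \<phi>))"
| "tr_fm V sharp K N T (IEx \<phi>) =
     PExF 1 (PAnd (Htm V sharp (FVar 1 0)) (tr_fm V sharp K N T \<phi>))"

text \<open>
  \<open>K c\<close> maps \<open>g\<^sub>0,\<dots>,g\<^sub>r\<^sub>-\<^sub>1\<close> to the tree with \<open>c\<close> at the root and immediate subtrees \<open>g\<^sub>0,\<dots>,g\<^sub>r\<^sub>-\<^sub>1\<close>.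
\<close>

definition interprets_constructor ::
  "'c vocabulary \<Rightarrow> ('c \<Rightarrow> nat) \<Rightarrow> 'c \<Rightarrow> prfl \<Rightarrow> bool" where
  "interprets_constructor V sharp c p \<longleftrightarrow>
     (let r = arity V c; h = Prim p (replicate r 1) 1 (map (FVar 1) [0..<r]) in
      prfl_ok (replicate r 1) 1 p \<and>
      pra_proves [] (PEq (NApp h [NZero]) (numeral_tm (sharp c))) \<and>
      (\<forall>i < r. pra_proves []
         (PAllN (PEq (NApp h [Papp p_cons [numeral_tm i, NVar 0]]) (NApp (FVar 1 i) [NVar 0])))))"

definition normalizes :: "'c vocabulary \<Rightarrow> ('c \<Rightarrow> nat) \<Rightarrow> prfl \<Rightarrow> bool" where
  "normalizes V sharp p \<longleftrightarrow>
     (let g = FVar 1 0; h = Prim p [1] 1 [g] in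
      prfl_ok [1] 1 p \<and>
      pra_proves [] (Htm V sharp h) \<and>
      pra_proves [] (PImp (Htm V sharp g) (SameHtm V sharp h g)))"

definition interpretation_of ::
  "'c vocabulary \<Rightarrow> ('c, 'd) ty_bundle list \<Rightarrow> ('c \<Rightarrow> nat) \<Rightarrow>
   ('c \<Rightarrow> prfl) \<Rightarrow> prfl \<Rightarrow> ('d \<Rightarrow> pfm) \<Rightarrow> bool" where
  "interpretation_of V S sharp K N T \<longleftrightarrow>
     (\<forall>c \<in> set (ctors V). interprets_constructor V sharp c (K c)) \<and>
     normalizes V sharp N \<and>
     (\<forall>D \<in> types S. pfm_ok (T D) \<and> pfm_fv (T D) \<subseteq> {FunV 1 0})"

end

theory Submission
  imports Defs "HOL-Library.Countable_Set"
begin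

text \<open>
  Provability in \<open>PRA\<^sup>*\<close> is reduced to truth in all its models by a completeness theorem, so that the
  axioms of the intrinsic theory can be verified inside an arbitrary, possibly nonstandard, model.

  In the absence of comprehension and choice a coinductive type cannot be defined by the existence of an infinite
  derivation.  Instead a type is approximated at every depth \<open>n\<close> by derivations that are correct up
  to depth \<open>n\<close>: an inductive type is the union of its approximations, which increase with \<open>n\<close>, and
  a coinductive type the intersection of its approximations, which decrease.  The approximation at
  \<open>n + 1\<close> arises from that at \<open>n\<close> by one application of the rules, whence Induction and Coinduction
  follow by induction on \<open>n\<close>.  The deconstruction rule needs one and the same disjunct for all \<open>n\<close>; it
  exists by the pigeonhole principle because there are finitely many.
\<close>

text \<open>The depth \<open>n\<close> ranges over all numbers of a model, nonstandard ones
  included, so the approximation at \<open>n\<close> is not obtained by unfolding the rules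
  \<open>n\<close> times: one formula with \<open>n\<close> as a variable must define all of them.
  This is why it quantifies over a decoration, a function that labels addresses by codes of types. A
  tree whose subtrees are decorated is decorated by gluing finitely many functions under a root,
  which a primitive recursive functional does, because the arity of a constructor is a genuine
  natural number.

  Induction in a model is available only for properties defined by a formula. Hence most inductive
  claims come with a formula \<open>?\<phi>\<close> and an equivalence \<open>sat\<close> for its
  meaning, and pairing and list codes are developed again from their recursion equations. The
  numbers of rules, constructors and arguments remain genuine; over these, witnesses may be chosen
  and maxima taken outside the model.

  Hyper-terms are equal if they agree on addresses, so every notion must be invariant under
  \<open>same\<close>. Free functionals become so because normalization maps representations of the
  same hyper-term to one and the same function.\<close>

instance prfl :: countable by countable_datatype
instance ftm :: countable by countable_datatype
instance ntm :: countable by countable_datatype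
instance pfm :: countable by countable_datatype

section \<open>Substitution\<close>

lemma ftm_subst_FVar [simp]: "ftm_subst FVar f = f"
  by (induction f) (auto simp: map_idI)

lemma ntm_subst_id [simp]: "ntm_subst NVar FVar t = t"
  by (induction t) (auto simp: map_idI)

lemma ftm_subst_subst:
  "ftm_subst \<tau> (ftm_subst \<tau>' f) = ftm_subst (\<lambda>k n. ftm_subst \<tau> (\<tau>' k n)) f"
  by (induction f) auto

lemma ntm_subst_subst:
  "ntm_subst \<sigma> \<tau> (ntm_subst \<sigma>' \<tau>' t) =
   ntm_subst (\<lambda>n. ntm_subst \<sigma> \<tau> (\<sigma>' n)) (\<lambda>k n. ftm_subst \<tau> (\<tau>' k n)) t"
  by (induction t) (auto simp: ftm_subst_subst)

lemma nup_NVar [simp]: "nup NVar = NVar"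
  by (rule ext) (simp add: nup_def split: nat.split)

lemma fup_FVar [simp]: "fup k FVar = FVar"
  by (intro ext) (simp add: fup_def fren_def split: nat.split)

lemma pfm_subst_id [simp]: "pfm_subst NVar FVar \<phi> = \<phi>"
  by (induction \<phi>) auto

lemma nup_comp:
  "nup (\<lambda>n. ntm_subst \<sigma> \<tau> (\<sigma>' n)) = (\<lambda>n. ntm_subst (nup \<sigma>) \<tau> (nup \<sigma>' n))"
  by (rule ext) (simp add: nup_def ntm_subst_subst split: nat.split)

lemma ftm_subst_cong:
  "(\<And>k n. FunV k n \<in> ftm_fv f \<Longrightarrow> \<tau> k n = \<tau>' k n) \<Longrightarrow> ftm_subst \<tau> f = ftm_subst \<tau>' f"
  by (induction f) auto

lemma ntm_subst_cong:
  "(\<And>n. NumV n \<in> ntm_fv t \<Longrightarrow> \<sigma> n = \<sigma>' n) \<Longrightarrow>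
   (\<And>k n. FunV k n \<in> ntm_fv t \<Longrightarrow> \<tau> k n = \<tau>' k n) \<Longrightarrow> ntm_subst \<sigma> \<tau> t = ntm_subst \<sigma>' \<tau>' t"
proof (induction t)
  case (NApp f ts)
  have "ftm_subst \<tau> f = ftm_subst \<tau>' f"
    by (rule ftm_subst_cong) (auto intro: NApp.prems)
  moreover have "map (ntm_subst \<sigma> \<tau>) ts = map (ntm_subst \<sigma>' \<tau>') ts"
    by (auto intro!: NApp.IH NApp.prems)
  ultimately show ?case by simp
qed auto

lemma ftm_subst_fup_ren:
  "ftm_subst (fup k \<tau>) (ftm_subst (fren k) f) = ftm_subst (fren k) (ftm_subst \<tau> f)"
  unfolding ftm_subst_subst by (rule ftm_subst_cong) (simp add: fren_def fup_def)

lemma fup_comp: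
  "fup k (\<lambda>j n. ftm_subst \<tau> (\<tau>' j n)) = (\<lambda>j n. ftm_subst (fup k \<tau>) (fup k \<tau>' j n))"
  by (intro ext)
    (auto simp: fup_def[of k \<tau>'] fup_def[of k "\<lambda>j n. ftm_subst \<tau> (\<tau>' j n)"] fup_def[of k \<tau> k 0]
      ftm_subst_fup_ren split: nat.split)

lemma pfm_subst_subst:
  "pfm_subst \<sigma> \<tau> (pfm_subst \<sigma>' \<tau>' \<phi>) =
   pfm_subst (\<lambda>n. ntm_subst \<sigma> \<tau> (\<sigma>' n)) (\<lambda>k n. ftm_subst \<tau> (\<tau>' k n)) \<phi>"
proof (induction \<phi> arbitrary: \<sigma> \<tau> \<sigma>' \<tau>')
  case (PAllF k \<phi>)
  show ?case
    by (simp add: PAllF fup_comp ntm_subst_subst)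
       (intro arg_cong2[where f = "\<lambda>a b. pfm_subst a b \<phi>"] ext refl ntm_subst_cong;
         simp add: fup_def fren_def)
next
  case (PExF k \<phi>)
  show ?case
    by (simp add: PExF fup_comp ntm_subst_subst)
       (intro arg_cong2[where f = "\<lambda>a b. pfm_subst a b \<phi>"] ext refl ntm_subst_cong;
         simp add: fup_def fren_def)
qed (auto simp: ntm_subst_subst nup_comp)

lemma pfm_subst_cong:
  "(\<And>n. NumV n \<in> pfm_fv \<phi> \<Longrightarrow> \<sigma> n = \<sigma>' n) \<Longrightarrow>
   (\<And>k n. FunV k n \<in> pfm_fv \<phi> \<Longrightarrow> \<tau> k n = \<tau>' k n) \<Longrightarrow> pfm_subst \<sigma> \<tau> \<phi> = pfm_subst \<sigma>' \<tau>' \<phi>"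
proof (induction \<phi> arbitrary: \<sigma> \<tau> \<sigma>' \<tau>')
  case (PEq s t)
  then show ?case by (auto intro!: ntm_subst_cong)
next
  case (PImp \<phi>1 \<phi>2)
  show ?case using PImp.prems by (auto intro!: PImp.IH)
next
  case (PAnd \<phi>1 \<phi>2)
  show ?case using PAnd.prems by (auto intro!: PAnd.IH)
next
  case (POr \<phi>1 \<phi>2)
  show ?case using POr.prems by (auto intro!: POr.IH)
next
  case (PAllN \<phi>)
  show ?case using PAllN.prems by (auto intro!: PAllN.IH simp: nup_def split: nat.split)
next
  case (PExN \<phi>)
  show ?case using PExN.prems by (auto intro!: PExN.IH simp: nup_def split: nat.split)
next
  case (PAllF k \<phi>)
  show ?case using PAllF.prems
    by (auto intro!: PAllF.IH simp: fup_def split: nat.split)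
next
  case (PExF k \<phi>)
  show ?case using PExF.prems
    by (auto intro!: PExF.IH simp: fup_def split: nat.split)
qed auto

text \<open>Arities must be preserved besides well-formedness: applications compare them, and
  \<open>finst\<close> reads the arity of the variable to be replaced off the inserted term.\<close>

definition subst_ok :: "(nat \<Rightarrow> ntm) \<Rightarrow> (nat \<Rightarrow> nat \<Rightarrow> ftm) \<Rightarrow> bool" where
  "subst_ok \<sigma> \<tau> \<longleftrightarrow> (\<forall>n. ntm_ok (\<sigma> n)) \<and> (\<forall>k n. ftm_ok (\<tau> k n) \<and> farity (\<tau> k n) = k)"

lemma farity_subst [simp]: "(\<And>k n. farity (\<tau> k n) = k) \<Longrightarrow> farity (ftm_subst \<tau> f) = farity f"
  by (cases f) auto

lemma ftm_ok_subst:
  assumes "\<And>k n. farity (\<tau> k n) = k" "\<And>k n. ftm_ok (\<tau> k n)"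
  shows "ftm_ok f \<Longrightarrow> ftm_ok (ftm_subst \<tau> f)"
  by (induction f) (auto simp: assms)

lemma ntm_ok_subst: "subst_ok \<sigma> \<tau> \<Longrightarrow> ntm_ok t \<Longrightarrow> ntm_ok (ntm_subst \<sigma> \<tau> t)"
  by (induction t) (auto simp: subst_ok_def ftm_ok_subst)

lemma fren_ok [simp]: "farity (fren k j n) = j" "ftm_ok (fren k j n)"
  by (auto simp: fren_def)

lemma subst_ok_nup: "subst_ok \<sigma> \<tau> \<Longrightarrow> subst_ok (nup \<sigma>) \<tau>"
  using ntm_ok_subst[of "\<lambda>i. NVar (Suc i)" FVar]
  by (auto simp: subst_ok_def nup_def split: nat.split)

lemma subst_ok_fup:
  "subst_ok \<sigma> \<tau> \<Longrightarrow> subst_ok (\<lambda>n. ntm_subst NVar (fren k) (\<sigma> n)) (fup k \<tau>)"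
  using ntm_ok_subst[of NVar "fren k"]
  by (auto simp: subst_ok_def fup_def ftm_ok_subst split: nat.split)

lemma pfm_ok_subst: "subst_ok \<sigma> \<tau> \<Longrightarrow> pfm_ok \<phi> \<Longrightarrow> pfm_ok (pfm_subst \<sigma> \<tau> \<phi>)"
  by (induction \<phi> arbitrary: \<sigma> \<tau>) (auto simp: ntm_ok_subst subst_ok_nup subst_ok_fup)

lemma subst_ok_inst [simp]:
  "subst_ok NVar FVar" "subst_ok (\<lambda>n. NVar (Suc n)) FVar" "subst_ok NVar (fren k)"
  "ntm_ok t \<Longrightarrow> subst_ok (\<lambda>n. case n of 0 \<Rightarrow> t | Suc m \<Rightarrow> NVar m) FVar"
  "ftm_ok f \<Longrightarrow> subst_ok NVar
     (\<lambda>k n. if k = farity f then (case n of 0 \<Rightarrow> f | Suc m \<Rightarrow> FVar k m) else FVar k n)"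
  by (auto simp: subst_ok_def split: nat.split)

lemma pfm_ok_inst [simp]:
  "pfm_ok \<phi> \<Longrightarrow> ntm_ok t \<Longrightarrow> pfm_ok (ninst \<phi> t)"
  "pfm_ok \<phi> \<Longrightarrow> ftm_ok f \<Longrightarrow> pfm_ok (finst \<phi> f)"
  "pfm_ok \<phi> \<Longrightarrow> pfm_ok (nlift \<phi>)" "pfm_ok \<phi> \<Longrightarrow> pfm_ok (flift k \<phi>)"
  by (auto simp: ninst_def finst_def nlift_def flift_def intro!: pfm_ok_subst)

lemma Papp_subst [simp]: "ntm_subst \<sigma> \<tau> (Papp p ts) = Papp p (map (ntm_subst \<sigma> \<tau>) ts)"
  by (simp add: Papp_def)

lemma NZero_subst [simp]: "ntm_subst \<sigma> \<tau> NZero = NZero"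
  by (simp add: NZero_def)

lemma NSuc_subst [simp]: "ntm_subst \<sigma> \<tau> (NSuc t) = NSuc (ntm_subst \<sigma> \<tau> t)"
  by (simp add: NSuc_def)

lemma numeral_subst [simp]: "ntm_subst \<sigma> \<tau> (numeral_tm n) = numeral_tm n"
  by (induction n) auto

lemma NZero_ok [simp]: "ntm_ok NZero" and NSuc_ok [simp]: "ntm_ok (NSuc t) = ntm_ok t"
  and numeral_ok [simp]: "ntm_ok (numeral_tm n)"
proof -
  show 1: "ntm_ok NZero" "ntm_ok (NSuc t) = ntm_ok t" for t
    by (auto simp: NZero_def NSuc_def Papp_def)
  show "ntm_ok (numeral_tm n)" by (induction n) (auto simp: 1)
qed

lemma ninst_subst:
  "pfm_subst \<sigma> \<tau> (ninst \<phi> t) = ninst (pfm_subst (nup \<sigma>) \<tau> \<phi>) (ntm_subst \<sigma> \<tau> t)"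
  unfolding ninst_def pfm_subst_subst
  by (rule pfm_subst_cong) (auto simp: nup_def ntm_subst_subst split: nat.split)

lemma nlift_subst: "pfm_subst (nup \<sigma>) \<tau> (nlift \<phi>) = nlift (pfm_subst \<sigma> \<tau> \<phi>)"
  unfolding nlift_def pfm_subst_subst by (rule pfm_subst_cong) (auto simp: nup_def)

lemma flift_subst:
  "pfm_subst (\<lambda>n. ntm_subst NVar (fren k) (\<sigma> n)) (fup k \<tau>) (flift k \<phi>) =
   flift k (pfm_subst \<sigma> \<tau> \<phi>)"
  unfolding flift_def pfm_subst_subst
  by (rule pfm_subst_cong) (auto simp: fup_def fren_def)

lemma finst_subst:
  assumes "\<And>k n. farity (\<tau> k n) = k" "farity f = k"
  shows "pfm_subst \<sigma> \<tau> (finst \<phi> f) =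
    finst (pfm_subst (\<lambda>n. ntm_subst NVar (fren k) (\<sigma> n)) (fup k \<tau>) \<phi>) (ftm_subst \<tau> f)"
proof -
  have *: "ftm_subst (\<lambda>j n. if j = k then (case n of 0 \<Rightarrow> g | Suc m \<Rightarrow> FVar j m) else FVar j n)
      (ftm_subst (fren k) h) = h" for g h
    unfolding ftm_subst_subst
    by (rule trans[OF ftm_subst_cong ftm_subst_FVar]) (auto simp: fren_def)
  have **: "ntm_subst NVar (\<lambda>j n. if j = k then (case n of 0 \<Rightarrow> g | Suc m \<Rightarrow> FVar j m) else FVar j n)
      (ntm_subst NVar (fren k) h) = h" for g h
    unfolding ntm_subst_subst
    by (rule trans[OF ntm_subst_cong ntm_subst_id]) (auto simp: fren_def)
  show ?thesis
    unfolding finst_def pfm_subst_subst using assms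
    by (intro pfm_subst_cong) (auto simp: fup_def * ** split: nat.split)
qed

section \<open>Derivations\<close>

lemma NumV_notin_ftm_fv [simp]: "NumV n \<notin> ftm_fv f"
  by (induction f) auto

lemma NumV_in_ntm_fv_subst: "NumV n \<in> ntm_fv (ntm_subst NVar \<tau> t) \<longleftrightarrow> NumV n \<in> ntm_fv t"
  by (induction t) auto

lemma nup_pow_less: "i < k \<Longrightarrow> (nup ^^ k) \<sigma> i = NVar i"
proof (induction k arbitrary: i)
  case (Suc k)
  then show ?case by (cases i) (auto simp: nup_def)
qed auto

lemma subst_PAllNs: "pfm_subst \<sigma> \<tau> (PAllNs k \<phi>) = PAllNs k (pfm_subst ((nup ^^ k) \<sigma>) \<tau> \<phi>)"
proof -
  have "pfm_subst \<sigma> \<tau> ((PAllN ^^ k) \<phi>) = (PAllN ^^ k) (pfm_subst ((nup ^^ k) \<sigma>) \<tau> \<phi>)" for \<sigma>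
    by (induction k arbitrary: \<sigma>) (auto simp: funpow_swap1[of nup])
  then show ?thesis by (simp add: PAllNs_def)
qed

lemma pfm_ok_PAllNs [simp]: "pfm_ok (PAllNs k \<phi>) = pfm_ok \<phi>"
proof -
  have "pfm_ok ((PAllN ^^ k) \<phi>) = pfm_ok \<phi>" by (induction k) auto
  then show ?thesis by (simp add: PAllNs_def)
qed

text \<open>Every scheme ranges over arbitrary well-formed terms or formulas, so a substitution
  leads to another instance of it. Only the two schemes with bound variables require pushing the
  substitution under quantifiers.\<close>

lemma pra_axiom_subst:
  assumes "pra_axiom \<phi>" and ok: "subst_ok \<sigma> \<tau>"
  shows "pra_axiom (pfm_subst \<sigma> \<tau> \<phi>)"
proof -
  have [simp]: "farity (ftm_subst \<tau> f) = farity f" for f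
    using ok by (simp add: subst_ok_def)
  then have [simp]: "farity \<circ> ftm_subst \<tau> = farity" by auto
  from assms(1) show ?thesis
  proof cases
    case (def_zero ks m fs ts)
    with ntm_ok_subst[OF ok, of "NApp (Prim PZero ks m fs) ts"] show ?thesis
      by (auto intro: pra_axiom.def_zero)
  next
    case (def_succ ks fs t)
    with ntm_ok_subst[OF ok, of "NApp (Prim PSucc ks 1 fs) [t]"] have "pra_axiom (PEq (NApp (Prim PSucc ks 1 (map (ftm_subst \<tau>) fs)) [ntm_subst \<sigma> \<tau> t])
      (NSuc (ntm_subst \<sigma> \<tau> t)))"
      by (intro pra_axiom.def_succ) auto
    with def_succ show ?thesis by simp
  next
    case (def_proj i ks m fs ts)
    with ntm_ok_subst[OF ok, of "NApp (Prim (PProj i) ks m fs) ts"]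
    have "pra_axiom (PEq (NApp (Prim (PProj i) ks m (map (ftm_subst \<tau>) fs)) (map (ntm_subst \<sigma> \<tau>) ts))
      (map (ntm_subst \<sigma> \<tau>) ts ! i))"
      by (intro pra_axiom.def_proj) auto
    with def_proj show ?thesis by auto
  next
    case (def_arg i ks m fs ts)
    with ntm_ok_subst[OF ok, of "NApp (Prim (PArg i) ks m fs) ts"]
    have "pra_axiom (PEq (NApp (Prim (PArg i) ks m (map (ftm_subst \<tau>) fs)) (map (ntm_subst \<sigma> \<tau>) ts))
      (NApp (map (ftm_subst \<tau>) fs ! i) (map (ntm_subst \<sigma> \<tau>) ts)))"
      by (intro pra_axiom.def_arg) auto
    with def_arg show ?thesis by auto
  next
    case (def_comp p qs ks m fs ts)
    with ntm_ok_subst[OF ok, of "NApp (Prim (PComp p qs) ks m fs) ts"]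
    have "pra_axiom (pfm_subst \<sigma> \<tau> (PEq (NApp (Prim (PComp p qs) ks m fs) ts)
         (NApp (Prim p ks (length qs) fs) (map (\<lambda>q. NApp (Prim q ks m fs) ts) qs))))"
      using pra_axiom.def_comp[of p qs ks m "map (ftm_subst \<tau>) fs" "map (ntm_subst \<sigma> \<tau>) ts"]
      by (simp add: comp_def)
    with def_comp show ?thesis by simp
  next
    case (def_rec_zero p q ks m fs ts)
    with ntm_ok_subst[OF ok, of "NApp (Prim (PRec p q) ks (Suc m) fs) (NZero # ts)"] show ?thesis
      by (auto intro!: pra_axiom.def_rec_zero)
  next
    case (def_rec_succ p q ks m fs t ts)
    with ntm_ok_subst[OF ok, of "NApp (Prim (PRec p q) ks (Suc m) fs) (NSuc t # ts)"] show ?thesis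
      by (auto intro!: pra_axiom.def_rec_succ)
  next
    case (succ_injective s t)
    with ntm_ok_subst[OF ok] show ?thesis by (auto intro!: pra_axiom.succ_injective)
  next
    case (succ_nonzero t)
    with ntm_ok_subst[OF ok] show ?thesis by (auto intro!: pra_axiom.succ_nonzero)
  next
    case (nat_induction \<phi>)
    let ?s = "\<lambda>n. case n of 0 \<Rightarrow> NSuc (NVar 0) | Suc m \<Rightarrow> NVar (Suc m)"
    have "pfm_subst (nup \<sigma>) \<tau> (pfm_subst ?s FVar \<phi>) = pfm_subst ?s FVar (pfm_subst (nup \<sigma>) \<tau> \<phi>)"
      unfolding pfm_subst_subst
      by (rule pfm_subst_cong) (auto simp: nup_def ntm_subst_subst split: nat.split)
    with nat_induction show ?thesis
      using pra_axiom.nat_induction[OF pfm_ok_subst[OF subst_ok_nup[OF ok], of \<phi>]]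
      by (simp add: ninst_subst)
  next
    case (explicit_definition t k)
    \<comment> \<open>All numeric variables of \<open>t\<close> are below \<open>k\<close>, hence
      bound by the displayed quantifiers. Under these the substitution fixes them, and the resulting
      instance is that of the term \<open>ntm_subst NVar \<tau> t\<close>.\<close>
    let ?s = "(nup ^^ k) (\<lambda>n. ntm_subst NVar (fren k) (\<sigma> n))"
    have 1: "ntm_subst ?s (fup k \<tau>) (ntm_subst NVar (fren k) t) =
        ntm_subst NVar (fren k) (ntm_subst NVar \<tau> t)"
      unfolding ntm_subst_subst
      by (rule ntm_subst_cong) (auto simp: nup_pow_less explicit_definition fup_def fren_def)
    have 2: "map (ntm_subst ?s (fup k \<tau>)) (map NVar (rev [0..<k])) = map NVar (rev [0..<k])"
      by (auto simp: nup_pow_less)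
    have "pra_axiom (PExF k (PAllNs k (PEq (NApp (FVar k 0) (map NVar (rev [0..<k])))
       (ntm_subst NVar (fren k) (ntm_subst NVar \<tau> t)))))"
      using explicit_definition ok
      by (intro pra_axiom.explicit_definition ntm_ok_subst)
         (auto simp: NumV_in_ntm_fv_subst subst_ok_def)
    then show ?thesis
      by (simp add: explicit_definition(1) subst_PAllNs 1 2 fup_def[of k \<tau> k 0] del: map_map)
  qed
qed

lemma map_nlift_subst:
  "map (pfm_subst (nup \<sigma>) \<tau>) (map nlift \<Gamma>) = map nlift (map (pfm_subst \<sigma> \<tau>) \<Gamma>)"
  by (simp add: nlift_subst)

lemma map_flift_subst:
  "map (pfm_subst (\<lambda>n. ntm_subst NVar (fren k) (\<sigma> n)) (fup k \<tau>)) (map (flift k) \<Gamma>) =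
   map (flift k) (map (pfm_subst \<sigma> \<tau>) \<Gamma>)"
  by (simp add: flift_subst)

text \<open>Serves to rename variables: a free variable in the role of a Henkin constant is turned
  into the eigenvariable of an elimination rule.\<close>

lemma pra_proves_subst:
  "pra_proves \<Gamma> \<phi> \<Longrightarrow> subst_ok \<sigma> \<tau> \<Longrightarrow> pra_proves (map (pfm_subst \<sigma> \<tau>) \<Gamma>) (pfm_subst \<sigma> \<tau> \<phi>)"
proof (induction arbitrary: \<sigma> \<tau> rule: pra_proves.induct)
  case (P_axiom \<phi> \<Gamma>)
  then show ?case by (intro pra_proves.P_axiom pra_axiom_subst)
next
  case (P_hyp \<phi> \<Gamma>)
  then show ?case by (intro pra_proves.P_hyp pfm_ok_subst) auto
next
  case (P_classical \<phi> \<Gamma>)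
  show ?case
    by (rule pra_proves.P_classical[OF pfm_ok_subst[OF P_classical.prems P_classical.hyps(1)]
        P_classical.IH[OF P_classical.prems, simplified]])
next
  case (P_impI \<phi> \<Gamma> \<psi>)
  show ?case
    using pra_proves.P_impI[OF pfm_ok_subst[OF P_impI.prems P_impI.hyps(1)]
        P_impI.IH[OF P_impI.prems, simplified]] by simp
next
  case (P_impE \<Gamma> \<phi> \<psi>)
  show ?case
    by (rule pra_proves.P_impE[OF P_impE.IH(1)[OF P_impE.prems, simplified] P_impE.IH(2)[OF P_impE.prems]])
next
  case (P_andI \<Gamma> \<phi> \<psi>)
  show ?case
    using pra_proves.P_andI[OF P_andI.IH[OF P_andI.prems]] by simp
next
  case (P_andE1 \<Gamma> \<phi> \<psi>)
  show ?case by (rule pra_proves.P_andE1[OF P_andE1.IH[OF P_andE1.prems, simplified]])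
next
  case (P_andE2 \<Gamma> \<phi> \<psi>)
  show ?case by (rule pra_proves.P_andE2[OF P_andE2.IH[OF P_andE2.prems, simplified]])
next
  case (P_orI1 \<psi> \<Gamma> \<phi>)
  show ?case
    using pra_proves.P_orI1[OF pfm_ok_subst[OF P_orI1.prems P_orI1.hyps(1)] P_orI1.IH[OF P_orI1.prems]]
    by simp
next
  case (P_orI2 \<phi> \<Gamma> \<psi>)
  show ?case
    using pra_proves.P_orI2[OF pfm_ok_subst[OF P_orI2.prems P_orI2.hyps(1)] P_orI2.IH[OF P_orI2.prems]]
    by simp
next
  case (P_orE \<Gamma> \<phi> \<psi> \<chi>)
  show ?case
    using P_orE.IH(2)[OF P_orE.prems] P_orE.IH(3)[OF P_orE.prems]
    by - (rule pra_proves.P_orE[OF P_orE.IH(1)[OF P_orE.prems, simplified]], simp_all)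
next
  case (P_allNI \<Gamma> \<phi>)
  show ?case
    using pra_proves.P_allNI[OF P_allNI.IH[OF subst_ok_nup[OF P_allNI.prems], unfolded map_nlift_subst]]
    by simp
next
  case (P_allNE \<Gamma> \<phi> t)
  show ?case
    using pra_proves.P_allNE[OF P_allNE.IH[OF P_allNE.prems, simplified]
        ntm_ok_subst[OF P_allNE.prems P_allNE.hyps(2)]]
    by (simp add: ninst_subst)
next
  case (P_exNI \<phi> t \<Gamma>)
  show ?case
    using pra_proves.P_exNI[OF pfm_ok_subst[OF subst_ok_nup[OF P_exNI.prems] P_exNI.hyps(1)]
        ntm_ok_subst[OF P_exNI.prems P_exNI.hyps(2)]
        P_exNI.IH[OF P_exNI.prems, unfolded ninst_subst]]
    by simp
next
  case (P_exNE \<Gamma> \<phi> \<psi>)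
  show ?case using P_exNE.IH(2)[OF subst_ok_nup[OF P_exNE.prems]]
    by - (rule pra_proves.P_exNE[OF P_exNE.IH(1)[OF P_exNE.prems, simplified]],
      simp only: map_nlift_subst nlift_subst list.map)
next
  case (P_allFI k \<Gamma> \<phi>)
  show ?case
    using pra_proves.P_allFI[OF P_allFI.IH[OF subst_ok_fup[OF P_allFI.prems, of k], unfolded map_flift_subst]]
    by simp
next
  case (P_allFE \<Gamma> k \<phi> f)
  have ok: "\<And>k n. farity (\<tau> k n) = k" "\<And>k n. ftm_ok (\<tau> k n)"
    using P_allFE.prems by (auto simp: subst_ok_def)
  show ?case
    using pra_proves.P_allFE[OF P_allFE.IH[OF P_allFE.prems, simplified]
        ftm_ok_subst[OF ok P_allFE.hyps(2)]] P_allFE.hyps ok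
    by (simp add: finst_subst)
next
  case (P_exFI \<phi> f k \<Gamma>)
  have ok: "\<And>k n. farity (\<tau> k n) = k" "\<And>k n. ftm_ok (\<tau> k n)"
    using P_exFI.prems by (auto simp: subst_ok_def)
  show ?case
    using pra_proves.P_exFI[OF pfm_ok_subst[OF subst_ok_fup[OF P_exFI.prems] P_exFI.hyps(1)]
        ftm_ok_subst[OF ok P_exFI.hyps(2)] _
        P_exFI.IH[OF P_exFI.prems, unfolded finst_subst[OF ok(1) P_exFI.hyps(3)]]]
      P_exFI.hyps(3) ok(1)
    by simp
next
  case (P_exFE \<Gamma> k \<phi> \<psi>)
  show ?case using P_exFE.IH(2)[OF subst_ok_fup[OF P_exFE.prems, of k]]
    by - (rule pra_proves.P_exFE[OF P_exFE.IH(1)[OF P_exFE.prems, simplified]],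
      simp only: map_flift_subst flift_subst list.map)
next
  case (P_refl t \<Gamma>)
  show ?case using pra_proves.P_refl[OF ntm_ok_subst[OF P_refl.prems P_refl.hyps]] by simp
next
  case (P_replace \<phi> \<Gamma> s t)
  show ?case
    using pra_proves.P_replace[OF pfm_ok_subst[OF subst_ok_nup[OF P_replace.prems] P_replace.hyps(1)]
        P_replace.IH(1)[OF P_replace.prems, simplified]
        P_replace.IH(2)[OF P_replace.prems, unfolded ninst_subst]]
    by (simp add: ninst_subst)
next
  case (P_ext \<phi> f g k xs \<Gamma>)
  have ok: "\<And>k n. farity (\<tau> k n) = k" "\<And>k n. ftm_ok (\<tau> k n)"
    using P_ext.prems by (auto simp: subst_ok_def)
  have xs: "map (ntm_subst ((nup ^^ k) \<sigma>) \<tau>) xs = xs"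
    by (auto simp: nup_pow_less P_ext.hyps)
  have "pra_proves (map (pfm_subst \<sigma> \<tau>) \<Gamma>)
      (PAllNs k (PEq (NApp (ftm_subst \<tau> f) xs) (NApp (ftm_subst \<tau> g) xs)))"
    using P_ext.IH(1)[OF P_ext.prems] by (simp add: subst_PAllNs xs)
  from pra_proves.P_ext[OF pfm_ok_subst[OF subst_ok_fup[OF P_ext.prems] P_ext.hyps(1)]
      ftm_ok_subst[OF ok P_ext.hyps(2)] ftm_ok_subst[OF ok P_ext.hyps(3)] _ _ P_ext.hyps(6) this]
  show ?case using P_ext.IH(2)[OF P_ext.prems] P_ext.hyps ok
    by (simp add: finst_subst[of \<tau> _ k])
qed

lemma pra_proves_weaken: "pra_proves \<Gamma> \<phi> \<Longrightarrow> set \<Gamma> \<subseteq> set \<Delta> \<Longrightarrow> pra_proves \<Delta> \<phi>"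
proof (induction arbitrary: \<Delta> rule: pra_proves.induct)
  case (P_axiom \<phi> \<Gamma>)
  show ?case by (rule pra_proves.P_axiom[OF P_axiom.hyps])
next
  case (P_hyp \<phi> \<Gamma>)
  show ?case using P_hyp by (intro pra_proves.P_hyp) auto
next
  case (P_classical \<phi> \<Gamma>)
  show ?case using P_classical.prems
    by - (rule pra_proves.P_classical[OF P_classical.hyps(1) P_classical.IH], auto)
next
  case (P_impI \<phi> \<Gamma> \<psi>)
  show ?case using P_impI.prems
    by - (rule pra_proves.P_impI[OF P_impI.hyps(1) P_impI.IH], auto)
next
  case (P_impE \<Gamma> \<phi> \<psi>)
  show ?case by (rule pra_proves.P_impE[OF P_impE.IH[OF P_impE.prems]])
next
  case (P_andI \<Gamma> \<phi> \<psi>)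
  show ?case by (rule pra_proves.P_andI[OF P_andI.IH[OF P_andI.prems]])
next
  case (P_andE1 \<Gamma> \<phi> \<psi>)
  show ?case by (rule pra_proves.P_andE1[OF P_andE1.IH[OF P_andE1.prems]])
next
  case (P_andE2 \<Gamma> \<phi> \<psi>)
  show ?case by (rule pra_proves.P_andE2[OF P_andE2.IH[OF P_andE2.prems]])
next
  case (P_orI1 \<psi> \<Gamma> \<phi>)
  show ?case by (rule pra_proves.P_orI1[OF P_orI1.hyps(1) P_orI1.IH[OF P_orI1.prems]])
next
  case (P_orI2 \<phi> \<Gamma> \<psi>)
  show ?case by (rule pra_proves.P_orI2[OF P_orI2.hyps(1) P_orI2.IH[OF P_orI2.prems]])
next
  case (P_orE \<Gamma> \<phi> \<psi> \<chi>)
  show ?case using P_orE.prems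
    by - (rule pra_proves.P_orE[OF P_orE.IH(1)[OF P_orE.prems] P_orE.IH(2) P_orE.IH(3)], auto)
next
  case (P_allNI \<Gamma> \<phi>)
  show ?case using P_allNI.prems by - (rule pra_proves.P_allNI[OF P_allNI.IH], auto)
next
  case (P_allNE \<Gamma> \<phi> t)
  show ?case by (rule pra_proves.P_allNE[OF P_allNE.IH[OF P_allNE.prems] P_allNE.hyps(2)])
next
  case (P_exNI \<phi> t \<Gamma>)
  show ?case by (rule pra_proves.P_exNI[OF P_exNI.hyps(1,2) P_exNI.IH[OF P_exNI.prems]])
next
  case (P_exNE \<Gamma> \<phi> \<psi>)
  show ?case using P_exNE.prems
    by - (rule pra_proves.P_exNE[OF P_exNE.IH(1)[OF P_exNE.prems] P_exNE.IH(2)], auto)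
next
  case (P_allFI k \<Gamma> \<phi>)
  show ?case using P_allFI.prems by - (rule pra_proves.P_allFI[OF P_allFI.IH], auto)
next
  case (P_allFE \<Gamma> k \<phi> f)
  show ?case by (rule pra_proves.P_allFE[OF P_allFE.IH[OF P_allFE.prems] P_allFE.hyps(2,3)])
next
  case (P_exFI \<phi> f k \<Gamma>)
  show ?case by (rule pra_proves.P_exFI[OF P_exFI.hyps(1-3) P_exFI.IH[OF P_exFI.prems]])
next
  case (P_exFE \<Gamma> k \<phi> \<psi>)
  show ?case using P_exFE.prems
    by - (rule pra_proves.P_exFE[OF P_exFE.IH(1)[OF P_exFE.prems] P_exFE.IH(2)], auto)
next
  case (P_refl t \<Gamma>)
  show ?case by (rule pra_proves.P_refl[OF P_refl.hyps])
next
  case (P_replace \<phi> \<Gamma> s t)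
  show ?case by (rule pra_proves.P_replace[OF P_replace.hyps(1) P_replace.IH[OF P_replace.prems]])
next
  case (P_ext \<phi> f g k xs \<Gamma>)
  show ?case by (rule pra_proves.P_ext[OF P_ext.hyps(1-6) P_ext.IH[OF P_ext.prems]])
qed

section \<open>Maximal consistent theories with witnesses\<close>

definition consistent :: "pfm list \<Rightarrow> bool" where
  "consistent \<Gamma> \<longleftrightarrow> \<not> pra_proves \<Gamma> PFalse"

lemma finite_pfm_fv: "finite (pfm_fv \<phi>)"
proof -
  have f: "finite (ftm_fv f)" for f by (induction f) auto
  have t: "finite (ntm_fv t)" for t by (induction t) (auto simp: f)
  have n: "inj nshift"
  proof (rule injI)
    fix x y show "nshift x = nshift y \<Longrightarrow> x = y" by (cases x; cases y) auto
  qed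
  have k: "inj (fshift k)" for k
  proof (rule injI)
    fix x y show "fshift k x = fshift k y \<Longrightarrow> x = y" by (cases x; cases y) (auto split: if_splits)
  qed
  show ?thesis
    by (induction \<phi>) (auto simp: t finite_vimageI[OF _ n, unfolded vimage_def]
        finite_vimageI[OF _ k, unfolded vimage_def])
qed

lemma fresh_NumV: "finite A \<Longrightarrow> \<exists>k. NumV k \<notin> A"
proof -
  assume "finite A"
  then have "finite (NumV -` A)" by (rule finite_vimageI) (auto intro: injI)
  then have "NumV -` A \<noteq> UNIV" by (metis infinite_UNIV_nat)
  then show ?thesis by auto
qed

lemma fresh_FunV: "finite A \<Longrightarrow> \<exists>n. FunV k n \<notin> A"
proof -
  assume "finite A"
  then have "finite (FunV k -` A)" by (rule finite_vimageI) (auto intro: injI)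
  then have "FunV k -` A \<noteq> UNIV" by (metis infinite_UNIV_nat)
  then show ?thesis by auto
qed

lemma consistent_witness_num:
  assumes con: "consistent \<Gamma>" and ex: "PExN \<psi> \<in> set \<Gamma>" and ok: "pfm_ok \<psi>"
  shows "\<exists>k. consistent (ninst \<psi> (NVar k) # \<Gamma>)"
proof -
  obtain k where k: "NumV k \<notin> (\<Union>\<phi> \<in> set \<Gamma>. pfm_fv \<phi>)"
    using fresh_NumV[of "\<Union>\<phi> \<in> set \<Gamma>. pfm_fv \<phi>"] by (auto simp: finite_pfm_fv)
  let ?\<sigma> = "\<lambda>n. if n = k then NVar 0 else NVar (Suc n)"
  have "\<not> pra_proves (ninst \<psi> (NVar k) # \<Gamma>) PFalse"
  proof
    assume "pra_proves (ninst \<psi> (NVar k) # \<Gamma>) PFalse"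
    from pra_proves_subst[OF this, of ?\<sigma> FVar]
    have 1: "pra_proves (pfm_subst ?\<sigma> FVar (ninst \<psi> (NVar k)) # map (pfm_subst ?\<sigma> FVar) \<Gamma>) PFalse"
      by (simp add: subst_ok_def)
    have "NumV m \<in> pfm_fv (PExN \<psi>) \<Longrightarrow> m \<noteq> k" for m
      using k ex by blast
    then have "pfm_subst ?\<sigma> FVar (ninst \<psi> (NVar k)) = pfm_subst NVar FVar \<psi>"
      unfolding ninst_def pfm_subst_subst by (intro pfm_subst_cong) (auto split: nat.split)
    moreover have "map (pfm_subst ?\<sigma> FVar) \<Gamma> = map nlift \<Gamma>"
      using k by (auto simp: nlift_def intro!: pfm_subst_cong)
    ultimately have "pra_proves (\<psi> # map nlift \<Gamma>) (nlift PFalse)"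
      using 1 by (simp add: nlift_def[of PFalse] del: map_eq_conv)
    moreover have "pra_proves \<Gamma> (PExN \<psi>)"
      by (rule P_hyp[OF ex]) (simp add: ok)
    ultimately show False
      using con P_exNE[of \<Gamma> \<psi> PFalse] unfolding consistent_def by simp
  qed
  then show ?thesis by (auto simp: consistent_def)
qed

text \<open>As for numbers; only function variables of arity \<open>k\<close> are shifted, so
  \<open>fren k\<close> takes the place of the successor.\<close>

lemma consistent_witness_fun:
  assumes con: "consistent \<Gamma>" and ex: "PExF k \<psi> \<in> set \<Gamma>" and ok: "pfm_ok \<psi>"
  shows "\<exists>n. consistent (finst \<psi> (FVar k n) # \<Gamma>)"
proof -
  obtain i where i: "FunV k i \<notin> (\<Union>\<phi> \<in> set \<Gamma>. pfm_fv \<phi>)"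
    using fresh_FunV[of "\<Union>\<phi> \<in> set \<Gamma>. pfm_fv \<phi>"] by (auto simp: finite_pfm_fv)
  let ?\<tau> = "\<lambda>j n. if j = k \<and> n = i then FVar k 0 else fren k j n"
  have "\<not> pra_proves (finst \<psi> (FVar k i) # \<Gamma>) PFalse"
  proof
    assume "pra_proves (finst \<psi> (FVar k i) # \<Gamma>) PFalse"
    from pra_proves_subst[OF this, of NVar ?\<tau>]
    have 1: "pra_proves (pfm_subst NVar ?\<tau> (finst \<psi> (FVar k i)) # map (pfm_subst NVar ?\<tau>) \<Gamma>) PFalse"
      by (simp add: subst_ok_def)
    have "FunV j m \<in> pfm_fv (PExF k \<psi>) \<Longrightarrow> j = k \<Longrightarrow> m \<noteq> i" for j m
      using i ex by blast
    then have "pfm_subst NVar ?\<tau> (finst \<psi> (FVar k i)) = pfm_subst NVar FVar \<psi>"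
      unfolding finst_def pfm_subst_subst
      by (intro pfm_subst_cong) (auto simp: fren_def split: nat.split)
    moreover have "map (pfm_subst NVar ?\<tau>) \<Gamma> = map (flift k) \<Gamma>"
      using i by (auto simp: flift_def intro!: pfm_subst_cong)
    ultimately have "pra_proves (\<psi> # map (flift k) \<Gamma>) (flift k PFalse)"
      using 1 by (simp add: flift_def[of _ PFalse] del: map_eq_conv)
    moreover have "pra_proves \<Gamma> (PExF k \<psi>)"
      by (rule P_hyp[OF ex]) (simp add: ok)
    ultimately show False
      using con P_exFE[of \<Gamma> k \<psi> PFalse] unfolding consistent_def by simp
  qed
  then show ?thesis by (auto simp: consistent_def)
qed

text \<open>One enumeration of the formulas yields both completeness and witnesses: a formula that
  is not refuted at its stage is added, together with an instance if it is existential.\<close>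

definition henkin_step :: "pfm \<Rightarrow> pfm list \<Rightarrow> pfm list \<Rightarrow> bool" where
  "henkin_step \<phi> \<Gamma> \<Gamma>' \<longleftrightarrow> set \<Gamma> \<subseteq> set \<Gamma>' \<and>
     (pfm_ok \<phi> \<longrightarrow> pra_proves \<Gamma> (PNot \<phi>) \<or>
       \<phi> \<in> set \<Gamma>' \<and>
       (\<forall>\<psi>. \<phi> = PExN \<psi> \<longrightarrow> (\<exists>k. ninst \<psi> (NVar k) \<in> set \<Gamma>')) \<and>
       (\<forall>\<psi> k. \<phi> = PExF k \<psi> \<longrightarrow> (\<exists>n. finst \<psi> (FVar k n) \<in> set \<Gamma>')))"

lemma henkin_step_exists:
  assumes con: "consistent \<Gamma>"
  shows "\<exists>\<Gamma>'. consistent \<Gamma>' \<and> henkin_step \<phi> \<Gamma> \<Gamma>'"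
proof (cases "pfm_ok \<phi> \<and> consistent (\<phi> # \<Gamma>)")
  case False
  then have "pfm_ok \<phi> \<longrightarrow> pra_proves \<Gamma> (PNot \<phi>)"
    using P_impI[of \<phi> \<Gamma> PFalse] by (auto simp: consistent_def)
  with con show ?thesis by (auto simp: henkin_step_def)
next
  case True
  consider \<psi> where "\<phi> = PExN \<psi>" | k \<psi> where "\<phi> = PExF k \<psi>"
    | "\<forall>\<psi>. \<phi> \<noteq> PExN \<psi>" "\<forall>\<psi> k. \<phi> \<noteq> PExF k \<psi>" by blast
  then show ?thesis
  proof cases
    case 1
    with True consistent_witness_num[of "\<phi> # \<Gamma>" \<psi>] obtain k
      where "consistent (ninst \<psi> (NVar k) # \<phi> # \<Gamma>)" by auto
    with 1 show ?thesis
      by (intro exI[of _ "ninst \<psi> (NVar k) # \<phi> # \<Gamma>"]) (auto simp: henkin_step_def)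
  next
    case 2
    with True consistent_witness_fun[of "\<phi> # \<Gamma>" k \<psi>] obtain n
      where "consistent (finst \<psi> (FVar k n) # \<phi> # \<Gamma>)" by auto
    with 2 show ?thesis
      by (intro exI[of _ "finst \<psi> (FVar k n) # \<phi> # \<Gamma>"]) (auto simp: henkin_step_def)
  next
    case 3
    with True show ?thesis
      by (intro exI[of _ "\<phi> # \<Gamma>"]) (auto simp: henkin_step_def)
  qed
qed

lemma ninst_nlift_up: "ninst (pfm_subst (nup (\<lambda>n. NVar (Suc n))) FVar \<psi>) (NVar 0) = \<psi>"
  unfolding ninst_def pfm_subst_subst
  by (rule trans[OF pfm_subst_cong pfm_subst_id]) (auto simp: nup_def split: nat.split)

lemma finst_flift_up:
  "finst (pfm_subst (\<lambda>n. ntm_subst NVar (fren k) (NVar n)) (fup k (fren k)) \<psi>) (FVar k 0) = \<psi>"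
  unfolding finst_def pfm_subst_subst
  by (rule trans[OF pfm_subst_cong pfm_subst_id]) (auto simp: fup_def fren_def split: nat.split)

text \<open>The construction supplies witnesses of existential formulas only; this duality turns
  them into counterexamples to universal ones.\<close>

lemma not_all_ex_not_num:
  assumes ok: "pfm_ok \<psi>"
  shows "pra_proves [PNot (PAllN \<psi>)] (PExN (PNot \<psi>))"
proof (rule P_classical)
  let ?\<Gamma> = "[PNot (PExN (PNot \<psi>)), PNot (PAllN \<psi>)]"
  have hyps: "pfm_ok (nlift \<phi>)" if "\<phi> \<in> set ?\<Gamma>" for \<phi> using that ok by auto
  have "pra_proves (map nlift ?\<Gamma>) \<psi>"
  proof (rule P_classical[OF ok])
    let ?\<Delta> = "PNot \<psi> # map nlift ?\<Gamma>"
    have eq: "nlift (PNot (PExN (PNot \<psi>))) =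
        PNot (PExN (PNot (pfm_subst (nup (\<lambda>n. NVar (Suc n))) FVar \<psi>)))"
      by (simp add: nlift_def)
    have "pra_proves ?\<Delta> (PNot (PExN (PNot (pfm_subst (nup (\<lambda>n. NVar (Suc n))) FVar \<psi>))))"
      unfolding eq[symmetric] by (rule P_hyp) (use hyps in auto)
    moreover have "pra_proves ?\<Delta> (PExN (PNot (pfm_subst (nup (\<lambda>n. NVar (Suc n))) FVar \<psi>)))"
    \<comment> \<open>The eigenvariable itself witnesses the lifted existential formula.\<close>
    proof (rule P_exNI[where t = "NVar 0"])
      have "ninst (PNot (pfm_subst (nup (\<lambda>n. NVar (Suc n))) FVar \<psi>)) (NVar 0) = PNot \<psi>"
        using ninst_nlift_up[of \<psi>] by (simp add: ninst_def)
      then show "pra_proves ?\<Delta> (ninst (PNot (pfm_subst (nup (\<lambda>n. NVar (Suc n))) FVar \<psi>)) (NVar 0))"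
        using ok by (auto intro!: P_hyp)
    qed (auto intro!: pfm_ok_subst subst_ok_nup ok)
    ultimately show "pra_proves ?\<Delta> PFalse" by (rule P_impE)
  qed
  then have "pra_proves ?\<Gamma> (PAllN \<psi>)" by (rule P_allNI)
  moreover have "pra_proves ?\<Gamma> (PNot (PAllN \<psi>))" by (rule P_hyp) (auto simp: ok)
  ultimately show "pra_proves ?\<Gamma> PFalse" by (metis P_impE)
qed (simp add: ok)

lemma not_all_ex_not_fun:
  assumes ok: "pfm_ok \<psi>"
  shows "pra_proves [PNot (PAllF k \<psi>)] (PExF k (PNot \<psi>))"
proof (rule P_classical)
  let ?\<Gamma> = "[PNot (PExF k (PNot \<psi>)), PNot (PAllF k \<psi>)]"
  let ?\<psi> = "pfm_subst (\<lambda>n. ntm_subst NVar (fren k) (NVar n)) (fup k (fren k)) \<psi>"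
  have hyps: "pfm_ok (flift k \<phi>)" if "\<phi> \<in> set ?\<Gamma>" for \<phi> using that ok by auto
  have "pra_proves (map (flift k) ?\<Gamma>) \<psi>"
  proof (rule P_classical[OF ok])
    let ?\<Delta> = "PNot \<psi> # map (flift k) ?\<Gamma>"
    have eq: "flift k (PNot (PExF k (PNot \<psi>))) = PNot (PExF k (PNot ?\<psi>))"
      by (simp add: flift_def)
    have "pra_proves ?\<Delta> (PNot (PExF k (PNot ?\<psi>)))"
      unfolding eq[symmetric] by (rule P_hyp) (use hyps in auto)
    moreover have "pra_proves ?\<Delta> (PExF k (PNot ?\<psi>))"
    proof (rule P_exFI[where f = "FVar k 0"])
      have "finst (PNot ?\<psi>) (FVar k 0) = PNot \<psi>"
        using finst_flift_up[of k \<psi>] by (simp add: finst_def)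
      then show "pra_proves ?\<Delta> (finst (PNot ?\<psi>) (FVar k 0))"
        using ok by (auto intro!: P_hyp)
      have "subst_ok (\<lambda>n. ntm_subst NVar (fren k) (NVar n)) (fup k (fren k))"
        by (rule subst_ok_fup) simp
      from pfm_ok_subst[OF this ok] show "pfm_ok (PNot ?\<psi>)" by simp
    qed auto
    ultimately show "pra_proves ?\<Delta> PFalse" by (rule P_impE)
  qed
  then have "pra_proves ?\<Gamma> (PAllF k \<psi>)" by (rule P_allFI)
  moreover have "pra_proves ?\<Gamma> (PNot (PAllF k \<psi>))" by (rule P_hyp) (auto simp: ok)
  ultimately show "pra_proves ?\<Gamma> PFalse" by (metis P_impE)
qed (simp add: ok)

text \<open>As \<open>from_nat\<close> inverts \<open>to_nat\<close>, each formula \<phi> is treated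
  at stage \<open>to_nat \<phi>\<close>.\<close>

locale henkin =
  fixes G :: "nat \<Rightarrow> pfm list"
  assumes con: "consistent (G n)"
    and step: "henkin_step (from_nat n) (G n) (G (Suc n))"
begin

text \<open>Provability from some stage rather than membership in one, so that deductive closure
  needs only the monotonicity of the stages.\<close>

definition H :: "pfm \<Rightarrow> bool" where
  "H \<phi> \<longleftrightarrow> (\<exists>n. pra_proves (G n) \<phi>)"

lemma G_mono: "n \<le> m \<Longrightarrow> set (G n) \<subseteq> set (G m)"
  by (rule lift_Suc_mono_le) (use step in \<open>auto simp: henkin_step_def\<close>)

lemma H_mp: assumes "H (PImp \<phi> \<psi>)" "H \<phi>" shows "H \<psi>"
proof -
  from assms obtain n m where "pra_proves (G n) (PImp \<phi> \<psi>)" "pra_proves (G m) \<phi>"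
    by (auto simp: H_def)
  then have "pra_proves (G (max n m)) (PImp \<phi> \<psi>)" "pra_proves (G (max n m)) \<phi>"
    by (auto elim!: pra_proves_weaken intro!: G_mono simp del: max.absorb1 max.absorb2)
  then have "pra_proves (G (max n m)) \<psi>" by (rule P_impE)
  then show ?thesis by (auto simp: H_def)
qed

text \<open>The hypotheses are discharged one at a time, so that \<open>H_mp\<close> finds a common
  stage for two formulas only.\<close>

lemma H_ded: "pra_proves \<Gamma> \<phi> \<Longrightarrow> \<forall>\<gamma> \<in> set \<Gamma>. pfm_ok \<gamma> \<and> H \<gamma> \<Longrightarrow> H \<phi>"
proof (induction \<Gamma> arbitrary: \<phi>)
  case Nil
  then have "pra_proves (G 0) \<phi>" by (auto elim: pra_proves_weaken)
  then show ?case by (auto simp: H_def)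
next
  case (Cons \<gamma> \<Gamma>)
  have "pra_proves \<Gamma> (PImp \<gamma> \<phi>)" using Cons.prems by (intro P_impI) auto
  then have "H (PImp \<gamma> \<phi>)" using Cons by auto
  then show ?case by (rule H_mp) (use Cons.prems in auto)
qed

lemma H_hyp: "\<phi> \<in> set (G n) \<Longrightarrow> pfm_ok \<phi> \<Longrightarrow> H \<phi>"
  unfolding H_def by (blast intro: P_hyp)

lemma H_False: "\<not> H PFalse"
  using con by (auto simp: H_def consistent_def)

lemma H_Not: assumes "pfm_ok \<phi>" shows "H (PNot \<phi>) \<longleftrightarrow> \<not> H \<phi>"
proof
  show "H (PNot \<phi>) \<Longrightarrow> \<not> H \<phi>" using H_mp H_False by blast
  show "\<not> H \<phi> \<Longrightarrow> H (PNot \<phi>)"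
    using step[of "to_nat \<phi>"] H_hyp[of \<phi>] assms by (auto simp: henkin_step_def H_def)
qed

lemma H_imp: assumes ok: "pfm_ok \<phi>" "pfm_ok \<psi>" shows "H (PImp \<phi> \<psi>) \<longleftrightarrow> (H \<phi> \<longrightarrow> H \<psi>)"
proof
  show "H (PImp \<phi> \<psi>) \<Longrightarrow> H \<phi> \<longrightarrow> H \<psi>" using H_mp by blast
  assume "H \<phi> \<longrightarrow> H \<psi>"
  then consider "H (PNot \<phi>)" | "H \<psi>" using H_Not ok by blast
  then show "H (PImp \<phi> \<psi>)"
  proof cases
    case 1
    have "pra_proves [PNot \<psi>, \<phi>, PNot \<phi>] PFalse"
      by (rule P_impE[of _ \<phi>]; rule P_hyp) (auto simp: ok)
    then have "pra_proves [PNot \<phi>] (PImp \<phi> \<psi>)"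
      by (intro P_impI[OF ok(1)] P_classical[OF ok(2)])
    then show ?thesis by (rule H_ded) (use ok 1 in auto)
  next
    case 2
    have "pra_proves [\<psi>] (PImp \<phi> \<psi>)" by (rule P_impI[OF ok(1)], rule P_hyp) (auto simp: ok)
    then show ?thesis by (rule H_ded) (use ok 2 in auto)
  qed
qed

lemma H_and: assumes ok: "pfm_ok \<phi>" "pfm_ok \<psi>" shows "H (PAnd \<phi> \<psi>) \<longleftrightarrow> H \<phi> \<and> H \<psi>"
proof
  assume *: "H (PAnd \<phi> \<psi>)"
  have "pra_proves [PAnd \<phi> \<psi>] \<phi>"
    by (rule P_andE1[of _ \<phi> \<psi>], rule P_hyp) (auto simp: ok)
  moreover have "pra_proves [PAnd \<phi> \<psi>] \<psi>"
    by (rule P_andE2[of _ \<phi> \<psi>], rule P_hyp) (auto simp: ok)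
  ultimately show "H \<phi> \<and> H \<psi>" using * ok H_ded[of "[PAnd \<phi> \<psi>]"] by auto
next
  assume *: "H \<phi> \<and> H \<psi>"
  have "pra_proves [\<phi>, \<psi>] (PAnd \<phi> \<psi>)" by (rule P_andI; rule P_hyp) (auto simp: ok)
  then show "H (PAnd \<phi> \<psi>)" by (rule H_ded) (use * ok in auto)
qed

lemma H_or: assumes ok: "pfm_ok \<phi>" "pfm_ok \<psi>" shows "H (POr \<phi> \<psi>) \<longleftrightarrow> H \<phi> \<or> H \<psi>"
proof
  assume *: "H (POr \<phi> \<psi>)"
  show "H \<phi> \<or> H \<psi>"
  proof (rule ccontr)
    assume "\<not> (H \<phi> \<or> H \<psi>)"
    then have "H (PNot \<phi>)" "H (PNot \<psi>)" using H_Not ok by auto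
    moreover have "pra_proves [POr \<phi> \<psi>, PNot \<phi>, PNot \<psi>] PFalse"
    proof (rule P_orE[of _ \<phi> \<psi>])
      show "pra_proves [\<phi>, POr \<phi> \<psi>, PNot \<phi>, PNot \<psi>] PFalse"
        by (rule P_impE[of _ \<phi>]; rule P_hyp) (auto simp: ok)
      show "pra_proves [\<psi>, POr \<phi> \<psi>, PNot \<phi>, PNot \<psi>] PFalse"
        by (rule P_impE[of _ \<psi>]; rule P_hyp) (auto simp: ok)
    qed (rule P_hyp, auto simp: ok)
    ultimately have "H PFalse" using * ok H_ded[of "[POr \<phi> \<psi>, PNot \<phi>, PNot \<psi>]"] by auto
    then show False using H_False by simp
  qed
next
  have "pra_proves [\<phi>] (POr \<phi> \<psi>)"
    by (rule P_orI1[OF ok(2)], rule P_hyp) (auto simp: ok)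
  moreover have "pra_proves [\<psi>] (POr \<phi> \<psi>)"
    by (rule P_orI2[OF ok(1)], rule P_hyp) (auto simp: ok)
  ultimately show "H \<phi> \<or> H \<psi> \<Longrightarrow> H (POr \<phi> \<psi>)"
    using ok H_ded[of "[\<phi>]"] H_ded[of "[\<psi>]"] by auto
qed

lemma H_exN: assumes ok: "pfm_ok \<psi>" shows "H (PExN \<psi>) \<longleftrightarrow> (\<exists>t. ntm_ok t \<and> H (ninst \<psi> t))"
proof
  assume *: "H (PExN \<psi>)"
  then have "\<not> pra_proves (G (to_nat (PExN \<psi>))) (PNot (PExN \<psi>))"
    using H_Not[of "PExN \<psi>"] ok by (auto simp: H_def)
  then obtain k where "ninst \<psi> (NVar k) \<in> set (G (Suc (to_nat (PExN \<psi>))))"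
    using step[of "to_nat (PExN \<psi>)"] ok by (auto simp: henkin_step_def)
  then have "H (ninst \<psi> (NVar k))" by (rule H_hyp) (simp add: ok)
  then show "\<exists>t. ntm_ok t \<and> H (ninst \<psi> t)" by (intro exI[of _ "NVar k"]) simp
next
  assume "\<exists>t. ntm_ok t \<and> H (ninst \<psi> t)"
  then show "H (PExN \<psi>)" unfolding H_def using P_exNI[OF ok] by blast
qed

lemma H_exF:
  assumes ok: "pfm_ok \<psi>"
  shows "H (PExF k \<psi>) \<longleftrightarrow> (\<exists>f. ftm_ok f \<and> farity f = k \<and> H (finst \<psi> f))"
proof
  assume *: "H (PExF k \<psi>)"
  then have "\<not> pra_proves (G (to_nat (PExF k \<psi>))) (PNot (PExF k \<psi>))"
    using H_Not[of "PExF k \<psi>"] ok by (auto simp: H_def)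
  then obtain n where "finst \<psi> (FVar k n) \<in> set (G (Suc (to_nat (PExF k \<psi>))))"
    using step[of "to_nat (PExF k \<psi>)"] ok by (auto simp: henkin_step_def)
  then have "H (finst \<psi> (FVar k n))" by (rule H_hyp) (simp add: ok)
  then show "\<exists>f. ftm_ok f \<and> farity f = k \<and> H (finst \<psi> f)" by (intro exI[of _ "FVar k n"]) simp
next
  assume "\<exists>f. ftm_ok f \<and> farity f = k \<and> H (finst \<psi> f)"
  then show "H (PExF k \<psi>)" unfolding H_def using P_exFI[OF ok] by blast
qed

lemma H_allN: assumes ok: "pfm_ok \<psi>" shows "H (PAllN \<psi>) \<longleftrightarrow> (\<forall>t. ntm_ok t \<longrightarrow> H (ninst \<psi> t))"
proof
  show "H (PAllN \<psi>) \<Longrightarrow> \<forall>t. ntm_ok t \<longrightarrow> H (ninst \<psi> t)"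
    unfolding H_def using P_allNE by blast
  assume *: "\<forall>t. ntm_ok t \<longrightarrow> H (ninst \<psi> t)"
  show "H (PAllN \<psi>)"
  proof (rule ccontr)
    assume "\<not> H (PAllN \<psi>)"
    then have "H (PNot (PAllN \<psi>))" using H_Not ok by simp
    then have "H (PExN (PNot \<psi>))"
      using H_ded[OF not_all_ex_not_num[OF ok]] ok by simp
    then obtain t where "ntm_ok t" "H (PNot (ninst \<psi> t))"
      using H_exN[of "PNot \<psi>"] ok by (auto simp: ninst_def)
    then show False using * H_Not[of "ninst \<psi> t"] ok by auto
  qed
qed

lemma H_allF:
  assumes ok: "pfm_ok \<psi>"
  shows "H (PAllF k \<psi>) \<longleftrightarrow> (\<forall>f. ftm_ok f \<longrightarrow> farity f = k \<longrightarrow> H (finst \<psi> f))"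
proof
  show "H (PAllF k \<psi>) \<Longrightarrow> \<forall>f. ftm_ok f \<longrightarrow> farity f = k \<longrightarrow> H (finst \<psi> f)"
    unfolding H_def using P_allFE by blast
  assume *: "\<forall>f. ftm_ok f \<longrightarrow> farity f = k \<longrightarrow> H (finst \<psi> f)"
  show "H (PAllF k \<psi>)"
  proof (rule ccontr)
    assume "\<not> H (PAllF k \<psi>)"
    then have "H (PNot (PAllF k \<psi>))" using H_Not ok by simp
    then have "H (PExF k (PNot \<psi>))"
      using H_ded[OF not_all_ex_not_fun[OF ok]] ok by simp
    then obtain f where "ftm_ok f" "farity f = k" "H (PNot (finst \<psi> f))"
      using H_exF[of "PNot \<psi>"] ok by (auto simp: finst_def)
    then show False using * H_Not[of "finst \<psi> f"] ok by auto
  qed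
qed

end

lemma henkin_extension:
  assumes "consistent \<Gamma>"
  obtains G where "henkin G" "G 0 = \<Gamma>"
proof -
  \<comment> \<open>The initial context is built into the invariant of the dependent choice, as the
    condition for \<open>n = 0\<close>.\<close>
  obtain G where "G 0 = \<Gamma>" "\<And>n. consistent (G n)" "\<And>n. henkin_step (from_nat n) (G n) (G (Suc n))"
    using dependent_nat_choice[of "\<lambda>n \<Delta>. consistent \<Delta> \<and> (n = 0 \<longrightarrow> \<Delta> = \<Gamma>)"
        "\<lambda>n. henkin_step (from_nat n)"] henkin_step_exists assms by (metis nat.distinct(1))
  then show thesis by (intro that[of G]) (auto simp: henkin_def)
qed

section \<open>Models\<close>

text \<open>Henkin structures: function quantifiers range over the designated sets
  \<open>funs\<close>, not over all functions. Arguments form a list, so that one type accommodates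
  all arities.\<close>

record 'a pra_struct =
  funs :: "nat \<Rightarrow> ('a list \<Rightarrow> 'a) set"
  prim :: "prfl \<Rightarrow> nat list \<Rightarrow> nat \<Rightarrow> ('a list \<Rightarrow> 'a) list \<Rightarrow> 'a list \<Rightarrow> 'a"
  fnl :: "nat \<Rightarrow> nat list \<Rightarrow> nat \<Rightarrow> ('a list \<Rightarrow> 'a) list \<Rightarrow> 'a list \<Rightarrow> 'a"

fun feval :: "'a pra_struct \<Rightarrow> (nat \<Rightarrow> nat \<Rightarrow> 'a list \<Rightarrow> 'a) \<Rightarrow> ftm \<Rightarrow> 'a list \<Rightarrow> 'a" where
  "feval M u (FVar k n) = u k n"
| "feval M u (Prim p ks m fs) = prim M p ks m (map (feval M u) fs)"
| "feval M u (Fnl F ks m fs) = fnl M F ks m (map (feval M u) fs)"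

fun neval :: "'a pra_struct \<Rightarrow> (nat \<Rightarrow> 'a) \<Rightarrow> (nat \<Rightarrow> nat \<Rightarrow> 'a list \<Rightarrow> 'a) \<Rightarrow> ntm \<Rightarrow> 'a" where
  "neval M e u (NVar n) = e n"
| "neval M e u (NApp f ts) = feval M u f (map (neval M e u) ts)"

definition pushf ::
  "nat \<Rightarrow> ('a list \<Rightarrow> 'a) \<Rightarrow> (nat \<Rightarrow> nat \<Rightarrow> 'a list \<Rightarrow> 'a) \<Rightarrow> nat \<Rightarrow> nat \<Rightarrow> 'a list \<Rightarrow> 'a" where
  "pushf k f u j n = (if j = k then case_nat f (u j) n else u j n)"

primrec sat :: "'a pra_struct \<Rightarrow> (nat \<Rightarrow> 'a) \<Rightarrow> (nat \<Rightarrow> nat \<Rightarrow> 'a list \<Rightarrow> 'a) \<Rightarrow> pfm \<Rightarrow> bool" where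
  "sat M e u PFalse \<longleftrightarrow> False"
| "sat M e u (PEq s t) \<longleftrightarrow> neval M e u s = neval M e u t"
| "sat M e u (PImp \<phi> \<psi>) \<longleftrightarrow> (sat M e u \<phi> \<longrightarrow> sat M e u \<psi>)"
| "sat M e u (PAnd \<phi> \<psi>) \<longleftrightarrow> sat M e u \<phi> \<and> sat M e u \<psi>"
| "sat M e u (POr \<phi> \<psi>) \<longleftrightarrow> sat M e u \<phi> \<or> sat M e u \<psi>"
| "sat M e u (PAllN \<phi>) \<longleftrightarrow> (\<forall>x. sat M (case_nat x e) u \<phi>)"
| "sat M e u (PExN \<phi>) \<longleftrightarrow> (\<exists>x. sat M (case_nat x e) u \<phi>)"
| "sat M e u (PAllF k \<phi>) \<longleftrightarrow> (\<forall>f \<in> funs M k. sat M e (pushf k f u) \<phi>)"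
| "sat M e u (PExF k \<phi>) \<longleftrightarrow> (\<exists>f \<in> funs M k. sat M e (pushf k f u) \<phi>)"

definition fenv :: "'a pra_struct \<Rightarrow> (nat \<Rightarrow> nat \<Rightarrow> 'a list \<Rightarrow> 'a) \<Rightarrow> bool" where
  "fenv M u \<longleftrightarrow> (\<forall>k n. u k n \<in> funs M k)"

text \<open>A function of arity \<open>k\<close> also has values on lists of other lengths; by
  \<open>fun_ext\<close> these are determined by the values on lists of length \<open>k\<close>, so
  extensional equality is equality.\<close>

locale pra_model =
  fixes M :: "'a pra_struct"
  assumes fun_ext: "f \<in> funs M k \<Longrightarrow> g \<in> funs M k \<Longrightarrow> (\<And>xs. length xs = k \<Longrightarrow> f xs = g xs) \<Longrightarrow> f = g"
    and prim_closed: "prfl_ok ks m p \<Longrightarrow> list_all2 (\<lambda>f k. f \<in> funs M k) fs ks \<Longrightarrow>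
      prim M p ks m fs \<in> funs M m"
    and fnl_closed: "list_all2 (\<lambda>f k. f \<in> funs M k) fs ks \<Longrightarrow> fnl M F ks m fs \<in> funs M m"
    and axiom_sat: "pra_axiom \<phi> \<Longrightarrow> fenv M u \<Longrightarrow> sat M e u \<phi>"

lemma feval_subst: "feval M u (ftm_subst \<tau> f) = feval M (\<lambda>k n. feval M u (\<tau> k n)) f"
  by (induction f) (auto intro: arg_cong[where f = "prim M _ _ _"] arg_cong[where f = "fnl M _ _ _"]
      simp: comp_def cong: map_cong)

lemma neval_subst:
  "neval M e u (ntm_subst \<sigma> \<tau> t) = neval M (\<lambda>n. neval M e u (\<sigma> n)) (\<lambda>k n. feval M u (\<tau> k n)) t"
  by (induction t) (auto simp: feval_subst comp_def cong: map_cong)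

lemma nup_env:
  "(\<lambda>n. neval M (case_nat x e) u (nup \<sigma> n)) = case_nat x (\<lambda>n. neval M e u (\<sigma> n))"
  by (rule ext) (auto simp: nup_def neval_subst split: nat.split)

lemma feval_fren_pushf: "feval M (pushf k f u) (fren k j n) = u j n"
  by (auto simp: fren_def pushf_def)

lemma fup_env:
  "(\<lambda>j n. feval M (pushf k f u) (fup k \<tau> j n)) = pushf k f (\<lambda>j n. feval M u (\<tau> j n))"
  by (intro ext) (auto simp: fup_def feval_subst feval_fren_pushf pushf_def[of k f u k 0]
      pushf_def[of k f "\<lambda>j n. feval M u (\<tau> j n)"] split: nat.split)

lemma sat_subst:
  "sat M e u (pfm_subst \<sigma> \<tau> \<phi>) \<longleftrightarrow> sat M (\<lambda>n. neval M e u (\<sigma> n)) (\<lambda>k n. feval M u (\<tau> k n)) \<phi>"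
  by (induction \<phi> arbitrary: e u \<sigma> \<tau>)
    (simp_all add: neval_subst nup_env fup_env feval_fren_pushf)

lemma sat_ninst: "sat M e u (ninst \<phi> t) \<longleftrightarrow> sat M (case_nat (neval M e u t) e) u \<phi>"
proof -
  have "(\<lambda>n. neval M e u (case n of 0 \<Rightarrow> t | Suc m \<Rightarrow> NVar m)) = case_nat (neval M e u t) e"
    by (rule ext) (simp split: nat.split)
  then show ?thesis by (simp add: ninst_def sat_subst)
qed

lemma sat_finst: "sat M e u (finst \<phi> f) \<longleftrightarrow> sat M e (pushf (farity f) (feval M u f) u) \<phi>"
proof -
  have "(\<lambda>k n. feval M u (if k = farity f then (case n of 0 \<Rightarrow> f | Suc m \<Rightarrow> FVar k m) else FVar k n)) =
      pushf (farity f) (feval M u f) u"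
    by (intro ext) (simp add: pushf_def split: nat.split)
  then show ?thesis by (simp add: finst_def sat_subst)
qed

lemma feval_cong: "(\<And>k n. FunV k n \<in> ftm_fv f \<Longrightarrow> u k n = u' k n) \<Longrightarrow> feval M u f = feval M u' f"
proof (induction f)
  case (Prim p ks m fs)
  have "map (feval M u) fs = map (feval M u') fs" using Prim by (intro map_cong) auto
  then show ?case by (simp only: feval.simps)
next
  case (Fnl F ks m fs)
  have "map (feval M u) fs = map (feval M u') fs" using Fnl by (intro map_cong) auto
  then show ?case by (simp only: feval.simps)
qed auto

lemma neval_cong:
  "(\<And>n. NumV n \<in> ntm_fv t \<Longrightarrow> e n = e' n) \<Longrightarrow>
   (\<And>k n. FunV k n \<in> ntm_fv t \<Longrightarrow> u k n = u' k n) \<Longrightarrow> neval M e u t = neval M e' u' t"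
proof (induction t)
  case (NApp f ts)
  have "feval M u f = feval M u' f" by (rule feval_cong) (auto intro: NApp.prems)
  moreover have "map (neval M e u) ts = map (neval M e' u') ts" by (auto intro!: NApp.IH NApp.prems)
  ultimately show ?case by (simp only: neval.simps)
qed auto

lemma sat_cong:
  "(\<And>n. NumV n \<in> pfm_fv \<phi> \<Longrightarrow> e n = e' n) \<Longrightarrow>
   (\<And>k n. FunV k n \<in> pfm_fv \<phi> \<Longrightarrow> u k n = u' k n) \<Longrightarrow> sat M e u \<phi> \<longleftrightarrow> sat M e' u' \<phi>"
proof (induction \<phi> arbitrary: e e' u u')
  case (PEq s t)
  have "neval M e u s = neval M e' u' s" "neval M e u t = neval M e' u' t"
    by (rule neval_cong; use PEq in auto)+
  then show ?case by simp
next
  case (PImp \<phi>1 \<phi>2)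
  show ?case using PImp.prems by (simp add: PImp.IH(1)[of e e' u u'] PImp.IH(2)[of e e' u u'])
next
  case (PAnd \<phi>1 \<phi>2)
  show ?case using PAnd.prems by (simp add: PAnd.IH(1)[of e e' u u'] PAnd.IH(2)[of e e' u u'])
next
  case (POr \<phi>1 \<phi>2)
  show ?case using POr.prems by (simp add: POr.IH(1)[of e e' u u'] POr.IH(2)[of e e' u u'])
next
  case (PAllN \<phi>)
  have "sat M (case_nat x e) u \<phi> = sat M (case_nat x e') u' \<phi>" for x
    by (rule PAllN.IH) (use PAllN.prems in \<open>auto split: nat.split\<close>)
  then show ?case by simp
next
  case (PExN \<phi>)
  have "sat M (case_nat x e) u \<phi> = sat M (case_nat x e') u' \<phi>" for x
    by (rule PExN.IH) (use PExN.prems in \<open>auto split: nat.split\<close>)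
  then show ?case by simp
next
  case (PAllF k \<phi>)
  have "sat M e (pushf k f u) \<phi> = sat M e' (pushf k f u') \<phi>" for f
    by (rule PAllF.IH) (use PAllF.prems in \<open>auto simp: pushf_def split: nat.split\<close>)
  then show ?case by simp
next
  case (PExF k \<phi>)
  have "sat M e (pushf k f u) \<phi> = sat M e' (pushf k f u') \<phi>" for f
    by (rule PExF.IH) (use PExF.prems in \<open>auto simp: pushf_def split: nat.split\<close>)
  then show ?case by simp
qed auto

section \<open>Completeness\<close>

lemma nup_pow_add: "(nup ^^ k) \<sigma> (n + k) = ntm_subst (\<lambda>i. NVar (i + k)) FVar (\<sigma> n)"
  by (induction k) (auto simp: nup_def ntm_subst_subst)

lemma finst_fup:
  assumes "farity f = k"
  shows "finst (pfm_subst (\<lambda>n. ntm_subst NVar (fren k) (\<sigma> n)) (fup k \<tau>) \<phi>) f =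
    pfm_subst \<sigma> (\<lambda>j n. if j = k then (case n of 0 \<Rightarrow> f | Suc m \<Rightarrow> \<tau> k m) else \<tau> j n) \<phi>"
proof -
  have *: "ftm_subst (\<lambda>j n. if j = k then (case n of 0 \<Rightarrow> f | Suc m \<Rightarrow> FVar j m) else FVar j n)
      (ftm_subst (fren k) h) = h" for h
    unfolding ftm_subst_subst
    by (rule trans[OF ftm_subst_cong ftm_subst_FVar]) (auto simp: fren_def)
  have **: "ntm_subst NVar (\<lambda>j n. if j = k then (case n of 0 \<Rightarrow> f | Suc m \<Rightarrow> FVar j m) else FVar j n)
      (ntm_subst NVar (fren k) h) = h" for h
    unfolding ntm_subst_subst
    by (rule trans[OF ntm_subst_cong ntm_subst_id]) (auto simp: fren_def)
  show ?thesis
    unfolding finst_def pfm_subst_subst using assms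
    by (intro pfm_subst_cong) (auto simp: fup_def * ** split: nat.split)
qed

lemma ninst_nup:
  "ninst (pfm_subst (nup \<sigma>) \<tau> \<phi>) t = pfm_subst (case_nat t \<sigma>) \<tau> \<phi>"
  unfolding ninst_def pfm_subst_subst
  by (rule pfm_subst_cong) (auto simp: nup_def ntm_subst_subst split: nat.split)

context henkin
begin

lemma H_axiom: "pra_axiom \<phi> \<Longrightarrow> H \<phi>"
  unfolding H_def by (blast intro: P_axiom)

text \<open>The outermost of the \<open>k\<close> quantifiers binds the largest index, so the first
  term of \<open>ts\<close> is inserted for index \<open>k - 1\<close>.\<close>

lemma H_PAllNs:
  "pfm_ok \<phi> \<Longrightarrow> H (PAllNs k \<phi>) \<longleftrightarrow>
    (\<forall>ts. length ts = k \<longrightarrow> (\<forall>t \<in> set ts. ntm_ok t) \<longrightarrow>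
      H (pfm_subst (\<lambda>n. if n < k then ts ! (k - Suc n) else NVar (n - k)) FVar \<phi>))"
proof (induction k arbitrary: \<phi>)
  case 0
  then show ?case by (simp add: PAllNs_def)
next
  case (Suc k)
  let ?i = "\<lambda>t n. case n of 0 \<Rightarrow> t | Suc m \<Rightarrow> NVar m"
  have ok: "subst_ok ((nup ^^ k) (?i t)) FVar" if "ntm_ok t" for t
    using that by (induction k) (auto intro: subst_ok_nup)
  have eq: "pfm_subst (\<lambda>n. if n < k then ts ! (k - Suc n) else NVar (n - k)) FVar
      (pfm_subst ((nup ^^ k) (?i t)) FVar \<phi>) =
      pfm_subst (\<lambda>n. if n < Suc k then (t # ts) ! (Suc k - Suc n) else NVar (n - Suc k)) FVar \<phi>"
    for t ts
    unfolding pfm_subst_subst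
  proof (rule pfm_subst_cong)
    fix n
    consider "n < k" | m where "n = m + k" by (metis add.commute le_Suc_ex not_less)
    then show "ntm_subst (\<lambda>n. if n < k then ts ! (k - Suc n) else NVar (n - k)) FVar
        ((nup ^^ k) (?i t) n) = (if n < Suc k then (t # ts) ! (Suc k - Suc n) else NVar (n - Suc k))"
    proof cases
      case 1
      then have "Suc k - Suc n = Suc (k - Suc n)" by simp
      with 1 show ?thesis by (simp add: nup_pow_less)
    next
      case 2
      then show ?thesis
        by (simp only: nup_pow_add ntm_subst_subst) (auto split: nat.split)
    qed
  qed simp
  have all: "(\<forall>ts. length ts = Suc k \<longrightarrow> (\<forall>t \<in> set ts. ntm_ok t) \<longrightarrow> P ts) \<longleftrightarrow>
      (\<forall>t. ntm_ok t \<longrightarrow> (\<forall>ts. length ts = k \<longrightarrow> (\<forall>t \<in> set ts. ntm_ok t) \<longrightarrow> P (t # ts)))"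
    for P :: "ntm list \<Rightarrow> bool" by (auto simp: length_Suc_conv)
  have "PAllNs (Suc k) \<phi> = PAllN (PAllNs k \<phi>)" by (simp add: PAllNs_def)
  moreover have "H (ninst (PAllNs k \<phi>) t) \<longleftrightarrow>
      (\<forall>ts. length ts = k \<longrightarrow> (\<forall>t \<in> set ts. ntm_ok t) \<longrightarrow>
        H (pfm_subst (\<lambda>n. if n < Suc k then (t # ts) ! (Suc k - Suc n) else NVar (n - Suc k)) FVar \<phi>))"
    if "ntm_ok t" for t
    unfolding ninst_def subst_PAllNs Suc.IH[OF pfm_ok_subst[OF ok[OF that] Suc.prems]] eq ..
  ultimately show ?case
    unfolding all using Suc.prems by (simp add: H_allN del: diff_Suc_Suc nth_Cons_Suc)
qed

section \<open>Provable equality of terms and of functions\<close>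

definition eqv :: "ntm \<Rightarrow> ntm \<Rightarrow> bool" where
  "eqv s t \<longleftrightarrow> H (PEq s t)"

lemma nlift_inst [simp]: "ntm_subst (\<lambda>n. case n of 0 \<Rightarrow> t | Suc m \<Rightarrow> NVar m) FVar
    (ntm_subst (\<lambda>n. NVar (Suc n)) FVar s) = s"
  by (simp add: ntm_subst_subst)

lemma nlift_tm_ok [simp]: "ntm_ok t \<Longrightarrow> ntm_ok (ntm_subst (\<lambda>n. NVar (Suc n)) FVar t)"
  by (rule ntm_ok_subst) simp_all

lemma flift_tm_ok [simp]: "ftm_ok f \<Longrightarrow> ftm_ok (ftm_subst (fren k) f)"
  by (rule ftm_ok_subst) simp_all

lemma flift_ntm_ok [simp]: "ntm_ok f \<Longrightarrow> ntm_ok (ntm_subst NVar (fren k) f)"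
  by (rule ntm_ok_subst) simp_all

lemma H_replace:
  assumes "eqv s t" "ntm_ok s" "ntm_ok t" "pfm_ok \<phi>" "H (ninst \<phi> s)"
  shows "H (ninst \<phi> t)"
proof -
  have "pra_proves [PEq s t, ninst \<phi> s] (ninst \<phi> t)"
    by (rule P_replace[of _ _ s]) (use assms in \<open>auto intro!: P_hyp\<close>)
  then show ?thesis by (rule H_ded) (use assms in \<open>auto simp: eqv_def\<close>)
qed

lemma eqv_refl: "ntm_ok t \<Longrightarrow> eqv t t"
  unfolding eqv_def H_def using P_refl by blast

lemma eqv_sym: assumes "eqv s t" "ntm_ok s" "ntm_ok t" shows "eqv t s"
  using H_replace[of s t "PEq (NVar 0) (ntm_subst (\<lambda>n. NVar (Suc n)) FVar s)"] assms eqv_refl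
  by (simp add: eqv_def ninst_def)

lemma eqv_trans: assumes "eqv r s" "eqv s t" "ntm_ok r" "ntm_ok s" "ntm_ok t" shows "eqv r t"
  using H_replace[of s t "PEq (ntm_subst (\<lambda>n. NVar (Suc n)) FVar r) (NVar 0)"] assms
  by (simp add: eqv_def ninst_def)

text \<open>\<open>P_replace\<close> exchanges one term at a time: \<open>pre\<close> collects the
  arguments already exchanged, and the formula marks the current one by
  \<open>NVar 0\<close>.\<close>

lemma eqv_app:
  "list_all2 (\<lambda>s t. ntm_ok s \<and> ntm_ok t \<and> eqv s t) ss ts \<Longrightarrow> ftm_ok f \<Longrightarrow>
   \<forall>t \<in> set pre. ntm_ok t \<Longrightarrow> length pre + length ss = farity f \<Longrightarrow>
   eqv (NApp f (pre @ ss)) (NApp f (pre @ ts))"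
proof (induction ss ts arbitrary: pre rule: list_all2_induct)
  case Nil
  then show ?case by (intro eqv_refl) auto
next
  case (Cons s ss t ts)
  let ?l = "ntm_subst (\<lambda>n. NVar (Suc n)) FVar"
  have len: "length ss = length ts" and okl: "\<forall>t \<in> set ss \<union> set ts. ntm_ok t"
    using Cons.hyps by (auto simp: list_all2_conv_all_nth in_set_conv_nth)
  have "H (PEq (NApp f (pre @ s # ss)) (NApp f (pre @ s # ss)))"
    unfolding eqv_def[symmetric] by (rule eqv_refl) (use Cons.hyps Cons.prems len okl in auto)
  moreover have "pfm_ok (PEq (?l (NApp f (pre @ s # ss))) (NApp f (map ?l pre @ NVar 0 # map ?l ss)))"
    using Cons.hyps Cons.prems okl by auto
  ultimately have "eqv (NApp f (pre @ s # ss)) (NApp f (pre @ t # ss))"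
    using H_replace[of s t "PEq (?l (NApp f (pre @ s # ss))) (NApp f (map ?l pre @ NVar 0 # map ?l ss))"]
      Cons.hyps
    by (simp add: eqv_def ninst_def map_idI comp_def)
  moreover have "eqv (NApp f ((pre @ [t]) @ ss)) (NApp f ((pre @ [t]) @ ts))"
    by (rule Cons.IH) (use Cons.hyps Cons.prems in auto)
  ultimately show ?case
    by - (rule eqv_trans[of _ "NApp f (pre @ t # ss)"], use Cons.hyps Cons.prems len okl in auto)
qed

definition feqv :: "ftm \<Rightarrow> ftm \<Rightarrow> bool" where
  "feqv f g \<longleftrightarrow>
     (\<forall>ts. length ts = farity f \<longrightarrow> (\<forall>t \<in> set ts. ntm_ok t) \<longrightarrow> eqv (NApp f ts) (NApp g ts))"

lemma H_ext:
  assumes "feqv f g" "ftm_ok f" "ftm_ok g" "farity f = k" "farity g = k" "pfm_ok \<phi>" "H (finst \<phi> f)"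
  shows "H (finst \<phi> g)"
proof -
  let ?xs = "map NVar (rev [0..<k])"
  let ?a = "PAllNs k (PEq (NApp f ?xs) (NApp g ?xs))"
  have ok: "pfm_ok ?a" using assms by auto
  have xs: "map (ntm_subst (\<lambda>n. if n < k then ts ! (k - Suc n) else NVar (n - k)) FVar) ?xs = ts"
    if "length ts = k" for ts
    using that by (auto intro!: nth_equalityI simp: rev_nth)
  have "H ?a"
    using ok assms(1,4) by (subst H_PAllNs) (simp_all add: xs feqv_def eqv_def del: map_map)
  moreover have "pra_proves [?a, finst \<phi> f] (finst \<phi> g)"
    by (rule P_ext[of _ f g k]) (use assms ok in \<open>auto intro!: P_hyp\<close>)
  ultimately show ?thesis using assms ok by (auto elim!: H_ded)
qed

text \<open>\<open>C\<close> stands for \<open>Prim p ks m\<close> or \<open>Fnl F ks m\<close>,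
  with \<open>good\<close> for the condition on the identifier. Argument functions are exchanged one
  at a time by \<open>P_ext\<close>, which is where functionals turn out to be extensional.\<close>

lemma feqv_app:
  assumes C: "\<And>\<tau> fs. ftm_subst \<tau> (C fs) = C (map (ftm_subst \<tau>) fs)" "\<And>fs. farity (C fs) = m"
    "\<And>fs. ftm_ok (C fs) \<longleftrightarrow> good \<and> map farity fs = ks \<and> (\<forall>f \<in> set fs. ftm_ok f)"
  shows "list_all2 (\<lambda>f g. ftm_ok f \<and> ftm_ok g \<and> farity f = farity g \<and> feqv f g) fs gs \<Longrightarrow>
   ftm_ok (C (pre @ fs)) \<Longrightarrow> length ts = m \<Longrightarrow> \<forall>t \<in> set ts. ntm_ok t \<Longrightarrow>
   ftm_ok (C (pre @ gs)) \<and> eqv (NApp (C (pre @ fs)) ts) (NApp (C (pre @ gs)) ts)"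
proof (induction fs gs arbitrary: pre rule: list_all2_induct)
  case Nil
  then show ?case by (auto intro!: eqv_refl simp: C)
next
  case (Cons f fs g gs)
  define k where "k = farity f"
  let ?l = "ftm_subst (fren k)" and ?n = "ntm_subst NVar (fren k)"
  have l [simp]: "ftm_subst (\<lambda>j n. if j = k then (case n of 0 \<Rightarrow> h | Suc m \<Rightarrow> FVar j m) else FVar j n)
      (?l f) = f" for f h
    unfolding ftm_subst_subst
    by (rule trans[OF ftm_subst_cong ftm_subst_FVar]) (auto simp: fren_def)
  have n [simp]: "ntm_subst NVar (\<lambda>j n. if j = k then (case n of 0 \<Rightarrow> h | Suc m \<Rightarrow> FVar j m) else FVar j n)
      (?n f) = f" for f h
    unfolding ntm_subst_subst
    by (rule trans[OF ntm_subst_cong ntm_subst_id]) (auto simp: fren_def)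
  have [simp]: "farity \<circ> ?l = farity" by auto
  have 1: "ftm_ok (C (pre @ g # fs))" using Cons.hyps Cons.prems by (simp add: C)
  have 2: "H (PEq (NApp (C (pre @ f # fs)) ts) (NApp (C (pre @ f # fs)) ts))"
    unfolding eqv_def[symmetric] by (rule eqv_refl) (use Cons.prems in \<open>auto simp: C\<close>)
  let ?\<phi> = "PEq (?n (NApp (C (pre @ f # fs)) ts))
     (NApp (C (map ?l pre @ FVar k 0 # map ?l fs)) (map ?n ts))"
  have inst: "finst ?\<phi> h = PEq (NApp (C (pre @ f # fs)) ts) (NApp (C (pre @ h # fs)) ts)"
    if "farity h = k" for h
    using that by (simp add: finst_def C comp_def map_idI)
  have "H (finst ?\<phi> g)"
  proof (rule H_ext[of f g k])
    show "H (finst ?\<phi> f)" using 2 inst[of f] by (simp add: k_def)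
    show "pfm_ok ?\<phi>" using Cons.hyps Cons.prems by (auto simp: C k_def)
  qed (use Cons.hyps in \<open>simp_all add: k_def\<close>)
  moreover have "farity g = k" using Cons.hyps by (simp add: k_def)
  ultimately have 3: "eqv (NApp (C (pre @ f # fs)) ts) (NApp (C (pre @ g # fs)) ts)"
    using inst[of g] by (simp only: eqv_def)
  have 4: "ftm_ok (C ((pre @ [g]) @ gs)) \<and>
      eqv (NApp (C ((pre @ [g]) @ fs)) ts) (NApp (C ((pre @ [g]) @ gs)) ts)"
    by (rule Cons.IH) (use 1 Cons.prems in auto)
  then show ?case using 1 3 Cons.prems eqv_trans[OF 3] by (simp add: C)
qed

section \<open>The term model\<close>

definition classes :: "ntm set set" where
  "classes = (\<lambda>t. {s. ntm_ok s \<and> eqv t s}) ` {t. ntm_ok t}"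

lemma class_eq_iff:
  assumes "ntm_ok s" "ntm_ok t"
  shows "{r. ntm_ok r \<and> eqv s r} = {r. ntm_ok r \<and> eqv t r} \<longleftrightarrow> eqv s t"
proof
  assume "{r. ntm_ok r \<and> eqv s r} = {r. ntm_ok r \<and> eqv t r}"
  then have "ntm_ok t \<and> eqv s t \<longleftrightarrow> ntm_ok t \<and> eqv t t" by (metis (no_types, lifting) mem_Collect_eq)
  then show "eqv s t" using assms eqv_refl by simp
next
  assume "eqv s t"
  then have "eqv s r \<longleftrightarrow> eqv t r" if "ntm_ok r" for r
    using that assms eqv_trans[of s t r] eqv_trans[of t s r] eqv_sym[of s t] by metis
  then show "{r. ntm_ok r \<and> eqv s r} = {r. ntm_ok r \<and> eqv t r}" by auto
qed

lemma eqv_numeral: "eqv (numeral_tm m) (numeral_tm n) \<Longrightarrow> m = n"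
proof (induction m arbitrary: n)
  case 0
  show ?case
  proof (cases n)
    case (Suc k)
    have "eqv (NSuc (numeral_tm k)) NZero" using eqv_sym[OF 0] Suc by simp
    moreover have "H (PNot (PEq (NSuc (numeral_tm k)) NZero))"
      by (rule H_axiom[OF succ_nonzero]) simp
    ultimately show ?thesis using H_mp H_False unfolding eqv_def by blast
  qed simp
next
  case (Suc m)
  show ?case
  proof (cases n)
    case 0
    have "H (PNot (PEq (NSuc (numeral_tm m)) NZero))" by (rule H_axiom[OF succ_nonzero]) simp
    then show ?thesis using H_mp H_False Suc.prems 0 unfolding eqv_def by fastforce
  next
    case (Suc k)
    have "H (PImp (PEq (NSuc (numeral_tm m)) (NSuc (numeral_tm k))) (PEq (numeral_tm m) (numeral_tm k)))"
      by (rule H_axiom[OF succ_injective]) simp_all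
    then have "eqv (numeral_tm m) (numeral_tm k)" using Suc.prems Suc H_mp unfolding eqv_def by force
    with Suc.IH Suc show ?thesis by simp
  qed
qed

text \<open>Infinitely many classes can be numbered by all natural numbers. The term model thus has
  carrier \<open>nat\<close>, and completeness can quantify over the structures on one fixed
  type.\<close>

lemma infinite_classes: "infinite classes"
proof -
  have "inj (\<lambda>n. {s. ntm_ok s \<and> eqv (numeral_tm n) s})"
    by (rule injI) (simp add: class_eq_iff eqv_numeral)
  then have "infinite (range (\<lambda>n. {s. ntm_ok s \<and> eqv (numeral_tm n) s}))"
    by (rule range_inj_infinite)
  moreover have "range (\<lambda>n. {s. ntm_ok s \<and> eqv (numeral_tm n) s}) \<subseteq> classes"
    by (auto simp: classes_def)
  ultimately show ?thesis using finite_subset by blast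
qed

definition cls :: "ntm \<Rightarrow> nat" where
  "cls t = to_nat_on classes {s. ntm_ok s \<and> eqv t s}"

lemma classes_bij: "bij_betw (to_nat_on classes) classes UNIV"
  by (rule to_nat_on_infinite[OF _ infinite_classes]) (simp add: classes_def)

lemma cls_eq_iff: assumes "ntm_ok s" "ntm_ok t" shows "cls s = cls t \<longleftrightarrow> eqv s t"
proof -
  have "{r. ntm_ok r \<and> eqv s r} \<in> classes" "{r. ntm_ok r \<and> eqv t r} \<in> classes"
    using assms unfolding classes_def by blast+
  then show ?thesis
    unfolding cls_def class_eq_iff[OF assms, symmetric]
    by (rule inj_on_eq_iff[OF bij_betw_imp_inj_on[OF classes_bij]])
qed

lemma cls_surj: "\<exists>t. ntm_ok t \<and> cls t = n"
proof -
  have "n \<in> to_nat_on classes ` classes"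
    using bij_betw_imp_surj_on[OF classes_bij] by simp
  then obtain C where "C \<in> classes" "n = to_nat_on classes C" by blast
  then show ?thesis unfolding classes_def cls_def by blast
qed

definition rep :: "nat \<Rightarrow> ntm" where
  "rep n = (SOME t. ntm_ok t \<and> cls t = n)"

lemma rep [simp]: "ntm_ok (rep n)" "cls (rep n) = n"
  using someI_ex[OF cls_surj[of n]] by (simp_all add: rep_def)

text \<open>The fixed value on lists of a wrong length is what makes \<open>fun_ext\<close> true in
  the term model.\<close>

definition fcls :: "ftm \<Rightarrow> nat list \<Rightarrow> nat" where
  "fcls f xs = (if length xs = farity f then cls (NApp f (map rep xs)) else 0)"

lemma eqv_rep_cls: "ntm_ok t \<Longrightarrow> eqv (rep (cls t)) t"
  using cls_eq_iff[of "rep (cls t)" t] by simp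

lemma fcls_app:
  assumes "ftm_ok f" "length ts = farity f" "\<forall>t \<in> set ts. ntm_ok t"
  shows "fcls f (map cls ts) = cls (NApp f ts)"
proof -
  have "eqv (NApp f ([] @ map rep (map cls ts))) (NApp f ([] @ ts))"
    by (rule eqv_app) (use assms in \<open>auto simp: list_all2_conv_all_nth eqv_rep_cls\<close>)
  then show ?thesis using assms by (simp add: fcls_def cls_eq_iff)
qed

lemma fcls_eq_iff:
  assumes "ftm_ok f" "ftm_ok g" "farity f = farity g"
  shows "fcls f = fcls g \<longleftrightarrow> feqv f g"
proof
  assume *: "fcls f = fcls g"
  show "feqv f g"
    unfolding feqv_def
  proof (intro allI impI)
    fix ts assume ts: "length ts = farity f" "\<forall>t \<in> set ts. ntm_ok t"
    then have "cls (NApp f ts) = cls (NApp g ts)"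
      using assms * by (simp add: fcls_app[symmetric])
    then show "eqv (NApp f ts) (NApp g ts)" using ts assms by (simp add: cls_eq_iff)
  qed
next
  assume "feqv f g"
  then show "fcls f = fcls g"
    using assms by (auto simp: fcls_def feqv_def cls_eq_iff fun_eq_iff)
qed

definition frep :: "nat \<Rightarrow> (nat list \<Rightarrow> nat) \<Rightarrow> ftm" where
  "frep k F = (SOME f. ftm_ok f \<and> farity f = k \<and> fcls f = F)"

text \<open>Functionals act on terms representing their arguments; that the choice of
  representatives is immaterial is the content of \<open>fcls_cong\<close>.\<close>

definition term_model :: "nat pra_struct" where
  "term_model = \<lparr>funs = \<lambda>k. fcls ` {f. ftm_ok f \<and> farity f = k},
     prim = \<lambda>p ks m Fs. fcls (Prim p ks m (map2 frep ks Fs)),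
     fnl = \<lambda>F ks m Fs. fcls (Fnl F ks m (map2 frep ks Fs))\<rparr>"

lemma frep:
  assumes "F \<in> funs term_model k"
  shows "ftm_ok (frep k F)" "farity (frep k F) = k" "fcls (frep k F) = F"
proof -
  from assms have "\<exists>f. ftm_ok f \<and> farity f = k \<and> fcls f = F"
    by (auto simp: term_model_def)
  from someI_ex[OF this]
  show "ftm_ok (frep k F)" "farity (frep k F) = k" "fcls (frep k F) = F"
    by (simp_all add: frep_def)
qed

lemma fcls_in_funs: "ftm_ok f \<Longrightarrow> farity f = k \<Longrightarrow> fcls f \<in> funs term_model k"
  by (auto simp: term_model_def)

lemma fcls_cong:
  assumes C: "\<And>\<tau> fs. ftm_subst \<tau> (C fs) = C (map (ftm_subst \<tau>) fs)" "\<And>fs. farity (C fs) = m"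
    "\<And>fs. ftm_ok (C fs) \<longleftrightarrow> good \<and> map farity fs = ks \<and> (\<forall>f \<in> set fs. ftm_ok f)"
    and ok: "ftm_ok (C fs)"
  shows "fcls (C (map2 frep ks (map fcls fs))) = fcls (C fs)"
proof -
  have ks: "ks = map farity fs" "\<forall>f \<in> set fs. ftm_ok f" using ok C(3) by auto
  have *: "list_all2 (\<lambda>f g. ftm_ok f \<and> ftm_ok g \<and> farity f = farity g \<and> feqv f g)
      fs (map2 frep ks (map fcls fs))"
    unfolding list_all2_conv_all_nth
  proof (intro conjI allI impI; (simp add: ks(1); fail)?)
    fix i assume i: "i < length fs"
    then have f: "ftm_ok (fs ! i)" using ks by auto
    from frep[OF fcls_in_funs[OF f refl]] i f ks(1)
    show "ftm_ok (fs ! i)" "ftm_ok (map2 frep ks (map fcls fs) ! i)"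
      "farity (fs ! i) = farity (map2 frep ks (map fcls fs) ! i)"
      "feqv (fs ! i) (map2 frep ks (map fcls fs) ! i)"
      using fcls_eq_iff[of "fs ! i" "frep (farity (fs ! i)) (fcls (fs ! i))"] by auto
  qed
  have "ftm_ok (C ([] @ map2 frep ks (map fcls fs))) \<and>
      eqv (NApp (C ([] @ fs)) ts) (NApp (C ([] @ map2 frep ks (map fcls fs))) ts)"
    if "length ts = m" "\<forall>t \<in> set ts. ntm_ok t" for ts
    by (rule feqv_app[of C, OF C *]) (use ok that in auto)
  \<comment> \<open>Well-formedness does not mention the arguments, but extracting it requires some
    list of length \<open>m\<close>.\<close>
  from this[of "replicate m NZero"] this have "ftm_ok (C (map2 frep ks (map fcls fs)))"
    "feqv (C fs) (C (map2 frep ks (map fcls fs)))"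
    by (auto simp: feqv_def C(2))
  then show ?thesis using fcls_eq_iff[OF ok] C(2) by metis
qed

lemma feval_term_model:
  assumes "\<And>k n. ftm_ok (\<tau> k n)" "\<And>k n. farity (\<tau> k n) = k"
  shows "ftm_ok f \<Longrightarrow> feval term_model (\<lambda>k n. fcls (\<tau> k n)) f = fcls (ftm_subst \<tau> f)"
proof (induction f)
  case (Prim p ks m fs)
  have ok: "ftm_ok (Prim p ks m (map (ftm_subst \<tau>) fs))"
    using ftm_ok_subst[OF assms(2,1) Prim.prems] by simp
  have "map (feval term_model (\<lambda>k n. fcls (\<tau> k n))) fs = map fcls (map (ftm_subst \<tau>) fs)"
    using Prim by auto
  moreover have "fcls (Prim p ks m (map2 frep ks (map fcls (map (ftm_subst \<tau>) fs)))) =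
      fcls (Prim p ks m (map (ftm_subst \<tau>) fs))"
    by (rule fcls_cong[where C = "Prim p ks m" and good = "prfl_ok ks m p"])
      (use ok in \<open>simp_all del: map_map\<close>)
  ultimately show ?case by (simp add: term_model_def del: map_map)
next
  case (Fnl F ks m fs)
  have ok: "ftm_ok (Fnl F ks m (map (ftm_subst \<tau>) fs))"
    using ftm_ok_subst[OF assms(2,1) Fnl.prems] by simp
  have "map (feval term_model (\<lambda>k n. fcls (\<tau> k n))) fs = map fcls (map (ftm_subst \<tau>) fs)"
    using Fnl by auto
  moreover have "fcls (Fnl F ks m (map2 frep ks (map fcls (map (ftm_subst \<tau>) fs)))) =
      fcls (Fnl F ks m (map (ftm_subst \<tau>) fs))"
    by (rule fcls_cong[where C = "Fnl F ks m" and good = True])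
      (use ok in \<open>simp_all del: map_map\<close>)
  ultimately show ?case by (simp add: term_model_def del: map_map)
qed simp

lemma neval_term_model:
  assumes ok: "subst_ok \<sigma> \<tau>"
  shows "ntm_ok t \<Longrightarrow>
    neval term_model (\<lambda>n. cls (\<sigma> n)) (\<lambda>k n. fcls (\<tau> k n)) t = cls (ntm_subst \<sigma> \<tau> t)"
proof (induction t)
  case (NApp f ts)
  have "map (neval term_model (\<lambda>n. cls (\<sigma> n)) (\<lambda>k n. fcls (\<tau> k n))) ts =
      map cls (map (ntm_subst \<sigma> \<tau>) ts)"
    using NApp.IH NApp.prems by simp
  moreover have "fcls (ftm_subst \<tau> f) (map cls (map (ntm_subst \<sigma> \<tau>) ts)) =
      cls (NApp (ftm_subst \<tau> f) (map (ntm_subst \<sigma> \<tau>) ts))"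
  proof (rule fcls_app)
    show "ftm_ok (ftm_subst \<tau> f)"
      using NApp.prems ok by (intro ftm_ok_subst) (simp_all add: subst_ok_def)
    show "length (map (ntm_subst \<sigma> \<tau>) ts) = farity (ftm_subst \<tau> f)"
      using NApp.prems ok by (simp add: subst_ok_def)
    show "\<forall>t \<in> set (map (ntm_subst \<sigma> \<tau>) ts). ntm_ok t"
      using NApp.prems ntm_ok_subst[OF ok] by simp
  qed
  moreover have "feval term_model (\<lambda>k n. fcls (\<tau> k n)) f = fcls (ftm_subst \<tau> f)"
    using ok NApp.prems by (intro feval_term_model) (simp_all add: subst_ok_def)
  ultimately show ?case by (simp del: map_map)
qed simp

text \<open>The truth lemma. An assignment is given by a substitution of representing terms, which
  must be arbitrary because a quantifier extends it by the term inserted for the bound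
  variable.\<close>

lemma sat_term_model:
  "subst_ok \<sigma> \<tau> \<Longrightarrow> pfm_ok \<phi> \<Longrightarrow>
   sat term_model (\<lambda>n. cls (\<sigma> n)) (\<lambda>k n. fcls (\<tau> k n)) \<phi> \<longleftrightarrow> H (pfm_subst \<sigma> \<tau> \<phi>)"
proof (induction \<phi> arbitrary: \<sigma> \<tau>)
  case PFalse
  then show ?case using H_False by simp
next
  case (PEq s t)
  then show ?case
    by (simp add: neval_term_model cls_eq_iff ntm_ok_subst) (simp add: eqv_def)
next
  case (PImp \<phi> \<psi>)
  then show ?case by (simp add: H_imp pfm_ok_subst)
next
  case (PAnd \<phi> \<psi>)
  then show ?case by (simp add: H_and pfm_ok_subst)
next
  case (POr \<phi> \<psi>)
  then show ?case by (simp add: H_or pfm_ok_subst)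
next
  case (PAllN \<phi>)
  have IH: "sat term_model (case_nat (cls t) (\<lambda>n. cls (\<sigma> n))) (\<lambda>k n. fcls (\<tau> k n)) \<phi> \<longleftrightarrow>
      H (ninst (pfm_subst (nup \<sigma>) \<tau> \<phi>) t)" if "ntm_ok t" for t
  proof -
    have "case_nat (cls t) (\<lambda>n. cls (\<sigma> n)) = (\<lambda>n. cls (case_nat t \<sigma> n))"
      by (rule ext) (simp split: nat.split)
    moreover have "subst_ok (case_nat t \<sigma>) \<tau>"
      using PAllN.prems that by (auto simp: subst_ok_def split: nat.split)
    ultimately show ?thesis using PAllN by (simp add: ninst_nup)
  qed
  have "sat term_model (\<lambda>n. cls (\<sigma> n)) (\<lambda>k n. fcls (\<tau> k n)) (PAllN \<phi>) \<longleftrightarrow>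
      (\<forall>t. ntm_ok t \<longrightarrow> H (ninst (pfm_subst (nup \<sigma>) \<tau> \<phi>) t))"
    using IH by (simp, metis rep)
  then show ?case using PAllN.prems by (simp add: H_allN pfm_ok_subst subst_ok_nup)
next
  case (PExN \<phi>)
  have IH: "sat term_model (case_nat (cls t) (\<lambda>n. cls (\<sigma> n))) (\<lambda>k n. fcls (\<tau> k n)) \<phi> \<longleftrightarrow>
      H (ninst (pfm_subst (nup \<sigma>) \<tau> \<phi>) t)" if "ntm_ok t" for t
  proof -
    have "case_nat (cls t) (\<lambda>n. cls (\<sigma> n)) = (\<lambda>n. cls (case_nat t \<sigma> n))"
      by (rule ext) (simp split: nat.split)
    moreover have "subst_ok (case_nat t \<sigma>) \<tau>"
      using PExN.prems that by (auto simp: subst_ok_def split: nat.split)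
    ultimately show ?thesis using PExN by (simp add: ninst_nup)
  qed
  have "sat term_model (\<lambda>n. cls (\<sigma> n)) (\<lambda>k n. fcls (\<tau> k n)) (PExN \<phi>) \<longleftrightarrow>
      (\<exists>t. ntm_ok t \<and> H (ninst (pfm_subst (nup \<sigma>) \<tau> \<phi>) t))"
    using IH by (simp, metis rep)
  then show ?case using PExN.prems by (simp add: H_exN pfm_ok_subst subst_ok_nup)
next
  case (PAllF k \<phi>)
  have IH: "sat term_model (\<lambda>n. cls (\<sigma> n)) (pushf k (fcls f) (\<lambda>k n. fcls (\<tau> k n))) \<phi> \<longleftrightarrow>
      H (finst (pfm_subst (\<lambda>n. ntm_subst NVar (fren k) (\<sigma> n)) (fup k \<tau>) \<phi>) f)"
    if "ftm_ok f" "farity f = k" for f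
  proof -
    let ?\<tau> = "\<lambda>j n. if j = k then (case n of 0 \<Rightarrow> f | Suc m \<Rightarrow> \<tau> k m) else \<tau> j n"
    have "pushf k (fcls f) (\<lambda>k n. fcls (\<tau> k n)) = (\<lambda>j n. fcls (?\<tau> j n))"
      by (intro ext) (auto simp: pushf_def split: nat.split)
    moreover have "subst_ok \<sigma> ?\<tau>"
      using PAllF.prems that by (auto simp: subst_ok_def split: nat.split)
    ultimately show ?thesis using PAllF that by (simp add: finst_fup)
  qed
  have "sat term_model (\<lambda>n. cls (\<sigma> n)) (\<lambda>k n. fcls (\<tau> k n)) (PAllF k \<phi>) \<longleftrightarrow>
      (\<forall>f. ftm_ok f \<longrightarrow> farity f = k \<longrightarrow>
        H (finst (pfm_subst (\<lambda>n. ntm_subst NVar (fren k) (\<sigma> n)) (fup k \<tau>) \<phi>) f))"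
    using IH by (auto simp: term_model_def)
  then show ?case using PAllF.prems by (simp add: H_allF pfm_ok_subst subst_ok_fup)
next
  case (PExF k \<phi>)
  have IH: "sat term_model (\<lambda>n. cls (\<sigma> n)) (pushf k (fcls f) (\<lambda>k n. fcls (\<tau> k n))) \<phi> \<longleftrightarrow>
      H (finst (pfm_subst (\<lambda>n. ntm_subst NVar (fren k) (\<sigma> n)) (fup k \<tau>) \<phi>) f)"
    if "ftm_ok f" "farity f = k" for f
  proof -
    let ?\<tau> = "\<lambda>j n. if j = k then (case n of 0 \<Rightarrow> f | Suc m \<Rightarrow> \<tau> k m) else \<tau> j n"
    have "pushf k (fcls f) (\<lambda>k n. fcls (\<tau> k n)) = (\<lambda>j n. fcls (?\<tau> j n))"
      by (intro ext) (auto simp: pushf_def split: nat.split)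
    moreover have "subst_ok \<sigma> ?\<tau>"
      using PExF.prems that by (auto simp: subst_ok_def split: nat.split)
    ultimately show ?thesis using PExF that by (simp add: finst_fup)
  qed
  have "sat term_model (\<lambda>n. cls (\<sigma> n)) (\<lambda>k n. fcls (\<tau> k n)) (PExF k \<phi>) \<longleftrightarrow>
      (\<exists>f. ftm_ok f \<and> farity f = k \<and>
        H (finst (pfm_subst (\<lambda>n. ntm_subst NVar (fren k) (\<sigma> n)) (fup k \<tau>) \<phi>) f))"
    using IH by (auto simp: term_model_def)
  then show ?case using PExF.prems by (simp add: H_exF pfm_ok_subst subst_ok_fup)
qed

lemma pra_axiom_ok: "pra_axiom \<phi> \<Longrightarrow> pfm_ok \<phi>"
proof (induction rule: pra_axiom.induct)
  case (nat_induction \<phi>)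
  have "subst_ok (\<lambda>n. case n of 0 \<Rightarrow> NSuc (NVar 0) | Suc m \<Rightarrow> NVar (Suc m)) FVar"
    by (auto simp: subst_ok_def split: nat.split)
  then show ?case using nat_induction by (simp add: pfm_ok_subst)
qed (auto simp: nth_mem)

lemma term_model: "pra_model term_model"
proof
  fix f g k assume fg: "f \<in> funs term_model k" "g \<in> funs term_model k"
    and eq: "\<And>xs. length xs = k \<Longrightarrow> f xs = g xs"
  show "f = g"
  proof
    fix xs show "f xs = g xs"
      using fg eq by (cases "length xs = k") (auto simp: term_model_def fcls_def)
  qed
next
  fix ks m p and fs :: "(nat list \<Rightarrow> nat) list"
  assume *: "prfl_ok ks m p" "list_all2 (\<lambda>f k. f \<in> funs term_model k) fs ks"
  have "ftm_ok (Prim p ks m (map2 frep ks fs))"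
    using * by (auto simp: list_all2_conv_all_nth in_set_conv_nth frep intro!: nth_equalityI)
  then show "prim term_model p ks m fs \<in> funs term_model m"
    using fcls_in_funs by (force simp: term_model_def)
next
  fix ks m F and fs :: "(nat list \<Rightarrow> nat) list"
  assume *: "list_all2 (\<lambda>f k. f \<in> funs term_model k) fs ks"
  have "ftm_ok (Fnl F ks m (map2 frep ks fs))"
    using * by (auto simp: list_all2_conv_all_nth in_set_conv_nth frep intro!: nth_equalityI)
  then show "fnl term_model F ks m fs \<in> funs term_model m"
    using fcls_in_funs by (force simp: term_model_def)
next
  fix \<phi> u and e :: "nat \<Rightarrow> nat"
  assume ax: "pra_axiom \<phi>" and "fenv term_model u"
  then have u: "u k n \<in> funs term_model k" for k n by (simp add: fenv_def)
  \<comment> \<open>Every assignment comes from a substitution, and the instance of an axiom under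
    it is again an axiom, hence in \<open>H\<close>.\<close>
  have "subst_ok (\<lambda>n. rep (e n)) (\<lambda>k n. frep k (u k n))"
    using frep(1,2)[OF u] by (simp add: subst_ok_def)
  then show "sat term_model e u \<phi>"
    using sat_term_model[of "\<lambda>n. rep (e n)" "\<lambda>k n. frep k (u k n)" \<phi>] frep(3)[OF u]
      H_axiom[OF pra_axiom_subst[OF ax]] pra_axiom_ok[OF ax] by simp
qed

end

text \<open>The term model of a Henkin extension of the negation refutes an unprovable formula.
  Since formulas are countable, structures on \<open>nat\<close> suffice.\<close>

theorem completeness:
  assumes ok: "pfm_ok \<phi>"
    and valid: "\<And>(M :: nat pra_struct) e u. pra_model M \<Longrightarrow> fenv M u \<Longrightarrow> sat M e u \<phi>"
  shows "pra_proves [] \<phi>"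
proof (rule ccontr)
  assume "\<not> pra_proves [] \<phi>"
  then have "consistent [PNot \<phi>]"
    using P_classical[OF ok] by (auto simp: consistent_def)
  then obtain G where "henkin G" and G: "G 0 = [PNot \<phi>]" by (rule henkin_extension)
  interpret henkin G by fact
  have "H (PNot \<phi>)" by (rule H_hyp[of _ 0]) (simp_all add: G ok)
  then have "\<not> sat term_model (\<lambda>n. cls (NVar n)) (\<lambda>k n. fcls (FVar k n)) \<phi>"
    using H_Not[OF ok] sat_term_model[of NVar FVar \<phi>] ok by simp
  then show False
    using valid[OF term_model] by (auto simp: fenv_def fcls_in_funs)
qed

section \<open>Arithmetic in a model\<close>

text \<open>Identifiers that never call an argument function. \<open>Prim p ks m fs\<close> and
  \<open>Papp p\<close> are different terms even for these, and their values have to be shown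
  equal.\<close>

fun arg_free :: "prfl \<Rightarrow> bool" where
  "arg_free (PArg i) = False"
| "arg_free (PComp p qs) = (arg_free p \<and> (\<forall>q \<in> set qs. arg_free q))"
| "arg_free (PRec p q) = (arg_free p \<and> arg_free q)"
| "arg_free p = True"

lemma prfl_ok_arg_free: "arg_free p \<Longrightarrow> prfl_ok ks m p \<Longrightarrow> prfl_ok ks' m p"
  by (induction p arbitrary: m) auto

lemma Papp_ok [simp]: "ntm_ok (Papp p ts) \<longleftrightarrow> prfl_ok [] (length ts) p \<and> (\<forall>t \<in> set ts. ntm_ok t)"
  by (auto simp: Papp_def)

context pra_model
begin

definition typed :: "('a list \<Rightarrow> 'a) list \<Rightarrow> nat list \<Rightarrow> bool" where
  "typed fs ks \<longleftrightarrow> list_all2 (\<lambda>f k. f \<in> funs M k) fs ks"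

lemma typed_Nil [simp]: "typed [] []" and typed_Cons [simp]:
  "typed (f # fs) (k # ks) \<longleftrightarrow> f \<in> funs M k \<and> typed fs ks"
  by (simp_all add: typed_def)

definition pr :: "prfl \<Rightarrow> 'a list \<Rightarrow> 'a" where
  "pr p xs = prim M p [] (length xs) [] xs"

lemma neval_Papp [simp]: "neval M e u (Papp p ts) = pr p (map (neval M e u) ts)"
  by (simp add: Papp_def pr_def)

definition Z :: 'a where "Z = pr PZero []"
definition S :: "'a \<Rightarrow> 'a" where "S x = pr PSucc [x]"

lemma neval_NZero [simp]: "neval M e u NZero = Z"
  by (simp add: NZero_def Z_def)

lemma neval_NSuc [simp]: "neval M e u (NSuc t) = S (neval M e u t)"
  by (simp add: NSuc_def S_def)

definition dflt :: "nat \<Rightarrow> 'a list \<Rightarrow> 'a" where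
  "dflt k = prim M PZero [] k []"

lemma dflt_in_funs: "dflt k \<in> funs M k"
  unfolding dflt_def by (rule prim_closed) simp_all

text \<open>Makes the variable \<open>FVar (ks ! i) i\<close> denote the argument
  \<open>fs ! i\<close>. Position \<open>i\<close> as index keeps the arguments apart whatever their
  arities, and defaults keep the environment well-typed elsewhere.\<close>

definition args_env :: "nat list \<Rightarrow> ('a list \<Rightarrow> 'a) list \<Rightarrow> nat \<Rightarrow> nat \<Rightarrow> 'a list \<Rightarrow> 'a" where
  "args_env ks fs k n = (if n < length ks \<and> ks ! n = k then fs ! n else dflt k)"

lemma fenv_args: "typed fs ks \<Longrightarrow> fenv M (args_env ks fs)"
  by (auto simp: fenv_def args_env_def typed_def list_all2_conv_all_nth dflt_in_funs)

definition fargs :: "nat list \<Rightarrow> ftm list" where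
  "fargs ks = map2 FVar ks [0..<length ks]"

definition nargs :: "nat \<Rightarrow> ntm list" where
  "nargs m = map NVar [0..<m]"

lemma feval_fargs [simp]: "typed fs ks \<Longrightarrow> map (feval M (args_env ks fs)) (fargs ks) = fs"
  by (auto simp: fargs_def args_env_def typed_def list_all2_conv_all_nth intro!: nth_equalityI)

lemma neval_nargs [simp]: "length xs = m \<Longrightarrow> map (neval M ((!) xs) u) (nargs m) = xs"
  by (auto simp: nargs_def intro!: nth_equalityI)

lemma fargs_ok [simp]: "map farity (fargs ks) = ks" "f \<in> set (fargs ks) \<Longrightarrow> ftm_ok f"
  by (auto simp: fargs_def set_zip intro!: nth_equalityI)

lemma nargs_ok [simp]: "length (nargs m) = m" "t \<in> set (nargs m) \<Longrightarrow> ntm_ok t"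
  by (auto simp: nargs_def)

lemma nth_fargs: "i < length ks \<Longrightarrow> fargs ks ! i = FVar (ks ! i) i"
  by (simp add: fargs_def)

lemma length_fargs [simp]: "length (fargs ks) = length ks"
  by (simp add: fargs_def)

lemma nth_nargs [simp]: "i < m \<Longrightarrow> nargs m ! i = NVar i"
  by (simp add: nargs_def)

text \<open>The defining equations are axioms for all terms; read at distinct variables they hold
  for arbitrary elements and functions of the model.\<close>

lemma prim_eqs:
  assumes fs: "typed fs ks"
  shows prim_PZero: "length xs = m \<Longrightarrow> prim M PZero ks m fs xs = Z"
    and prim_PSucc: "prim M PSucc ks (Suc 0) fs [x] = S x"
    and prim_PProj: "i < m \<Longrightarrow> length xs = m \<Longrightarrow> prim M (PProj i) ks m fs xs = xs ! i"
    and prim_PArg: "i < length ks \<Longrightarrow> m = ks ! i \<Longrightarrow> length xs = m \<Longrightarrow>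
      prim M (PArg i) ks m fs xs = (fs ! i) xs"
    and prim_PComp: "prfl_ok ks m (PComp p qs) \<Longrightarrow> length xs = m \<Longrightarrow>
      prim M (PComp p qs) ks m fs xs =
      prim M p ks (length qs) fs (map (\<lambda>q. prim M q ks m fs xs) qs)"
    and prim_PRec_Z: "prfl_ok ks (Suc m) (PRec p q) \<Longrightarrow> length xs = m \<Longrightarrow>
      prim M (PRec p q) ks (Suc m) fs (Z # xs) = prim M p ks m fs xs"
    and prim_PRec_S: "prfl_ok ks (Suc m) (PRec p q) \<Longrightarrow> length xs = m \<Longrightarrow>
      prim M (PRec p q) ks (Suc m) fs (S x # xs) =
      prim M q ks (Suc (Suc m)) fs (x # prim M (PRec p q) ks (Suc m) fs (x # xs) # xs)"
proof -
  note ax = axiom_sat[OF _ fenv_args[OF fs]]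
  note fs [simp]
  show "prim M PZero ks m fs xs = Z" if "length xs = m"
    using ax[OF def_zero, of ks m "fargs ks" "nargs m" "(!) xs"] that by simp
  show "prim M PSucc ks (Suc 0) fs [x] = S x"
    using ax[OF def_succ, of ks "fargs ks" "NVar 0" "\<lambda>_. x"] by simp
  show "prim M (PProj i) ks m fs xs = xs ! i" if "i < m" "length xs = m"
    using ax[OF def_proj, of i ks m "fargs ks" "nargs m" "(!) xs"] that by simp
  show "prim M (PArg i) ks m fs xs = (fs ! i) xs" if "i < length ks" "m = ks ! i" "length xs = m"
    using ax[OF def_arg, of i ks m "fargs ks" "nargs m" "(!) xs"] that
    by (simp add: nth_fargs args_env_def)
  show "prim M (PComp p qs) ks m fs xs =
      prim M p ks (length qs) fs (map (\<lambda>q. prim M q ks m fs xs) qs)"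
    if "prfl_ok ks m (PComp p qs)" "length xs = m"
    using ax[OF def_comp, of p qs ks m "fargs ks" "nargs m" "(!) xs"] that by (simp add: comp_def)
  show "prim M (PRec p q) ks (Suc m) fs (Z # xs) = prim M p ks m fs xs"
    if "prfl_ok ks (Suc m) (PRec p q)" "length xs = m"
    using ax[OF def_rec_zero, of p q ks m "fargs ks" "nargs m" "(!) xs"] that by simp
  have env: "map (neval M (case_nat x ((!) xs)) u) (map (\<lambda>n. NVar (Suc n)) [0..<m]) = xs"
    if "length xs = m" for u
    using that by (auto intro!: nth_equalityI)
  show "prim M (PRec p q) ks (Suc m) fs (S x # xs) =
      prim M q ks (Suc (Suc m)) fs (x # prim M (PRec p q) ks (Suc m) fs (x # xs) # xs)"
    if "prfl_ok ks (Suc m) (PRec p q)" "length xs = m"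
    using ax[OF def_rec_succ, of p q ks m "fargs ks" "NVar 0" "map (\<lambda>n. NVar (Suc n)) [0..<m]"
        "case_nat x ((!) xs)"] that
    by (simp add: env del: map_map)
qed

lemma S_inject [simp]: "S x = S y \<longleftrightarrow> x = y"
  using axiom_sat[OF succ_injective[of "NVar 0" "NVar 1"] fenv_args[OF typed_Nil], of "case_nat x (\<lambda>_. y)"]
  by auto

lemma S_not_Z [simp]: "S x \<noteq> Z" "Z \<noteq> S x"
  using axiom_sat[OF succ_nonzero[of "NVar 0"] fenv_args[OF typed_Nil], of "\<lambda>_. x"] by auto

text \<open>Parameters of the property enter through \<open>e\<close> and \<open>u\<close>; axioms
  hold only for functions of the model, whence \<open>fenv M u\<close>.\<close>

lemma sat_induct:
  assumes ok: "pfm_ok \<phi>" "fenv M u" and Z: "sat M (case_nat Z e) u \<phi>"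
    and S: "\<And>x. sat M (case_nat x e) u \<phi> \<Longrightarrow> sat M (case_nat (S x) e) u \<phi>"
  shows "sat M (case_nat x e) u \<phi>"
proof -
  have "(\<lambda>n. neval M (case_nat x e) u (case n of 0 \<Rightarrow> NSuc (NVar 0) | Suc m \<Rightarrow> NVar (Suc m))) =
      case_nat (S x) e" for x
    by (rule ext) (simp split: nat.split)
  then show ?thesis
    using axiom_sat[OF nat_induction[OF ok(1)] ok(2), of e] Z S by (simp add: sat_ninst sat_subst)
qed

text \<open>The recursion argument may be nonstandard, so for \<open>PRec\<close> the agreement of
  both sides is proved by induction inside the model.\<close>

lemma prim_arg_free:
  "arg_free p \<Longrightarrow> typed fs ks \<Longrightarrow> prfl_ok ks m p \<Longrightarrow> length xs = m \<Longrightarrow>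
   prim M p ks m fs xs = pr p xs"
proof (induction p arbitrary: m xs)
  case PSucc
  then show ?case by (auto simp: length_Suc_conv prim_PSucc pr_def)
next
  case (PComp p qs)
  then have ok: "prfl_ok [] m (PComp p qs)"
    using prfl_ok_arg_free[of "PComp p qs" ks m "[]"] by simp
  have "map (\<lambda>q. prim M q ks m fs xs) qs = map (\<lambda>q. prim M q [] m [] xs) qs"
    using PComp by (auto simp: pr_def)
  then show ?case
    using PComp.prems ok PComp.IH(1)[of "length qs"]
    by (simp add: prim_PComp pr_def del: map_eq_conv)
next
  case (PRec p q)
  then obtain k where k: "m = Suc k" by (cases m) auto
  with PRec.prems obtain y ys where xs: "xs = y # ys" "length ys = k" by (auto simp: length_Suc_conv)
  have ok: "prfl_ok [] (Suc k) (PRec p q)" "prfl_ok ks (Suc k) (PRec p q)"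
    using PRec.prems prfl_ok_arg_free[of "PRec p q" ks "Suc k" "[]"] by (simp_all add: k)
  let ?ts = "NVar 0 # map (\<lambda>n. NVar (Suc n)) [0..<k]"
  let ?\<phi> = "PEq (NApp (Prim (PRec p q) ks (Suc k) (fargs ks)) ?ts) (NApp (Prim (PRec p q) [] (Suc k) []) ?ts)"
  have env: "map (neval M (case_nat x ((!) ys)) u) (map (\<lambda>n. NVar (Suc n)) [0..<k]) = ys" for x u
    using xs by (auto intro!: nth_equalityI)
  have sat: "sat M (case_nat x ((!) ys)) (args_env ks fs) ?\<phi> \<longleftrightarrow>
      prim M (PRec p q) ks (Suc k) fs (x # ys) = prim M (PRec p q) [] (Suc k) [] (x # ys)" for x
    using PRec.prems(2) by (simp add: env del: map_map)
  have "sat M (case_nat y ((!) ys)) (args_env ks fs) ?\<phi>"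
  proof (rule sat_induct)
    show "pfm_ok ?\<phi>" using ok by auto
    show "sat M (case_nat Z ((!) ys)) (args_env ks fs) ?\<phi>"
      using PRec.prems(1,2) ok xs PRec.IH(1)[of k ys] unfolding sat
      by (simp add: prim_PRec_Z pr_def)
    show "sat M (case_nat (S x) ((!) ys)) (args_env ks fs) ?\<phi>"
      if "sat M (case_nat x ((!) ys)) (args_env ks fs) ?\<phi>" for x
      using that PRec.prems(1,2) ok xs PRec.IH(2)[of "Suc (Suc k)"] unfolding sat
      by (simp add: prim_PRec_S pr_def)
  qed (rule fenv_args[OF PRec.prems(2)])
  then show ?case unfolding sat by (simp add: xs k pr_def)
qed (auto simp: prim_eqs pr_def)

end

lemma prfl_ok_arith:
  "prfl_ok ks (Suc (Suc 0)) p_add" "prfl_ok ks (Suc 0) p_pred" "prfl_ok ks (Suc (Suc 0)) p_sub"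
  "prfl_ok ks (Suc 0) p_is0" "prfl_ok ks m p_one"
  "prfl_ok ks (Suc 0) p_tri" "prfl_ok ks (Suc (Suc 0)) p_pair" "prfl_ok ks (Suc 0) p_diag"
  "prfl_ok ks (Suc 0) p_fst" "prfl_ok ks (Suc 0) p_snd" "prfl_ok ks (Suc (Suc 0)) p_cons"
  "prfl_ok ks (Suc 0) p_hd" "prfl_ok ks (Suc 0) p_tl" "prfl_ok ks (Suc (Suc 0)) p_drop"
  "prfl_ok ks (Suc (Suc 0)) p_nth" "prfl_ok ks (Suc (Suc (Suc 0))) p_segment"
  "prfl_ok ks (Suc (Suc 0)) p_take"
  by (simp_all add: p_add_def p_pred_def p_sub_def p_is0_def p_one_def p_tri_def p_pair_def p_diag_def
      p_fst_def p_snd_def p_cons_def p_hd_def p_tl_def p_drop_def p_nth_def p_segment_def p_take_def)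

lemma arg_free_arith:
  "arg_free p_add" "arg_free p_pred" "arg_free p_sub" "arg_free p_is0" "arg_free p_one"
  "arg_free p_tri" "arg_free p_pair" "arg_free p_diag" "arg_free p_fst" "arg_free p_snd"
  "arg_free p_cons" "arg_free p_hd" "arg_free p_tl" "arg_free p_drop" "arg_free p_nth"
  "arg_free p_segment" "arg_free p_take"
  by (simp_all add: p_add_def p_pred_def p_sub_def p_is0_def p_one_def p_tri_def p_pair_def p_diag_def
      p_fst_def p_snd_def p_cons_def p_hd_def p_tl_def p_drop_def p_nth_def p_segment_def p_take_def)

text \<open>\<open>p_glue\<close> maps \<open>k, n, b, a\<close> to \<open>drop (n - k) (take n b) @ a\<close>, and \<open>p_app\<close> maps
  \<open>m, b, a\<close> to \<open>take m b @ a\<close>, where \<open>b\<close> is padded by zeros if it is too short.\<close>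

definition p_glue :: prfl where
  "p_glue = PRec (PProj 2)
     (PComp p_cons
        [PComp p_nth [PComp p_sub [PComp PSucc [PProj 0], PProj 2], PProj 3], PProj 1])"

definition p_app :: prfl where
  "p_app = PComp p_glue [PProj 0, PProj 0, PProj 1, PProj 2]"

lemma prfl_ok_glue:
  "prfl_ok ks (Suc (Suc (Suc (Suc 0)))) p_glue" "prfl_ok ks (Suc (Suc (Suc 0))) p_app"
  by (simp_all add: p_glue_def p_app_def prfl_ok_arith)

context pra_model
begin

lemma pr_PZero: "pr PZero xs = Z"
  and pr_PSucc: "pr PSucc [x] = S x"
  and pr_PProj: "i < length xs \<Longrightarrow> pr (PProj i) xs = xs ! i"
  by (simp_all add: pr_def prim_eqs)

lemma pr_PComp:
  "prfl_ok [] (length xs) (PComp p qs) \<Longrightarrow> pr (PComp p qs) xs = pr p (map (\<lambda>q. pr q xs) qs)"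
  by (simp add: pr_def prim_PComp)

lemma pr_PRec:
  "prfl_ok [] (Suc (length xs)) (PRec p q) \<Longrightarrow> pr (PRec p q) (Z # xs) = pr p xs"
  "prfl_ok [] (Suc (length xs)) (PRec p q) \<Longrightarrow>
   pr (PRec p q) (S x # xs) = pr q (x # pr (PRec p q) (x # xs) # xs)"
  by (simp_all add: pr_def prim_PRec_Z prim_PRec_S)

lemmas pr_eqs = pr_PZero pr_PSucc pr_PProj pr_PComp pr_PRec prfl_ok_arith prfl_ok_glue

definition add where "add x y = pr p_add [x, y]"
definition pred where "pred x = pr p_pred [x]"
definition sub where "sub x y = pr p_sub [x, y]"
definition tri where "tri x = pr p_tri [x]"
definition pair where "pair x y = pr p_pair [x, y]"
definition diag where "diag x = pr p_diag [x]"
definition pfst where "pfst x = pr p_fst [x]"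
definition psnd where "psnd x = pr p_snd [x]"
definition cons where "cons x y = pr p_cons [x, y]"
definition hd\<^sub>M where "hd\<^sub>M x = pr p_hd [x]"
definition tl\<^sub>M where "tl\<^sub>M x = pr p_tl [x]"
definition drop\<^sub>M where "drop\<^sub>M x y = pr p_drop [x, y]"
definition nth\<^sub>M where "nth\<^sub>M x y = pr p_nth [x, y]"
definition seg where "seg x y z = pr p_segment [x, y, z]"
definition take\<^sub>M where "take\<^sub>M x y = pr p_take [x, y]"
definition glue where "glue x y z w = pr p_glue [x, y, z, w]"
definition app where "app x y z = pr p_app [x, y, z]"

text \<open>Evaluating a formula yields values of the form \<open>pr p xs\<close>; these equations
  lead back to the operations about which the lemmas speak.\<close>

lemmas fold_ops = add_def[symmetric] pred_def[symmetric] sub_def[symmetric] tri_def[symmetric]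
  pair_def[symmetric] diag_def[symmetric] pfst_def[symmetric] psnd_def[symmetric]
  cons_def[symmetric] hd\<^sub>M_def[symmetric] tl\<^sub>M_def[symmetric] drop\<^sub>M_def[symmetric]
  nth\<^sub>M_def[symmetric] seg_def[symmetric] take\<^sub>M_def[symmetric] glue_def[symmetric] app_def[symmetric]

lemma add_simps [simp]: "add Z y = y" "add (S x) y = S (add x y)"
  by (simp_all add: add_def p_add_def pr_eqs)

lemma pred_simps [simp]: "pred Z = Z" "pred (S x) = x"
  by (simp_all add: pred_def p_pred_def pr_eqs)

lemma sub_simps [simp]: "sub Z x = x" "sub (S n) x = pred (sub n x)"
  by (simp_all add: sub_def pred_def p_sub_def pr_eqs)

lemma tri_simps [simp]: "tri Z = Z" "tri (S n) = add (tri n) (S n)"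
  by (simp_all add: tri_def add_def p_tri_def pr_eqs)

lemma pair_eq: "pair m n = add (tri (add m n)) m"
  by (simp add: pair_def add_def tri_def p_pair_def pr_eqs)

lemma diag_simps [simp]: "diag Z = Z"
  "diag (S n) = add (diag n) (sub (sub (S n) (tri (S (diag n)))) (S Z))"
  by (simp_all only: diag_def add_def sub_def tri_def)
    (simp_all add: p_diag_def p_is0_def p_one_def pr_eqs)

lemma pfst_eq: "pfst z = sub (tri (diag z)) z"
  and psnd_eq: "psnd z = sub (pfst z) (diag z)"
  by (simp_all add: pfst_def psnd_def sub_def tri_def diag_def p_fst_def[symmetric])
     (simp_all add: p_fst_def p_snd_def pr_eqs)

lemma cons_eq: "cons i b = S (pair i b)"
  by (simp add: cons_def pair_def p_cons_def pr_eqs)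

lemma hd_eq: "hd\<^sub>M a = pfst (pred a)"
  by (simp add: hd\<^sub>M_def pfst_def pred_def p_hd_def pr_eqs)

lemma tl_eq: "tl\<^sub>M a = psnd (pred a)"
  by (simp add: tl\<^sub>M_def psnd_def pred_def p_tl_def pr_eqs)

lemma drop_simps [simp]: "drop\<^sub>M Z a = a" "drop\<^sub>M (S n) a = tl\<^sub>M (drop\<^sub>M n a)"
  by (simp_all add: drop\<^sub>M_def tl\<^sub>M_def p_drop_def pr_eqs)

lemma nth_eq: "nth\<^sub>M n a = hd\<^sub>M (drop\<^sub>M n a)"
  by (simp add: nth\<^sub>M_def hd\<^sub>M_def drop\<^sub>M_def p_nth_def pr_eqs)

lemma seg_simps [simp]: "seg Z n a = Z"
  "seg (S m) n a = cons (nth\<^sub>M (sub (S m) n) a) (seg m n a)"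
  by (simp_all only: seg_def cons_def nth\<^sub>M_def sub_def)
    (simp_all add: p_segment_def pr_eqs eval_nat_numeral)

lemma take_eq: "take\<^sub>M n a = seg n n a"
  by (simp add: take\<^sub>M_def seg_def p_take_def pr_eqs)

lemma glue_simps [simp]: "glue Z n b a = a"
  "glue (S m) n b a = cons (nth\<^sub>M (sub (S m) n) b) (glue m n b a)"
  by (simp_all only: glue_def cons_def nth\<^sub>M_def sub_def)
    (simp_all add: p_glue_def pr_eqs eval_nat_numeral)

lemma app_eq: "app m b a = glue m m b a"
  by (simp add: app_def glue_def p_app_def pr_eqs eval_nat_numeral)

text \<open>A well-typed environment to start from; in formulas evaluated in it, function variables
  are bound or have been pushed on top.\<close>

definition u0 :: "nat \<Rightarrow> nat \<Rightarrow> 'a list \<Rightarrow> 'a" where "u0 = args_env [] []"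

lemma fenv_u0 [simp]: "fenv M u0"
  unfolding u0_def by (rule fenv_args) simp

lemmas ind_simps = fold_ops prfl_ok_arith prfl_ok_glue

section \<open>Addition, truncated subtraction and order\<close>

lemma add_Z_right [simp]: "add x Z = x"
proof -
  have "sat M (case_nat x e) u0 (PEq (Papp p_add [NVar 0, NZero]) (NVar 0))" for e
    by (rule sat_induct) (simp_all add: ind_simps)
  then show ?thesis by (simp add: ind_simps)
qed

lemma add_S_right [simp]: "add x (S y) = S (add x y)"
proof -
  have "sat M (case_nat x (\<lambda>_. y)) u0
      (PEq (Papp p_add [NVar 0, NSuc (NVar 1)]) (NSuc (Papp p_add [NVar 0, NVar 1])))"
    by (rule sat_induct) (simp_all add: ind_simps)
  then show ?thesis by (simp add: ind_simps)
qed

lemma add_commute: "add x y = add y x"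
proof -
  have "sat M (case_nat x (\<lambda>_. y)) u0 (PEq (Papp p_add [NVar 0, NVar 1]) (Papp p_add [NVar 1, NVar 0]))"
    by (rule sat_induct) (simp_all add: ind_simps)
  then show ?thesis by (simp add: ind_simps)
qed

lemma add_assoc: "add (add x y) z = add x (add y z)"
proof -
  have "sat M (case_nat x (case_nat y (\<lambda>_. z))) u0
      (PEq (Papp p_add [Papp p_add [NVar 0, NVar 1], NVar 2]) (Papp p_add [NVar 0, Papp p_add [NVar 1, NVar 2]]))"
    by (rule sat_induct) (simp_all add: ind_simps)
  then show ?thesis by (simp add: ind_simps)
qed

lemma add_cancel_left [simp]: "add x y = add x z \<longleftrightarrow> y = z"
proof -
  have "sat M (case_nat x (case_nat y (\<lambda>_. z))) u0
      (PImp (PEq (Papp p_add [NVar 0, NVar 1]) (Papp p_add [NVar 0, NVar 2])) (PEq (NVar 1) (NVar 2)))"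
    by (rule sat_induct) (simp_all add: ind_simps)
  then show ?thesis by (auto simp: ind_simps)
qed

lemma Z_or_S: "x = Z \<or> (\<exists>y. x = S y)"
proof -
  have "sat M (case_nat x e) u0 (POr (PEq (NVar 0) NZero) (PExN (PEq (NVar 1) (NSuc (NVar 0)))))" for e
    by (rule sat_induct) simp_all
  then show ?thesis by simp
qed

lemma num_cases: obtains "x = Z" | y where "x = S y"
  using Z_or_S by blast

lemma sub_add [simp]: "sub y (add y x) = x"
proof -
  have "sat M (case_nat y e) u0 (PAllN (PEq (Papp p_sub [NVar 1, Papp p_add [NVar 1, NVar 0]]) (NVar 0)))" for e
    by (rule sat_induct) (simp_all add: ind_simps flip: add_S_right)
  then show ?thesis by (simp add: ind_simps)
qed

lemma sub_S_S: "sub (S n) (S x) = sub n x"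
proof -
  have "sat M (case_nat n (\<lambda>_. x)) u0
      (PEq (Papp p_sub [NSuc (NVar 0), NSuc (NVar 1)]) (Papp p_sub [NVar 0, NVar 1]))"
    by (rule sat_induct) (simp_all add: ind_simps)
  then show ?thesis by (simp add: ind_simps)
qed

lemma sub_Z [simp]: "sub x Z = Z"
proof -
  have "sat M (case_nat x e) u0 (PEq (Papp p_sub [NVar 0, NZero]) NZero)" for e
    by (rule sat_induct) (simp_all add: ind_simps)
  then show ?thesis by (simp add: ind_simps)
qed

lemma sub_add_self: "sub (add x k) x = Z"
proof -
  have "sat M (case_nat x (\<lambda>_. k)) u0 (PEq (Papp p_sub [Papp p_add [NVar 0, NVar 1], NVar 0]) NZero)"
    by (rule sat_induct) (simp_all add: ind_simps sub_S_S del: sub_simps(2))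
  then show ?thesis by (simp add: ind_simps)
qed

definition le :: "'a \<Rightarrow> 'a \<Rightarrow> bool" where
  "le x y \<longleftrightarrow> (\<exists>k. y = add x k)"

lemma le_refl [simp]: "le x x"
  unfolding le_def by (metis add_Z_right)

lemma le_Z [simp]: "le Z y"
  unfolding le_def by simp

lemma le_S_S [simp]: "le (S x) (S y) \<longleftrightarrow> le x y"
  by (simp add: le_def)

lemma not_S_le_Z [simp]: "\<not> le (S x) Z"
  by (auto simp: le_def)

lemma le_S: "le x y \<Longrightarrow> le x (S y)"
  unfolding le_def by (metis add_S_right)

lemma le_trans: "le x y \<Longrightarrow> le y z \<Longrightarrow> le x z"
  unfolding le_def by (metis add_assoc)

lemma S_Z_le: "le (S Z) a \<longleftrightarrow> a \<noteq> Z"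
  by (cases a rule: num_cases) simp_all

lemma add_eq_Z: "add x y = Z \<Longrightarrow> x = Z \<and> y = Z"
  by (cases x rule: num_cases; cases y rule: num_cases) auto

lemma le_antisym: "le x y \<Longrightarrow> le y x \<Longrightarrow> x = y"
proof -
  assume "le x y" "le y x"
  then obtain j k where "y = add x j" "x = add y k" by (auto simp: le_def)
  then have "add x (add j k) = add x Z" by (metis add_assoc add_Z_right)
  then have "add j k = Z" by (simp only: add_cancel_left)
  then show ?thesis using \<open>y = add x j\<close> add_eq_Z[of j k] by simp
qed

lemma not_S_le [simp]: "\<not> le (S x) x"
proof
  assume "le (S x) x"
  then obtain k where "x = add x (S k)" by (auto simp: le_def)
  then show False by (metis add_Z_right add_cancel_left S_not_Z(1))
qed

lemma le_or_lt: "le x y \<or> le (S y) x"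
proof -
  have "sat M (case_nat x (\<lambda>_. y)) u0 (POr (PExN (PEq (NVar 2) (Papp p_add [NVar 1, NVar 0])))
      (PExN (PEq (NVar 1) (Papp p_add [NSuc (NVar 2), NVar 0]))))"
  proof (rule sat_induct)
    fix x assume "sat M (case_nat x (\<lambda>_. y)) u0 (POr (PExN (PEq (NVar 2) (Papp p_add [NVar 1, NVar 0])))
      (PExN (PEq (NVar 1) (Papp p_add [NSuc (NVar 2), NVar 0]))))"
    then have "le x y \<or> le (S y) x" by (simp add: ind_simps le_def)
    then have "le (S x) y \<or> le (S y) (S x)"
    proof
      assume "le x y"
      then obtain k where k: "y = add x k" by (auto simp: le_def)
      show ?thesis
        by (cases k rule: num_cases) (auto simp: k le_def)
    next
      assume "le (S y) x"
      then have "le (S y) (S x)" by (rule le_S)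
      then show ?thesis ..
    qed
    then show "sat M (case_nat (S x) (\<lambda>_. y)) u0 (POr (PExN (PEq (NVar 2) (Papp p_add [NVar 1, NVar 0])))
      (PExN (PEq (NVar 1) (Papp p_add [NSuc (NVar 2), NVar 0]))))"
      by (simp add: ind_simps le_def)
  qed (simp_all add: ind_simps)
  then show ?thesis by (simp add: ind_simps le_def)
qed

text \<open>The value of \<open>sub x y\<close> is the truncated difference \<open>y - x\<close>.
  Through this equivalence formulas express the order by an equation.\<close>

lemma sub_eq_Z: "sub x y = Z \<longleftrightarrow> le y x"
proof
  show "le y x \<Longrightarrow> sub x y = Z" by (auto simp: le_def sub_add_self)
  show "le y x" if "sub x y = Z"
  proof (rule ccontr)
    assume "\<not> le y x"
    then obtain k where "y = add x (S k)" using le_or_lt[of y x] by (auto simp: le_def)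
    then show False using that by (simp del: add_S_right)
  qed
qed

lemma le_add: "le x (add x y)" "le y (add x y)"
  unfolding le_def using add_commute[of x y] by metis+

section \<open>Triangular numbers and pairing\<close>

lemma tri_mono: "le x y \<Longrightarrow> le (tri x) (tri y)"
proof -
  assume "le x y"
  then obtain k where k: "y = add x k" by (auto simp: le_def)
  let ?\<phi> = "PEq (Papp p_sub [Papp p_tri [Papp p_add [NVar 1, NVar 0]], Papp p_tri [NVar 1]]) NZero"
  have sat: "sat M (case_nat k (\<lambda>_. x)) u0 ?\<phi> \<longleftrightarrow> le (tri x) (tri (add x k))" for k
    by (simp add: ind_simps sub_eq_Z)
  have "sat M (case_nat k (\<lambda>_. x)) u0 ?\<phi>"
  proof (rule sat_induct)
    fix k assume "sat M (case_nat k (\<lambda>_. x)) u0 ?\<phi>"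
    then show "sat M (case_nat (S k) (\<lambda>_. x)) u0 ?\<phi>"
      unfolding sat by (simp only: add_S_right tri_simps) (rule le_S, erule le_trans, rule le_add)
  qed (simp_all add: ind_simps sub_eq_Z)
  then show ?thesis unfolding sat k .
qed

text \<open>From \<open>n\<close> to \<open>n + 1\<close> the value of \<open>diag\<close> grows by
  one if the next triangular number is reached and stays the same otherwise; the two cases preserve
  both bounds.\<close>

lemma diag_bounds: "le (tri (diag n)) n \<and> le (S n) (tri (S (diag n)))"
proof -
  let ?\<phi> = "PAnd (PEq (Papp p_sub [NVar 0, Papp p_tri [Papp p_diag [NVar 0]]]) NZero)
     (PEq (Papp p_sub [Papp p_tri [NSuc (Papp p_diag [NVar 0])], NSuc (NVar 0)]) NZero)"
  have sat: "sat M (case_nat n e) u0 ?\<phi> \<longleftrightarrow> le (tri (diag n)) n \<and> le (S n) (tri (S (diag n)))" for n e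
    by (simp only: sat.simps neval_Papp neval_NSuc list.map neval.simps neval_NZero nat.case
        fold_ops sub_eq_Z)
  have "sat M (case_nat n e) u0 ?\<phi>" for e
  proof (rule sat_induct; (simp add: ind_simps sub_eq_Z; fail)?)
    fix n assume "sat M (case_nat n e) u0 ?\<phi>"
    then have IH: "le (tri (diag n)) n" "le (S n) (tri (S (diag n)))" unfolding sat by auto
    have "le (tri (diag (S n))) (S n) \<and> le (S (S n)) (tri (S (diag (S n))))"
    proof (cases "le (tri (S (diag n))) (S n)")
      case True
      then have "sub (S n) (tri (S (diag n))) = Z" by (simp only: sub_eq_Z)
      then have d: "diag (S n) = S (diag n)" by (simp only: diag_simps sub_simps(1) add_S_right add_Z_right)
      have "le (S n) (add (tri (S (diag n))) (S (diag n)))"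
        by (rule le_trans[OF IH(2) le_add(1)])
      then have "le (S (S n)) (tri (S (S (diag n))))"
        by (simp only: tri_simps(2)[of "S (diag n)"] add_S_right[of _ "S (diag n)"] le_S_S)
      then show ?thesis using True unfolding d by (rule conjI[rotated])
    next
      case False
      then obtain k where k: "sub (S n) (tri (S (diag n))) = S k"
        using sub_eq_Z[of "S n" "tri (S (diag n))"] by (metis num_cases)
      then have d: "diag (S n) = diag n"
        by (simp only: diag_simps k sub_S_S sub_Z add_Z_right)
      show ?thesis
        unfolding d using IH(1) False le_or_lt[of "tri (S (diag n))" "S n"] by (auto intro: le_S)
    qed
    then show "sat M (case_nat (S n) e) u0 ?\<phi>" unfolding sat .
  qed
  then show ?thesis unfolding sat .
qed

text \<open>\<open>pair m k\<close> lies at or above the triangular number of \<open>m + k\<close>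
  and below the next one. By monotonicity of \<open>tri\<close>, such bounds determine the value of
  \<open>diag\<close>.\<close>

lemma diag_pair: "diag (pair m k) = add m k"
proof -
  let ?s = "add m k" and ?z = "pair m k"
  have z: "le (tri ?s) ?z" "le (S ?z) (tri (S ?s))"
    by (simp_all add: pair_eq le_add add_assoc[symmetric])
  have "le ?s (diag ?z)"
  proof (rule ccontr)
    assume "\<not> le ?s (diag ?z)"
    then have "le (tri (S (diag ?z))) (tri ?s)" using le_or_lt[of ?s "diag ?z"] tri_mono by blast
    then have "le (S ?z) ?z" using diag_bounds[of ?z] z(1) le_trans by blast
    then show False by simp
  qed
  moreover have "le (diag ?z) ?s"
  proof (rule ccontr)
    assume "\<not> le (diag ?z) ?s"
    then have "le (tri (S ?s)) (tri (diag ?z))" using le_or_lt[of "diag ?z" ?s] tri_mono by blast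
    then have "le (S ?z) ?z" using diag_bounds[of ?z] z(2) le_trans by blast
    then show False by simp
  qed
  ultimately show ?thesis by (rule le_antisym[symmetric])
qed

lemma pfst_pair [simp]: "pfst (pair m k) = m"
  unfolding pfst_eq diag_pair by (simp add: pair_eq)

lemma psnd_pair [simp]: "psnd (pair m k) = k"
  unfolding psnd_eq pfst_pair diag_pair by simp

text \<open>The distance \<open>r\<close> of \<open>z\<close> from the triangular number below it is
  at most \<open>diag z\<close>, for otherwise the next triangular number would not exceed
  \<open>z\<close>. So \<open>diag z\<close> splits into the two components.\<close>

lemma pair_pfst_psnd [simp]: "pair (pfst z) (psnd z) = z"
proof -
  obtain r where r: "z = add (tri (diag z)) r" using diag_bounds[of z] by (auto simp: le_def)
  have f: "pfst z = r" unfolding pfst_eq by (subst (2) r) simp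
  have "le (S r) (S (diag z))"
  proof (rule ccontr)
    assume "\<not> le (S r) (S (diag z))"
    then have "le (S (diag z)) r" using le_or_lt[of r "diag z"] by simp
    then obtain k where "r = add (S (diag z)) k" by (auto simp: le_def)
    with r have "z = add (tri (S (diag z))) k" by (simp add: add_assoc)
    then have "le (tri (S (diag z))) z" by (auto simp: le_def)
    then have "le (S z) z" using diag_bounds[of z] le_trans by blast
    then show False by simp
  qed
  then obtain q where q: "diag z = add r q" by (auto simp: le_def)
  have "psnd z = q" unfolding psnd_eq f by (simp add: q)
  then show ?thesis using f r q by (simp add: pair_eq)
qed

lemma pair_Z: "pair Z Z = Z"
  by (simp add: pair_eq)

lemma le_pair: "le k (pair m k)"
proof -
  have "le n (tri n)" for n
    by (cases n rule: num_cases) (simp_all add: le_add)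
  then have "le k (tri (add m k))" using le_trans le_add(2) by blast
  then show ?thesis unfolding pair_eq using le_trans le_add(1) by blast
qed

section \<open>Codes of lists\<close>

lemma cons_not_Z [simp]: "cons i b \<noteq> Z" "Z \<noteq> cons i b"
  by (simp_all add: cons_eq)

lemma hd_cons [simp]: "hd\<^sub>M (cons i b) = i" and tl_cons [simp]: "tl\<^sub>M (cons i b) = b"
  by (simp_all add: hd_eq tl_eq cons_eq)

lemma cons_inject [simp]: "cons i b = cons j c \<longleftrightarrow> i = j \<and> b = c"
  by (metis hd_cons tl_cons)

lemma tl_Z [simp]: "tl\<^sub>M Z = Z"
  using psnd_pair[of Z Z] by (simp add: tl_eq pair_Z)

lemma list_cases: obtains "a = Z" | i b where "a = cons i b"
proof (cases a rule: num_cases)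
  case (2 y)
  have "a = cons (pfst y) (psnd y)" by (simp add: 2 cons_eq)
  then show thesis by (rule that(2))
qed (rule that(1))

lemma le_cons: "le (S b) (cons i b)"
  by (simp add: cons_eq le_pair)

text \<open>The recursion of \<open>drop\<^sub>M\<close> takes the tail last; inductions that follow
  an address from the root need it taken first.\<close>

lemma drop_S: "drop\<^sub>M (S n) a = drop\<^sub>M n (tl\<^sub>M a)"
proof -
  have "sat M (case_nat n (\<lambda>_. a)) u0
     (PEq (Papp p_drop [NSuc (NVar 0), NVar 1]) (Papp p_drop [NVar 0, Papp p_tl [NVar 1]]))"
    by (rule sat_induct) (simp_all add: ind_simps)
  then show ?thesis by (simp add: ind_simps)
qed

lemma drop_Z [simp]: "drop\<^sub>M n Z = Z"
proof -
  have "sat M (case_nat n e) u0 (PEq (Papp p_drop [NVar 0, NZero]) NZero)" for e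
    by (rule sat_induct) (simp_all add: ind_simps)
  then show ?thesis by (simp add: ind_simps)
qed

text \<open>Each entry raises the code by at least one, so a list is no longer than its code. This
  removes the bound on the quantifier of \<open>Adr\<close>.\<close>

lemma drop_bound: "drop\<^sub>M n a \<noteq> Z \<Longrightarrow> le (S n) a"
proof -
  let ?\<phi> = "PAllN (PImp (PNot (PEq (Papp p_drop [NVar 1, NVar 0]) NZero))
     (PEq (Papp p_sub [NVar 0, NSuc (NVar 1)]) NZero))"
  have sat: "sat M (case_nat n e) u0 ?\<phi> \<longleftrightarrow> (\<forall>a. drop\<^sub>M n a \<noteq> Z \<longrightarrow> le (S n) a)" for n e
    by (simp add: fold_ops del: sub_simps) (simp only: sub_simps(2)[symmetric] sub_eq_Z)
  have "sat M (case_nat n e) u0 ?\<phi>" for e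
  proof (rule sat_induct)
    show "sat M (case_nat Z e) u0 ?\<phi>"
      unfolding sat by (simp add: S_Z_le)
    fix n assume IH: "sat M (case_nat n e) u0 ?\<phi>"
    show "sat M (case_nat (S n) e) u0 ?\<phi>"
      unfolding sat
    proof (intro allI impI)
      fix a assume d: "drop\<^sub>M (S n) a \<noteq> Z"
      show "le (S (S n)) a"
      proof (cases a rule: list_cases)
        case (2 i b)
        then have "le (S n) b" using d IH unfolding sat drop_S by simp
        then have "le (S (S n)) (S b)" by simp
        then show ?thesis unfolding 2 using le_cons le_trans by blast
      qed (use d in simp)
    qed
  qed (simp_all add: ind_simps)
  then show "drop\<^sub>M n a \<noteq> Z \<Longrightarrow> le (S n) a" unfolding sat by blast
qed

lemma nth_S: "nth\<^sub>M (S n) a = nth\<^sub>M n (tl\<^sub>M a)"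
  by (simp only: nth_eq drop_S)

lemma sub_S_pred: "le (S m) n \<Longrightarrow> sub m n = S (sub (S m) n)"
  by (cases "sub m n" rule: num_cases) (auto simp: sub_eq_Z dest: le_trans[of "S m" n m])

text \<open>The last \<open>m\<close> of the first \<open>n + 1\<close> entries do not include the
  first entry if \<open>m \<le> n\<close>, so that entry may be removed. Thus
  \<open>take\<^sub>M\<close>, which is computed from the back, can be unfolded from the
  front.\<close>

lemma seg_shift: "le m n \<Longrightarrow> seg m (S n) a = seg m n (tl\<^sub>M a)"
proof -
  let ?\<phi> = "PImp (PEq (Papp p_sub [NVar 1, NVar 0]) NZero)
     (PEq (Papp p_segment [NVar 0, NSuc (NVar 1), NVar 2]) (Papp p_segment [NVar 0, NVar 1, Papp p_tl [NVar 2]]))"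
  have sat: "sat M (case_nat m (case_nat n (\<lambda>_. a))) u0 ?\<phi> \<longleftrightarrow>
      (le m n \<longrightarrow> seg m (S n) a = seg m n (tl\<^sub>M a))" for m
    by (simp add: ind_simps sub_eq_Z)
  have "sat M (case_nat m (case_nat n (\<lambda>_. a))) u0 ?\<phi>"
  proof (rule sat_induct)
    fix m assume IH: "sat M (case_nat m (case_nat n (\<lambda>_. a))) u0 ?\<phi>"
    show "sat M (case_nat (S m) (case_nat n (\<lambda>_. a))) u0 ?\<phi>"
      unfolding sat
    proof
      assume m: "le (S m) n"
      then have "le m n" using le_trans[OF le_S[OF le_refl]] by blast
      with IH show "seg (S m) (S n) a = seg (S m) n (tl\<^sub>M a)"
        unfolding sat by (simp only: seg_simps sub_S_S sub_S_pred[OF m] nth_S)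
    qed
  qed (simp_all add: ind_simps)
  then show "le m n \<Longrightarrow> seg m (S n) a = seg m n (tl\<^sub>M a)" unfolding sat by blast
qed

lemma glue_shift: "le m n \<Longrightarrow> glue m (S n) a b = glue m n (tl\<^sub>M a) b"
proof -
  let ?\<phi> = "PImp (PEq (Papp p_sub [NVar 1, NVar 0]) NZero)
     (PEq (Papp p_glue [NVar 0, NSuc (NVar 1), NVar 2, NVar 3])
       (Papp p_glue [NVar 0, NVar 1, Papp p_tl [NVar 2], NVar 3]))"
  have sat: "sat M (case_nat m (case_nat n (case_nat a (\<lambda>_. b)))) u0 ?\<phi> \<longleftrightarrow>
      (le m n \<longrightarrow> glue m (S n) a b = glue m n (tl\<^sub>M a) b)" for m
    by (simp add: ind_simps sub_eq_Z)
  have "sat M (case_nat m (case_nat n (case_nat a (\<lambda>_. b)))) u0 ?\<phi>"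
  proof (rule sat_induct)
    fix m assume IH: "sat M (case_nat m (case_nat n (case_nat a (\<lambda>_. b)))) u0 ?\<phi>"
    show "sat M (case_nat (S m) (case_nat n (case_nat a (\<lambda>_. b)))) u0 ?\<phi>"
      unfolding sat
    proof
      assume m: "le (S m) n"
      then have "le m n" using le_trans[OF le_S[OF le_refl]] by blast
      with IH show "glue (S m) (S n) a b = glue (S m) n (tl\<^sub>M a) b"
        unfolding sat by (simp only: glue_simps sub_S_S sub_S_pred[OF m] nth_S)
    qed
  qed (simp_all add: ind_simps)
  then show "le m n \<Longrightarrow> glue m (S n) a b = glue m n (tl\<^sub>M a) b" unfolding sat by blast
qed

lemma take_Z [simp]: "take\<^sub>M Z a = Z"
  by (simp add: take_eq)

lemma sub_self [simp]: "sub x x = Z"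
  by (simp add: sub_eq_Z)

lemma take_S: "take\<^sub>M (S n) a = cons (hd\<^sub>M a) (take\<^sub>M n (tl\<^sub>M a))"
  by (simp only: take_eq seg_simps sub_self seg_shift[OF le_refl] nth_eq drop_simps)

lemma app_Z [simp]: "app Z b a = a"
  by (simp add: app_eq)

lemma app_S: "app (S m) b a = cons (hd\<^sub>M b) (app m (tl\<^sub>M b) a)"
  by (simp only: app_eq glue_simps sub_self glue_shift[OF le_refl] nth_eq drop_simps)

text \<open>Tails have smaller codes, so the claim for all codes up to \<open>n\<close> follows by
  induction on \<open>n\<close>.\<close>

lemma sat_list_induct:
  assumes ok: "pfm_ok \<phi>" "fenv M u" and Z: "sat M (case_nat Z e) u \<phi>"
    and cons: "\<And>i b. sat M (case_nat b e) u \<phi> \<Longrightarrow> sat M (case_nat (cons i b) e) u \<phi>"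
  shows "sat M (case_nat a e) u \<phi>"
proof -
  \<comment> \<open>The list keeps index 0 and the bound takes index 1, so the parameters of \<phi>
    move up by one.\<close>
  let ?\<sigma> = "\<lambda>n. case n of 0 \<Rightarrow> NVar 0 | Suc m \<Rightarrow> NVar (Suc (Suc m))"
  let ?\<phi> = "PAllN (PImp (PEq (Papp p_sub [NVar 1, NVar 0]) NZero) (pfm_subst ?\<sigma> FVar \<phi>))"
  have "(\<lambda>n. neval M (case_nat b (case_nat n' e)) u (?\<sigma> n)) = case_nat b e" for b n'
    by (rule ext) (simp split: nat.split)
  then have sat: "sat M (case_nat n e) u ?\<phi> \<longleftrightarrow> (\<forall>b. le b n \<longrightarrow> sat M (case_nat b e) u \<phi>)" for n
    by (simp add: ind_simps sub_eq_Z sat_subst)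
  have "sat M (case_nat a e) u ?\<phi>"
  proof (rule sat_induct[OF _ ok(2)])
    have "subst_ok ?\<sigma> FVar" by (auto simp: subst_ok_def split: nat.split)
    then show "pfm_ok ?\<phi>" using ok by (simp add: pfm_ok_subst ind_simps)
    show "sat M (case_nat Z e) u ?\<phi>"
      unfolding sat using Z le_antisym le_Z by blast
    fix n assume IH: "sat M (case_nat n e) u ?\<phi>"
    show "sat M (case_nat (S n) e) u ?\<phi>"
      unfolding sat
    proof (intro allI impI)
      fix b assume b: "le b (S n)"
      show "sat M (case_nat b e) u \<phi>"
      proof (cases b rule: list_cases)
        case (2 i c)
        then have "le (S c) (S n)" using b le_cons le_trans by blast
        then show ?thesis using IH cons unfolding sat 2 by simp
      qed (use Z in simp)
    qed
  qed
  then show ?thesis unfolding sat by simp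
qed

end

section \<open>Hyper-terms in a model\<close>

text \<open>Maps \<open>t, x, y\<close> to \<open>y\<close> if \<open>t\<close> is 0 and to
  \<open>x\<close> otherwise: as with truncated differences, 0 means that a test succeeds.\<close>

definition p_if :: prfl where "p_if = PRec (PProj 1) (PProj 2)"

text \<open>The sum of both truncated differences is 0 exactly for equal arguments.\<close>

definition p_neq :: prfl where "p_neq = PComp p_add [p_sub, PComp p_sub [PProj 1, PProj 0]]"

primrec p_num :: "nat \<Rightarrow> prfl" where
  "p_num 0 = PZero"
| "p_num (Suc n) = PComp PSucc [p_num n]"

primrec p_branch :: "nat list \<Rightarrow> prfl" where
  "p_branch [] = PZero"
| "p_branch (i # is) =
     PComp p_if [PComp p_neq [p_hd, p_num i], p_branch is, PComp (PArg i) [p_tl]]"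

text \<open>The tree with root label \<open>v\<close> and immediate subtrees given by the \<open>r\<close> arguments.\<close>

definition p_node :: "nat \<Rightarrow> nat \<Rightarrow> prfl" where
  "p_node v r = PComp p_if [PProj 0, p_branch [0..<r], p_num v]"

text \<open>The normal form of \<open>g\<close> replaces the invalid labels of \<open>g\<close> by the code of a fixed constructor, and
  then replaces the values outside the addresses by 0.\<close>

primrec p_relabel :: "nat \<Rightarrow> nat list \<Rightarrow> prfl" where
  "p_relabel d [] = p_num d"
| "p_relabel d (v # vs) = PComp p_if [PComp p_neq [PArg 0, p_num v], p_relabel d vs, p_num v]"

text \<open>The arguments are \<open>n, a\<close>, and a pair holds the code and the arity of a
  constructor. The value is 0 iff some pair permits the step of \<open>a\<close> at position
  \<open>n\<close>: its code is the label reached there, and its arity exceeds the entry at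
  \<open>n\<close>.\<close>

primrec p_badstep :: "prfl \<Rightarrow> (nat \<times> nat) list \<Rightarrow> prfl" where
  "p_badstep g [] = p_one"
| "p_badstep g (x # xs) =
     PComp p_if [PComp p_add [PComp p_neq [PComp g [p_take], p_num (fst x)],
                              PComp p_sub [p_num (snd x), PComp PSucc [p_nth]]],
       p_badstep g xs, PZero]"

text \<open>On \<open>k, a\<close> the positions below \<open>k\<close> are searched for a forbidden
  step. With \<open>k = a\<close> this covers the whole address, because a list is no longer than
  its code.\<close>

definition p_bad :: "prfl \<Rightarrow> (nat \<times> nat) list \<Rightarrow> prfl" where
  "p_bad g xs = PRec PZero
     (PComp p_if [PComp (PComp p_if [p_drop, p_badstep g xs, PZero]) [PProj 0, PProj 2], p_one, PProj 1])"

definition p_norm :: "nat \<Rightarrow> (nat \<times> nat) list \<Rightarrow> prfl" where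
  "p_norm d xs =
     PComp p_if [PComp (p_bad (p_relabel d (map fst xs)) xs) [PProj 0, PProj 0], PZero,
       p_relabel d (map fst xs)]"

lemma prfl_ok_num [simp]: "prfl_ok ks m (p_num n)" and arg_free_num [simp]: "arg_free (p_num n)"
  by (induction n arbitrary: m) auto

lemma prfl_ok_if [simp]: "prfl_ok ks (Suc (Suc (Suc 0))) p_if" "prfl_ok ks (Suc (Suc 0)) p_neq"
  and arg_free_if [simp]: "arg_free p_if" "arg_free p_neq"
  by (simp_all add: p_if_def p_neq_def prfl_ok_arith arg_free_arith eval_nat_numeral)

lemma prfl_ok_branch:
  "\<forall>i \<in> set is. i < length ks \<and> ks ! i = Suc 0 \<Longrightarrow> prfl_ok ks (Suc 0) (p_branch is)"
  by (induction "is") (auto simp: prfl_ok_arith)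

lemma prfl_ok_node: "prfl_ok (replicate r (Suc 0)) (Suc 0) (p_node v r)"
  by (auto simp: p_node_def intro!: prfl_ok_branch)

lemma prfl_ok_relabel: "prfl_ok [Suc 0] (Suc 0) (p_relabel d vs)"
  by (induction vs) auto

lemma prfl_ok_badstep:
  "prfl_ok [Suc 0] (Suc 0) g \<Longrightarrow> prfl_ok [Suc 0] (Suc (Suc 0)) (p_badstep g xs)"
  by (induction xs) (auto simp: prfl_ok_arith)

lemma prfl_ok_bad: "prfl_ok [Suc 0] (Suc 0) g \<Longrightarrow> prfl_ok [Suc 0] (Suc (Suc 0)) (p_bad g xs)"
  by (simp add: p_bad_def prfl_ok_arith prfl_ok_badstep eval_nat_numeral)

lemma prfl_ok_norm: "prfl_ok [Suc 0] (Suc 0) (p_norm d xs)"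
  by (simp add: p_norm_def prfl_ok_bad prfl_ok_relabel)

context pra_model
begin

abbreviation F1 :: "('a list \<Rightarrow> 'a) set" where "F1 \<equiv> funs M (Suc 0)"

lemma F1_ext: "f \<in> F1 \<Longrightarrow> g \<in> F1 \<Longrightarrow> (\<And>b. f [b] = g [b]) \<Longrightarrow> f = g"
  by (rule fun_ext[of _ "Suc 0"]) (auto simp: length_Suc_conv)

section \<open>Standard numerals, nodes and subtrees\<close>

primrec num :: "nat \<Rightarrow> 'a" where
  "num 0 = Z"
| "num (Suc n) = S (num n)"

lemma neval_numeral [simp]: "neval M e u (numeral_tm n) = num n"
  by (induction n) simp_all

lemma num_inject [simp]: "num m = num n \<longleftrightarrow> m = n"
proof (induction m arbitrary: n)
  case 0
  then show ?case by (cases n) auto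
next
  case (Suc m)
  then show ?case by (cases n) auto
qed

text \<open>Nonstandard elements lie above all numerals. Hence the entries permitted by the arity of
  a constructor are genuine numbers, even on addresses of nonstandard length.\<close>

lemma le_num: "le (S x) (num r) \<longleftrightarrow> (\<exists>i < r. x = num i)"
proof (induction r arbitrary: x)
  case (Suc r)
  show ?case
  proof (cases x rule: num_cases)
    case 1
    then show ?thesis by (auto intro: exI[of _ 0])
  next
    case (2 y)
    have "(\<exists>i < Suc r. S y = num i) \<longleftrightarrow> (\<exists>i < r. y = num i)"
    proof
      assume "\<exists>i < Suc r. S y = num i"
      then obtain i where "i < Suc r" "S y = num i" by blast
      then show "\<exists>i < r. y = num i" by (cases i) auto
    qed (metis Suc_mono num.simps(2))
    then show ?thesis by (simp add: 2 Suc)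
  qed
qed simp

lemma pr_if: "pr p_if [t, x, y] = (if t = Z then y else x)"
  by (cases t rule: num_cases) (simp_all add: p_if_def pr_eqs eval_nat_numeral)

lemma pr_neq: "pr p_neq [x, y] = Z \<longleftrightarrow> x = y"
proof -
  have "pr p_neq [x, y] = add (sub x y) (sub y x)"
    by (simp add: p_neq_def pr_eqs add_def sub_def)
  then show ?thesis
    using add_eq_Z[of "sub x y" "sub y x"] le_antisym[of x y] by (auto simp: sub_eq_Z)
qed

lemma pr_num: "pr (p_num n) xs = num n"
  by (induction n) (simp_all add: pr_eqs)

lemmas prim_arith = prim_PZero prim_PSucc prim_PProj prim_PArg prim_PComp prim_PRec_Z prim_PRec_S
  prim_arg_free pr_eqs pr_if pr_neq pr_num arg_free_arith fold_ops

lemma prim_branch: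
  assumes gs: "typed gs (replicate r (Suc 0))"
  shows "set is \<subseteq> {..<r} \<Longrightarrow> prim M (p_branch is) (replicate r (Suc 0)) (Suc 0) gs [a] =
    (if \<exists>i \<in> set is. hd\<^sub>M a = num i then (gs ! (THE i. hd\<^sub>M a = num i)) [tl\<^sub>M a] else Z)"
proof (induction "is")
  case (Cons i "is")
  have ok: "prfl_ok (replicate r (Suc 0)) (Suc 0) (p_branch (i # is))"
    using Cons.prems by (intro prfl_ok_branch) auto
  have "prim M (p_branch (i # is)) (replicate r (Suc 0)) (Suc 0) gs [a] =
    (if hd\<^sub>M a = num i then (gs ! i) [tl\<^sub>M a] else
     prim M (p_branch is) (replicate r (Suc 0)) (Suc 0) gs [a])"
    using ok gs Cons.prems by (simp add: prim_arith)
  then show ?case using Cons by (auto cong: conj_cong)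
qed (use gs in \<open>simp add: prim_PZero\<close>)

definition node :: "nat \<Rightarrow> ('a list \<Rightarrow> 'a) list \<Rightarrow> 'a list \<Rightarrow> 'a" where
  "node v gs = prim M (p_node v (length gs)) (replicate (length gs) (Suc 0)) (Suc 0) gs"

lemma typed_F1: "set gs \<subseteq> F1 \<Longrightarrow> r = length gs \<Longrightarrow> typed gs (replicate r (Suc 0))"
  by (auto simp: typed_def list_all2_conv_all_nth)

lemma node_in_F1 [simp]: "set gs \<subseteq> F1 \<Longrightarrow> node v gs \<in> F1"
  unfolding node_def using typed_F1[of gs] prfl_ok_node
  by (auto intro!: prim_closed simp: typed_def)

lemma node_eq:
  assumes "set gs \<subseteq> F1"
  shows "node v gs [a] = (if a = Z then num v else
    if \<exists>i < length gs. hd\<^sub>M a = num i then (gs ! (THE i. hd\<^sub>M a = num i)) [tl\<^sub>M a] else Z)"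
proof -
  note t = typed_F1[OF assms refl]
  have "node v gs [a] = (if a = Z then num v else
      prim M (p_branch [0..<length gs]) (replicate (length gs) (Suc 0)) (Suc 0) gs [a])"
    using t prfl_ok_node[of "length gs" v, unfolded p_node_def]
    by (simp add: node_def p_node_def prim_arith)
  also have "\<dots> = (if a = Z then num v else
    if \<exists>i \<in> set [0..<length gs]. hd\<^sub>M a = num i then (gs ! (THE i. hd\<^sub>M a = num i)) [tl\<^sub>M a] else Z)"
    using t by (subst prim_branch) auto
  finally show ?thesis by auto
qed

lemma node_root [simp]: "set gs \<subseteq> F1 \<Longrightarrow> node v gs [Z] = num v"
  by (simp add: node_eq)

lemma node_cons_num [simp]:
  "set gs \<subseteq> F1 \<Longrightarrow> i < length gs \<Longrightarrow> node v gs [cons (num i) b] = (gs ! i) [b]"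
  by (auto simp: node_eq)

lemma node_cons_other:
  "set gs \<subseteq> F1 \<Longrightarrow> (\<And>i. i < length gs \<Longrightarrow> j \<noteq> num i) \<Longrightarrow> node v gs [cons j b] = Z"
  by (auto simp: node_eq)

text \<open>Explicit Definition admits no free numeric parameters, so it does not directly provide
  the function with a given nonstandard value. Its existence follows by induction on the value,
  applying the successor to the previous function.\<close>

lemma const_in_F1: "\<exists>g \<in> F1. \<forall>b. g [b] = x"
proof -
  let ?\<phi> = "PExF 1 (PAllN (PEq (NApp (FVar 1 0) [NVar 0]) (NVar 1)))"
  have sat: "sat M (case_nat x e) u0 ?\<phi> \<longleftrightarrow> (\<exists>g \<in> F1. \<forall>b. g [b] = x)" for x e
    by (simp add: pushf_def)
  have "sat M (case_nat x e) u0 ?\<phi>" for e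
  proof (rule sat_induct)
    have "dflt (Suc 0) [b] = Z" for b
      unfolding dflt_def by (rule prim_PZero) simp_all
    then show "sat M (case_nat Z e) u0 ?\<phi>" unfolding sat using dflt_in_funs by blast
    fix x assume "sat M (case_nat x e) u0 ?\<phi>"
    then obtain g where g: "g \<in> F1" "\<forall>b. g [b] = x" unfolding sat by blast
    have "prim M (PComp PSucc [PArg 0]) [Suc 0] (Suc 0) [g] \<in> F1"
      by (rule prim_closed) (simp_all add: g)
    moreover have "prim M (PComp PSucc [PArg 0]) [Suc 0] (Suc 0) [g] [b] = S x" for b
      using g by (simp add: prim_arith)
    ultimately show "sat M (case_nat (S x) e) u0 ?\<phi>" unfolding sat by blast
  qed simp_all
  then show ?thesis unfolding sat .
qed

text \<open>The choice is unique by \<open>F1_ext\<close>. All indices are allowed, including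
  nonstandard ones, because the conditions on decorations quantify over all lists.\<close>

definition child :: "('a list \<Rightarrow> 'a) \<Rightarrow> 'a \<Rightarrow> 'a list \<Rightarrow> 'a" where
  "child x i = (SOME g. g \<in> F1 \<and> (\<forall>b. g [b] = x [cons i b]))"

lemma child:
  assumes x: "x \<in> F1"
  shows child_in_F1 [simp]: "child x i \<in> F1" and child_app [simp]: "child x i [b] = x [cons i b]"
proof -
  \<comment> \<open>A nonstandard index can be passed to a functional only in the guise of a
    function constantly equal to it.\<close>
  obtain k where k: "k \<in> F1" "\<forall>b. k [b] = i" using const_in_F1 by blast
  let ?p = "PComp (PArg 0) [PComp p_cons [PArg 1, PProj 0]]"
  have "prim M ?p [Suc 0, Suc 0] (Suc 0) [x, k] \<in> F1"
    by (rule prim_closed) (simp_all add: x k prfl_ok_arith)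
  moreover have "prim M ?p [Suc 0, Suc 0] (Suc 0) [x, k] [b] = x [cons i b]" for b
    using x k by (simp add: prim_arith)
  ultimately have "\<exists>g. g \<in> F1 \<and> (\<forall>b. g [b] = x [cons i b])" by blast
  from someI_ex[OF this] show "child x i \<in> F1" "child x i [b] = x [cons i b]"
    by (simp_all add: child_def)
qed

lemma child_node:
  assumes gs: "set gs \<subseteq> F1" and i: "i < length gs"
  shows "child (node v gs) (num i) = gs ! i"
proof (rule F1_ext)
  show "gs ! i \<in> F1" using gs i nth_mem by blast
qed (use gs i in simp_all)

end

locale hyper = pra_model M for M :: "'a pra_struct" +
  fixes V :: "'c vocabulary" and sharp :: "'c \<Rightarrow> nat"
  assumes sharp_inj: "inj_on sharp (set (ctors V))"
begin

definition adr :: "('a list \<Rightarrow> 'a) \<Rightarrow> 'a \<Rightarrow> bool" where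
  "adr g a \<longleftrightarrow> (\<forall>n. drop\<^sub>M n a \<noteq> Z \<longrightarrow>
     (\<exists>c \<in> set (ctors V). g [take\<^sub>M n a] = num (sharp c) \<and> (\<exists>i < arity V c. nth\<^sub>M n a = num i)))"

definition htm :: "('a list \<Rightarrow> 'a) \<Rightarrow> bool" where
  "htm g \<longleftrightarrow> (\<forall>a. adr g a \<longrightarrow> (\<exists>c \<in> set (ctors V). g [a] = num (sharp c)))"

definition same :: "('a list \<Rightarrow> 'a) \<Rightarrow> ('a list \<Rightarrow> 'a) \<Rightarrow> bool" where
  "same g h \<longleftrightarrow> (\<forall>a. adr g a \<longrightarrow> g [a] = h [a])"

lemma sat_PDisj [simp]: "sat M e u (PDisj \<phi>s) \<longleftrightarrow> (\<exists>\<phi> \<in> set \<phi>s. sat M e u \<phi>)"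
  by (induction \<phi>s) (auto simp: PDisj_def)

lemma neval_nlift_tm [simp]: "neval M (case_nat x e) u (nlift_tm t) = neval M e u t"
  by (simp add: nlift_tm_def neval_subst)

lemma sat_Adr [simp]: "sat M e u (Adr V sharp g a) \<longleftrightarrow> adr (feval M u g) (neval M e u a)"
proof -
  have "(\<forall>n. le (S n) x \<longrightarrow> drop\<^sub>M n x \<noteq> Z \<longrightarrow> Q n) \<longleftrightarrow> (\<forall>n. drop\<^sub>M n x \<noteq> Z \<longrightarrow> Q n)" for x Q
    using drop_bound by blast
  then show ?thesis
    by (simp add: Adr_def Let_def fold_ops sub_eq_Z le_num adr_def)
qed

lemma sat_Htm [simp]: "sat M e u (Htm V sharp g) \<longleftrightarrow> htm (feval M u g)"
  by (simp add: Htm_def htm_def)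

lemma sat_SameHtm [simp]: "sat M e u (SameHtm V sharp g h) \<longleftrightarrow> same (feval M u g) (feval M u h)"
  by (simp add: SameHtm_def same_def)

end

lemma pfm_ok_PDisj [simp]: "pfm_ok (PDisj \<phi>s) \<longleftrightarrow> (\<forall>\<phi> \<in> set \<phi>s. pfm_ok \<phi>)"
  by (induction \<phi>s) (auto simp: PDisj_def)

lemma ntm_ok_nlift_tm [simp]: "ntm_ok t \<Longrightarrow> ntm_ok (nlift_tm t)"
  unfolding nlift_tm_def by (rule ntm_ok_subst) simp_all

lemma pfm_ok_Adr [simp]:
  "ftm_ok g \<Longrightarrow> farity g = Suc 0 \<Longrightarrow> ntm_ok a \<Longrightarrow> pfm_ok (Adr V sharp g a)"
  by (auto simp: Adr_def Let_def prfl_ok_arith)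

lemma pfm_ok_Htm [simp]: "ftm_ok g \<Longrightarrow> farity g = Suc 0 \<Longrightarrow> pfm_ok (Htm V sharp g)"
  by (auto simp: Htm_def)

lemma pfm_ok_SameHtm [simp]:
  "ftm_ok g \<Longrightarrow> farity g = Suc 0 \<Longrightarrow> ftm_ok h \<Longrightarrow> farity h = Suc 0 \<Longrightarrow>
   pfm_ok (SameHtm V sharp g h)"
  by (auto simp: SameHtm_def)

definition norm_prfl :: "'c vocabulary \<Rightarrow> ('c \<Rightarrow> nat) \<Rightarrow> 'c \<Rightarrow> prfl" where
  "norm_prfl V sharp c = p_norm (sharp c) (map (\<lambda>c. (sharp c, arity V c)) (ctors V))"

context hyper
begin

lemma adr_Z [simp]: "adr g Z"
  by (simp add: adr_def)

text \<open>Position 0 of the address concerns the label of the root, and position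
  \<open>n + 1\<close> is position \<open>n\<close> of the remaining address in the subtree.\<close>

lemma adr_cons:
  assumes g: "g \<in> F1"
  shows "adr g (cons j b) \<longleftrightarrow>
    (\<exists>c \<in> set (ctors V). g [Z] = num (sharp c) \<and> (\<exists>i < arity V c. j = num i)) \<and> adr (child g j) b"
    (is "_ \<longleftrightarrow> ?R \<and> _")
proof
  assume L: "adr g (cons j b)"
  then have "?R" unfolding adr_def by (elim allE[of _ Z]) (simp add: nth_eq)
  moreover have "adr (child g j) b"
    unfolding adr_def
  proof (intro allI impI)
    fix n assume "drop\<^sub>M n b \<noteq> Z"
    then have "drop\<^sub>M (S n) (cons j b) \<noteq> Z" by (simp add: drop_S del: drop_simps)
    then show "\<exists>c \<in> set (ctors V). child g j [take\<^sub>M n b] = num (sharp c) \<and>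
        (\<exists>i < arity V c. nth\<^sub>M n b = num i)"
      using L[unfolded adr_def, rule_format, of "S n"] by (simp add: take_S nth_S g del: drop_simps)
  qed
  ultimately show "?R \<and> adr (child g j) b" ..
next
  assume R: "?R \<and> adr (child g j) b"
  show "adr g (cons j b)"
    unfolding adr_def
  proof (intro allI impI)
    fix n assume n: "drop\<^sub>M n (cons j b) \<noteq> Z"
    show "\<exists>c \<in> set (ctors V). g [take\<^sub>M n (cons j b)] = num (sharp c) \<and>
        (\<exists>i < arity V c. nth\<^sub>M n (cons j b) = num i)"
    proof (cases n rule: num_cases)
      case 1
      then show ?thesis using R by (simp add: nth_eq)
    next
      case (2 m)
      then have "drop\<^sub>M m b \<noteq> Z" using n by (simp add: drop_S del: drop_simps)
      then show ?thesis using R unfolding adr_def 2 by (auto simp: take_S nth_S g)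
    qed
  qed
qed

text \<open>By \<open>sharp_inj\<close> the label of the root determines the constructor, so a
  single arity decides which first entries are allowed.\<close>

lemma adr_cons_num:
  assumes "g \<in> F1" "c \<in> set (ctors V)" "g [Z] = num (sharp c)"
  shows "adr g (cons j b) \<longleftrightarrow> (\<exists>i < arity V c. j = num i \<and> adr (child g (num i)) b)"
proof -
  have "c' = c" if "c' \<in> set (ctors V)" "num (sharp c) = num (sharp c')" for c'
    using that assms(2) sharp_inj by (auto dest: inj_onD)
  with assms show ?thesis by (auto simp: adr_cons)
qed

lemma adr_root: "g \<in> F1 \<Longrightarrow> adr g (cons j b) \<Longrightarrow> \<exists>c \<in> set (ctors V). g [Z] = num (sharp c)"
  by (auto simp: adr_cons)

lemma same_child:
  assumes "g \<in> F1" "h \<in> F1" "same g h" "c \<in> set (ctors V)" "g [Z] = num (sharp c)" "i < arity V c"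
  shows "same (child g (num i)) (child h (num i))"
  using assms by (auto simp: same_def adr_cons_num)

lemma htm_child:
  assumes "g \<in> F1" "htm g" "c \<in> set (ctors V)" "g [Z] = num (sharp c)" "i < arity V c"
  shows "htm (child g (num i))"
  using assms by (auto simp: htm_def adr_cons_num)

lemma same_root: "same g h \<Longrightarrow> g [Z] = h [Z]"
  by (simp add: same_def)

text \<open>The functions are quantified inside the formula because the induction passes to their
  children. As \<open>same\<close> refers to the addresses of its first argument only, this is what
  makes it symmetric.\<close>

lemma adr_cong_all:
  "\<forall>g \<in> F1. \<forall>h \<in> F1. same g h \<longrightarrow> (adr g a \<longleftrightarrow> adr h a)"
proof -
  let ?g = "FVar 1 1" and ?h = "FVar 1 0"
  let ?A = "\<lambda>g. Adr V sharp g (NVar 0)"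
  let ?\<phi> = "PAllF 1 (PAllF 1 (PImp (SameHtm V sharp ?g ?h)
     (PAnd (PImp (?A ?g) (?A ?h)) (PImp (?A ?h) (?A ?g)))))"
  have sat: "sat M (case_nat a e) u0 ?\<phi> \<longleftrightarrow>
      (\<forall>g \<in> F1. \<forall>h \<in> F1. same g h \<longrightarrow> (adr g a \<longleftrightarrow> adr h a))" for a e
    by (auto simp: pushf_def)
  have "sat M (case_nat a e) u0 ?\<phi>" for e
  proof (rule sat_list_induct)
    show "sat M (case_nat Z e) u0 ?\<phi>" unfolding sat by simp
    fix i b assume IH: "sat M (case_nat b e) u0 ?\<phi>"
    show "sat M (case_nat (cons i b) e) u0 ?\<phi>"
      unfolding sat
    proof (intro ballI impI)
      fix g h assume gh: "g \<in> F1" "h \<in> F1" "same g h"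
      show "adr g (cons i b) \<longleftrightarrow> adr h (cons i b)"
      proof (cases "\<exists>c \<in> set (ctors V). g [Z] = num (sharp c)")
        case True
        then obtain c where c: "c \<in> set (ctors V)" "g [Z] = num (sharp c)" by blast
        have "adr (child g (num j)) b \<longleftrightarrow> adr (child h (num j)) b" if "j < arity V c" for j
          using IH same_child[OF gh c that] gh unfolding sat by simp
        moreover have "h [Z] = num (sharp c)" using same_root[OF gh(3)] c by simp
        ultimately show ?thesis using c gh by (auto simp: adr_cons_num)
      next
        case False
        then show ?thesis
          using adr_root[OF gh(1), of i b] adr_root[OF gh(2), of i b] same_root[OF gh(3)] by auto
      qed
    qed
  qed simp_all
  then show ?thesis unfolding sat .
qed

lemma adr_cong: "g \<in> F1 \<Longrightarrow> h \<in> F1 \<Longrightarrow> same g h \<Longrightarrow> adr g a \<longleftrightarrow> adr h a"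
  using adr_cong_all by blast

lemma same_refl [simp]: "same g g"
  by (simp add: same_def)

lemma same_sym: assumes "g \<in> F1" "h \<in> F1" "same g h" shows "same h g"
  unfolding same_def
proof (intro allI impI)
  fix a assume "adr h a"
  then have "adr g a" using adr_cong[OF assms] by blast
  then show "h [a] = g [a]" using assms(3) by (simp add: same_def)
qed

lemma same_trans: assumes "g \<in> F1" "h \<in> F1" "same g h" "same h k" shows "same g k"
  unfolding same_def
proof (intro allI impI)
  fix a assume a: "adr g a"
  then have "adr h a" using adr_cong[OF assms(1-3)] by blast
  then show "g [a] = k [a]" using a assms(3,4) by (simp add: same_def)
qed

lemma htm_cong: assumes "g \<in> F1" "h \<in> F1" "same g h" "htm g" shows "htm h"
  unfolding htm_def
proof (intro allI impI)
  fix a assume "adr h a"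
  then have a: "adr g a" using adr_cong[OF assms(1-3)] by blast
  then have "\<exists>c \<in> set (ctors V). g [a] = num (sharp c)" using assms(4) by (simp add: htm_def)
  then show "\<exists>c \<in> set (ctors V). h [a] = num (sharp c)" using a assms(3) by (simp add: same_def)
qed

lemma htm_node:
  assumes "c \<in> set (ctors V)" "set gs \<subseteq> F1" "length gs = arity V c" "\<forall>g \<in> set gs. htm g"
  shows "htm (node (sharp c) gs)"
  unfolding htm_def
proof (intro allI impI)
  fix a assume a: "adr (node (sharp c) gs) a"
  show "\<exists>c' \<in> set (ctors V). node (sharp c) gs [a] = num (sharp c')"
  proof (cases a rule: list_cases)
    case 1
    then show ?thesis using assms by auto
  next
    case (2 j b)
    then obtain i where "i < arity V c" "j = num i" "adr (gs ! i) b"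
      using a assms by (auto simp: adr_cons_num[of _ c] child_node)
    then show ?thesis using assms unfolding 2 htm_def by auto
  qed
qed

lemma same_node:
  assumes c: "c \<in> set (ctors V)" and x: "x \<in> F1" "x [Z] = num (sharp c)"
    and gs: "set gs \<subseteq> F1" "length gs = arity V c"
    and eq: "\<And>i. i < arity V c \<Longrightarrow> same (child x (num i)) (gs ! i)"
  shows "same x (node (sharp c) gs)"
  unfolding same_def
proof (intro allI impI)
  fix a assume a: "adr x a"
  show "x [a] = node (sharp c) gs [a]"
  proof (cases a rule: list_cases)
    case 1
    then show ?thesis using x gs by simp
  next
    case (2 j b)
    then obtain i where i: "i < arity V c" "j = num i" "adr (child x (num i)) b"
      using a c x by (auto simp: adr_cons_num[of _ c])
    then have "child x (num i) [b] = (gs ! i) [b]" using eq unfolding same_def by blast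
    then show ?thesis using i x gs by (simp add: 2)
  qed
qed

section \<open>Normal forms of hyper-terms\<close>

lemma add_eq_Z_iff: "add x y = Z \<longleftrightarrow> x = Z \<and> y = Z"
  by (auto dest: add_eq_Z)

definition nrm :: "'c \<Rightarrow> ('a list \<Rightarrow> 'a) \<Rightarrow> 'a list \<Rightarrow> 'a" where
  "nrm c g = prim M (norm_prfl V sharp c) [Suc 0] (Suc 0) [g]"

definition relabel :: "'c \<Rightarrow> ('a list \<Rightarrow> 'a) \<Rightarrow> 'a list \<Rightarrow> 'a" where
  "relabel c g = prim M (p_relabel (sharp c) (map sharp (ctors V))) [Suc 0] (Suc 0) [g]"

lemma nrm_in_F1 [simp]: "g \<in> F1 \<Longrightarrow> nrm c g \<in> F1"
  unfolding nrm_def norm_prfl_def by (rule prim_closed) (simp_all add: prfl_ok_norm)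

lemma relabel_in_F1 [simp]: "g \<in> F1 \<Longrightarrow> relabel c g \<in> F1"
  unfolding relabel_def by (rule prim_closed) (simp_all add: prfl_ok_relabel)

lemma prim_relabel:
  "g \<in> F1 \<Longrightarrow> prim M (p_relabel d vs) [Suc 0] (Suc 0) [g] [a] =
    (if \<exists>v \<in> set vs. g [a] = num v then g [a] else num d)"
proof (induction vs)
  case (Cons v vs)
  have ok: "prfl_ok [Suc 0] (Suc 0) (p_relabel d (v # vs))" by (rule prfl_ok_relabel)
  have "prim M (p_relabel d (v # vs)) [Suc 0] (Suc 0) [g] [a] =
      (if g [a] = num v then num v else prim M (p_relabel d vs) [Suc 0] (Suc 0) [g] [a])"
    using ok Cons.prems by (simp add: prim_arith)
  then show ?case using Cons by auto
qed (simp add: prim_arith)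

lemma relabel_eq:
  "g \<in> F1 \<Longrightarrow> relabel c g [a] =
    (if \<exists>c \<in> set (ctors V). g [a] = num (sharp c) then g [a] else num (sharp c))"
  unfolding relabel_def by (subst prim_relabel) auto

lemma prim_badstep:
  assumes g: "g \<in> F1" and p: "prfl_ok [Suc 0] (Suc 0) p"
  shows "prim M (p_badstep p xs) [Suc 0] (Suc (Suc 0)) [g] [n, a] = Z \<longleftrightarrow>
    (\<exists>x \<in> set xs. prim M p [Suc 0] (Suc 0) [g] [take\<^sub>M n a] = num (fst x) \<and>
       (\<exists>i < snd x. nth\<^sub>M n a = num i))"
proof (induction xs)
  case (Cons x xs)
  have ok: "prfl_ok [Suc 0] (Suc (Suc 0)) (p_badstep p (x # xs))" by (rule prfl_ok_badstep[OF p])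
  let ?t = "add (pr p_neq [prim M p [Suc 0] (Suc 0) [g] [take\<^sub>M n a], num (fst x)])
    (sub (num (snd x)) (S (nth\<^sub>M n a)))"
  have "prim M (p_badstep p (x # xs)) [Suc 0] (Suc (Suc 0)) [g] [n, a] =
      (if ?t = Z then Z else prim M (p_badstep p xs) [Suc 0] (Suc (Suc 0)) [g] [n, a])"
    using ok g p by (simp add: prim_arith del: sub_simps)
  moreover have "?t = Z \<longleftrightarrow> prim M p [Suc 0] (Suc 0) [g] [take\<^sub>M n a] = num (fst x) \<and>
       (\<exists>i < snd x. nth\<^sub>M n a = num i)"
    by (simp only: add_eq_Z_iff pr_neq sub_eq_Z le_num)
  ultimately show ?case using Cons.IH by auto
qed (use g in \<open>simp add: prim_arith p_one_def\<close>)

text \<open>The range \<open>k\<close> of the search may be nonstandard, so its outcome is compared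
  with the quantifier by induction inside the model.\<close>

lemma prim_bad:
  assumes g: "g \<in> F1" and p: "prfl_ok [Suc 0] (Suc 0) p"
  shows "prim M (p_bad p xs) [Suc 0] (Suc (Suc 0)) [g] [k, a] = Z \<longleftrightarrow>
    (\<forall>n. le (S n) k \<longrightarrow> drop\<^sub>M n a \<noteq> Z \<longrightarrow>
      prim M (p_badstep p xs) [Suc 0] (Suc (Suc 0)) [g] [n, a] = Z)"
proof -
  let ?bad = "\<lambda>k. prim M (p_bad p xs) [Suc 0] (Suc (Suc 0)) [g] [k, a]"
  let ?step = "\<lambda>n. prim M (p_badstep p xs) [Suc 0] (Suc (Suc 0)) [g] [n, a]"
  note ok = prfl_ok_bad[OF p, of xs] prfl_ok_badstep[OF p, of xs]
  have Z: "?bad Z = Z"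
    using g ok unfolding p_bad_def by (simp add: prim_arith)
  have S: "?bad (S k) = Z \<longleftrightarrow> (drop\<^sub>M k a \<noteq> Z \<longrightarrow> ?step k = Z) \<and> ?bad k = Z" for k
  proof -
    have "?bad (S k) = (if (if drop\<^sub>M k a = Z then Z else ?step k) = Z then ?bad k else S Z)"
      using g ok by (simp add: p_bad_def prim_arith eval_nat_numeral p_one_def)
    then show ?thesis by auto
  qed
  let ?T = "\<lambda>p ts. NApp (Prim p [1] 2 [FVar 1 0]) ts"
  \<comment> \<open>The language has no biconditional; the two implications are joined by a
    conjunction.\<close>
  let ?\<phi> = "PAnd (PImp (PEq (?T (p_bad p xs) [NVar 0, NVar 1]) NZero)
       (PAllN (PImp (PEq (Papp p_sub [NVar 1, NSuc (NVar 0)]) NZero)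
         (PImp (PNot (PEq (Papp p_drop [NVar 0, NVar 2]) NZero))
           (PEq (?T (p_badstep p xs) [NVar 0, NVar 2]) NZero)))))
     (PImp (PAllN (PImp (PEq (Papp p_sub [NVar 1, NSuc (NVar 0)]) NZero)
         (PImp (PNot (PEq (Papp p_drop [NVar 0, NVar 2]) NZero))
           (PEq (?T (p_badstep p xs) [NVar 0, NVar 2]) NZero))))
       (PEq (?T (p_bad p xs) [NVar 0, NVar 1]) NZero))"
  let ?u = "pushf 1 g u0"
  have u: "fenv M ?u"
    using fenv_u0 g unfolding fenv_def by (auto simp: pushf_def split: nat.split)
  have sat: "sat M (case_nat k (\<lambda>_. a)) ?u ?\<phi> \<longleftrightarrow>
      (?bad k = Z \<longleftrightarrow> (\<forall>n. le (S n) k \<longrightarrow> drop\<^sub>M n a \<noteq> Z \<longrightarrow> ?step n = Z))" for k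
    by (simp add: fold_ops sub_eq_Z pushf_def eval_nat_numeral del: sub_simps) blast
  have "sat M (case_nat k (\<lambda>_. a)) ?u ?\<phi>"
  proof (rule sat_induct[OF _ u])
    show "pfm_ok ?\<phi>" using ok by (simp add: prfl_ok_arith numeral_2_eq_2)
    show "sat M (case_nat Z (\<lambda>_. a)) ?u ?\<phi>" unfolding sat using Z by simp
    fix k assume IH: "sat M (case_nat k (\<lambda>_. a)) ?u ?\<phi>"
    have eq: "le (S n) (S k) \<longleftrightarrow> n = k \<or> le (S n) k" for n
      using le_or_lt[of k n] le_antisym[of n k] le_S[of "S n" k] by auto
    show "sat M (case_nat (S k) (\<lambda>_. a)) ?u ?\<phi>"
      using IH unfolding sat S eq by simp blast
  qed
  then show ?thesis unfolding sat .
qed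

lemma nrm_eq:
  assumes g: "g \<in> F1"
  shows "nrm c g [a] = (if adr (relabel c g) a then relabel c g [a] else Z)"
proof -
  let ?xs = "map (\<lambda>c. (sharp c, arity V c)) (ctors V)"
  let ?p = "p_relabel (sharp c) (map sharp (ctors V))"
  have p: "prfl_ok [Suc 0] (Suc 0) ?p" by (rule prfl_ok_relabel)
  have fst: "map fst ?xs = map sharp (ctors V)" by simp
  have "nrm c g [a] = (if prim M (p_bad ?p ?xs) [Suc 0] (Suc (Suc 0)) [g] [a, a] = Z
      then relabel c g [a] else Z)"
    using g p prfl_ok_bad[OF p, of ?xs]
    by (simp add: nrm_def norm_prfl_def p_norm_def relabel_def fst prim_arith comp_def del: map_map)
  also have "prim M (p_bad ?p ?xs) [Suc 0] (Suc (Suc 0)) [g] [a, a] = Z \<longleftrightarrow> adr (relabel c g) a"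
    unfolding prim_bad[OF g p] prim_badstep[OF g p] adr_def
    using drop_bound by (auto simp: relabel_def)
  finally show ?thesis .
qed

lemma same_relabel_nrm: "g \<in> F1 \<Longrightarrow> same (relabel c g) (nrm c g)"
  by (simp add: same_def nrm_eq)

text \<open>After relabelling every label is the code of a constructor, and clearing the values
  outside the addresses keeps the hyper-term.\<close>

lemma htm_nrm:
  assumes g: "g \<in> F1" and c: "c \<in> set (ctors V)"
  shows "htm (nrm c g)"
proof -
  have "htm (relabel c g)"
    using c unfolding htm_def by (auto simp: relabel_eq[OF g])
  then show ?thesis by (rule htm_cong[rotated 3]) (simp_all add: g same_relabel_nrm)
qed

lemma same_relabel: "g \<in> F1 \<Longrightarrow> htm g \<Longrightarrow> same g (relabel c g)"
  by (simp add: same_def htm_def relabel_eq)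

lemma same_nrm:
  assumes g: "g \<in> F1" "htm g"
  shows "same (nrm c g) g"
proof (rule same_sym)
  show "same g (nrm c g)"
    by (rule same_trans[of _ "relabel c g"]) (use g in \<open>simp_all add: same_relabel same_relabel_nrm\<close>)
qed (use g in simp_all)

text \<open>Representations of a hyper-term differ only outside its addresses, where the normal form
  is 0. Equality of functions, not just \<open>same\<close>, is required for the arguments of a free
  functional.\<close>

lemma nrm_cong:
  assumes g: "g \<in> F1" "htm g" and h: "h \<in> F1" "htm h" and "same g h"
  shows "nrm c g = nrm c h"
proof (rule F1_ext)
  fix a
  have adr: "adr (relabel c g) a \<longleftrightarrow> adr g a" "adr (relabel c h) a \<longleftrightarrow> adr h a" "adr g a \<longleftrightarrow> adr h a"
    using adr_cong[OF _ _ same_relabel[OF g, of c], of a] adr_cong[OF _ _ same_relabel[OF h, of c], of a]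
      adr_cong[of g h a] assms by simp_all
  moreover have "g [a] = h [a]" if "adr g a" using assms that by (simp add: same_def)
  ultimately show "nrm c g [a] = nrm c h [a]"
    using g h by (simp add: nrm_eq relabel_eq)
qed (use g h in simp_all)

end

section \<open>The interpretation of the type-identifiers\<close>

definition PConj :: "pfm list \<Rightarrow> pfm" where
  "PConj \<phi>s = foldr PAnd \<phi>s (PNot PFalse)"

lemma pfm_ok_PConj [simp]: "pfm_ok (PConj \<phi>s) \<longleftrightarrow> (\<forall>\<phi> \<in> set \<phi>s. pfm_ok \<phi>)"
  by (induction \<phi>s) (auto simp: PConj_def)

lemma sat_PConj [simp]: "sat M e u (PConj \<phi>s) \<longleftrightarrow> (\<forall>\<phi> \<in> set \<phi>s. sat M e u \<phi>)"
  by (induction \<phi>s) (auto simp: PConj_def)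

lemma fv_PConj [simp]: "pfm_fv (PConj \<phi>s) = (\<Union>\<phi> \<in> set \<phi>s. pfm_fv \<phi>)"
  by (induction \<phi>s) (auto simp: PConj_def)

lemma fv_PDisj [simp]: "pfm_fv (PDisj \<phi>s) = (\<Union>\<phi> \<in> set \<phi>s. pfm_fv \<phi>)"
  by (induction \<phi>s) (auto simp: PDisj_def)

lemma fv_Papp [simp]: "ntm_fv (Papp p ts) = (\<Union>t \<in> set ts. ntm_fv t)"
  by (simp add: Papp_def)

lemma fv_numeral [simp]: "ntm_fv NZero = {}" "ntm_fv (NSuc t) = ntm_fv t" "ntm_fv (numeral_tm n) = {}"
proof -
  show 1: "ntm_fv NZero = {}" "ntm_fv (NSuc t) = ntm_fv t" for t
    by (simp_all add: NZero_def NSuc_def)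
  show "ntm_fv (numeral_tm n) = {}" by (induction n) (simp_all add: 1)
qed

type_synonym ('c, 'd) rule = "'c \<times> 'd list \<times> 'd"

text \<open>
  A type \<open>D\<close> of a bundle holds of \<open>x\<close> up to depth \<open>n\<close> if there is a decoration \<open>h\<close> of the addresses by
  codes of types, with \<open>D\<close> at the root, that up to depth \<open>n\<close> follows the rules of the bundle.  At depth
  \<open>n\<close> types of the bundle are admitted in a coinductive bundle only, and types of earlier bundles
  must hold of the subtrees at which they occur.  Undecorated addresses have the label 0.

  In \<open>local_fm\<close> the function variables 0 and 1 are the subtrees \<open>g\<close> of \<open>x\<close> and \<open>k\<close> of \<open>h\<close> at an address, and the
  numeric variable 1 is the remaining depth.  In \<open>deco_fm\<close> the function variables 0 and 1 are \<open>h\<close> and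
  \<open>x\<close>, and the numeric variable 0 is \<open>n\<close>; an address is given by its length and any
  list of which it is an initial segment.
\<close>

definition rule_fm :: "('c \<Rightarrow> nat) \<Rightarrow> ('d \<Rightarrow> nat) \<Rightarrow> ('c, 'd) rule \<Rightarrow> pfm" where
  "rule_fm sharp code = (\<lambda>(c, Qs, D).
     PAnd (PEq (NApp (FVar 1 0) [NZero]) (numeral_tm (sharp c)))
       (PConj (map (\<lambda>i. PEq (NApp (FVar 1 1) [Papp p_cons [numeral_tm i, NZero]])
          (numeral_tm (code (Qs ! i)))) [0..<length Qs])))"

definition local_fm :: "('c \<Rightarrow> nat) \<Rightarrow> ('d \<Rightarrow> nat) \<Rightarrow> bool \<Rightarrow> 'd list \<Rightarrow> ('c, 'd) rule list \<Rightarrow>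
    'd list \<Rightarrow> ('d \<Rightarrow> pfm) \<Rightarrow> pfm" where
  "local_fm sharp code coind Ds R lower T =
     PAnd
       (PConj (map (\<lambda>D. PImp (PEq (NApp (FVar 1 1) [NZero]) (numeral_tm (code D)))
          (PAnd (if coind then PNot PFalse else PNot (PEq (NVar 1) NZero))
            (PImp (PNot (PEq (NVar 1) NZero))
              (PDisj (map (rule_fm sharp code) (filter (\<lambda>\<rho>. snd (snd \<rho>) = D) R)))))) Ds))
       (PConj (map (\<lambda>Q. PImp (PEq (NApp (FVar 1 1) [NZero]) (numeral_tm (code Q))) (T Q)) lower))"

definition deco_fm :: "pfm \<Rightarrow> pfm" where
  "deco_fm loc =
     PAllN (PAllN (PAllN (PAllF 1 (PAllF 1
       (PImp (PEq (Papp p_add [NVar 2, NVar 1]) (NVar 3))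
       (PImp (PAllN (PEq (NApp (FVar 1 3) [Papp p_app [NVar 3, NVar 1, NVar 0]])
                         (NApp (FVar 1 0) [NVar 0])))
       (PImp (PAllN (PEq (NApp (FVar 1 2) [Papp p_app [NVar 3, NVar 1, NVar 0]])
                         (NApp (FVar 1 1) [NVar 0])))
         loc)))))))"

definition approx_fm :: "('d \<Rightarrow> nat) \<Rightarrow> pfm \<Rightarrow> 'd \<Rightarrow> pfm" where
  "approx_fm code loc D =
     PExF 1 (PAnd (PEq (NApp (FVar 1 0) [NZero]) (numeral_tm (code D))) (deco_fm loc))"

definition type_fm :: "('d \<Rightarrow> nat) \<Rightarrow> bool \<Rightarrow> pfm \<Rightarrow> 'd \<Rightarrow> pfm" where
  "type_fm code coind loc D =
     (if coind then PAllN (approx_fm code loc D) else PExN (approx_fm code loc D))"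

definition type_ok :: "pfm \<Rightarrow> bool" where
  "type_ok \<phi> \<longleftrightarrow> pfm_ok \<phi> \<and> pfm_fv \<phi> \<subseteq> {FunV 1 0}"

lemma local_fm_ok:
  assumes "\<And>Q. Q \<in> set lower \<Longrightarrow> type_ok (T Q)"
  shows "pfm_ok (local_fm sharp code coind Ds R lower T)"
    "pfm_fv (local_fm sharp code coind Ds R lower T) \<subseteq> {NumV 1, FunV 1 0, FunV 1 1}"
  using assms unfolding local_fm_def rule_fm_def type_ok_def
  by (auto simp: prfl_ok_arith split: prod.splits if_splits)

lemma approx_fm_ok:
  assumes "pfm_ok loc" "pfm_fv loc \<subseteq> {NumV 1, FunV 1 0, FunV 1 1}"
  shows "pfm_ok (approx_fm code loc D)" "pfm_fv (approx_fm code loc D) \<subseteq> {NumV 0, FunV 1 0}"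
proof -
  show "pfm_ok (approx_fm code loc D)"
    using assms by (simp add: approx_fm_def deco_fm_def prfl_ok_arith prfl_ok_glue)
  show "pfm_fv (approx_fm code loc D) \<subseteq> {NumV 0, FunV 1 0}"
  proof
    fix v assume "v \<in> pfm_fv (approx_fm code loc D)"
    then show "v \<in> {NumV 0, FunV 1 0}"
      using assms(2) by (cases v) (auto simp: approx_fm_def deco_fm_def split: if_splits)
  qed
qed

lemma type_fm_ok:
  assumes "pfm_ok loc" "pfm_fv loc \<subseteq> {NumV 1, FunV 1 0, FunV 1 1}"
  shows "type_ok (type_fm code coind loc D)"
proof -
  have "v \<in> {FunV 1 0}" if "v \<in> pfm_fv (type_fm code coind loc D)" for v
    using that approx_fm_ok(2)[OF assms, of code D]
    by (cases v) (auto simp: type_fm_def split: if_splits)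
  then show ?thesis
    using approx_fm_ok(1)[OF assms, of code D] unfolding type_ok_def type_fm_def by auto
qed

context pra_model
begin

lemma fenv_pushf [simp]: "fenv M u \<Longrightarrow> f \<in> F1 \<Longrightarrow> fenv M (pushf (Suc 0) f u)"
  by (auto simp: fenv_def pushf_def split: nat.split)

text \<open>Finitely many depths, in the sense of the ambient logic, have a common bound; this is
  how depths found separately are merged.\<close>

lemma le_bound: "\<exists>N. \<forall>x \<in> set xs. le (f x) N"
proof (induction xs)
  case (Cons x xs)
  then obtain N where N: "\<forall>x \<in> set xs. le (f x) N" by blast
  show ?case
    by (rule exI[of _ "add (f x) N"]) (use N le_add le_trans in auto)
qed simp

text \<open>Intended for formulas whose only free variable is \<open>FVar 1 0\<close>, as ensured by
  \<open>type_ok\<close>; the rest of the assignment is an arbitrary filling.\<close>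

definition holds :: "pfm \<Rightarrow> ('a list \<Rightarrow> 'a) \<Rightarrow> bool" where
  "holds \<phi> g \<longleftrightarrow> sat M (\<lambda>_. Z) (pushf 1 g u0) \<phi>"

lemma sat_type: "type_ok \<phi> \<Longrightarrow> sat M e u \<phi> \<longleftrightarrow> holds \<phi> (u 1 0)"
  unfolding holds_def type_ok_def by (intro sat_cong) (auto simp: pushf_def)

end

text \<open>One bundle above types that are already interpreted by \<open>T\<close>. Codes are
  positive because 0 marks undecorated addresses, and \<open>lower_cong\<close> is the part of
  invariance under \<open>same\<close> that the bundle inherits.\<close>

locale type_bundle = hyper M V sharp for M :: "'a pra_struct" and V :: "'c vocabulary" and sharp +
  fixes code :: "'d \<Rightarrow> nat" and coind :: bool and Ds :: "'d list" and R :: "('c, 'd) rule list"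
    and lower :: "'d list" and T :: "'d \<Rightarrow> pfm"
  assumes code_inj: "inj_on code (set Ds \<union> set lower)"
    and code_pos: "D \<in> set Ds \<union> set lower \<Longrightarrow> code D \<noteq> 0"
    and disjoint: "set Ds \<inter> set lower = {}"
    and rules_ok: "(c, Qs, D) \<in> set R \<Longrightarrow> D \<in> set Ds \<and> c \<in> set (ctors V) \<and>
      length Qs = arity V c \<and> set Qs \<subseteq> set Ds \<union> set lower"
    and lower_ok: "Q \<in> set lower \<Longrightarrow> type_ok (T Q)"
    and lower_cong: "Q \<in> set lower \<Longrightarrow> g \<in> F1 \<Longrightarrow> h \<in> F1 \<Longrightarrow> same g h \<Longrightarrow>
      holds (T Q) g \<Longrightarrow> holds (T Q) h"
begin

definition loc :: "'a \<Rightarrow> ('a list \<Rightarrow> 'a) \<Rightarrow> ('a list \<Rightarrow> 'a) \<Rightarrow> bool" where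
  "loc j g k \<longleftrightarrow>
     (\<forall>D \<in> set Ds. k [Z] = num (code D) \<longrightarrow> (coind \<or> j \<noteq> Z) \<and>
        (j \<noteq> Z \<longrightarrow> (\<exists>c Qs. (c, Qs, D) \<in> set R \<and> g [Z] = num (sharp c) \<and>
           (\<forall>i < length Qs. k [cons (num i) Z] = num (code (Qs ! i)))))) \<and>
     (\<forall>Q \<in> set lower. k [Z] = num (code Q) \<longrightarrow> holds (T Q) g)"

definition deco :: "'a \<Rightarrow> ('a list \<Rightarrow> 'a) \<Rightarrow> ('a list \<Rightarrow> 'a) \<Rightarrow> bool" where
  "deco n x h \<longleftrightarrow> (\<forall>m j b. \<forall>k \<in> F1. \<forall>g \<in> F1. add m j = n \<longrightarrow>
     (\<forall>a. x [app m b a] = g [a]) \<longrightarrow> (\<forall>a. h [app m b a] = k [a]) \<longrightarrow> loc j g k)"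

definition approx :: "'a \<Rightarrow> 'd \<Rightarrow> ('a list \<Rightarrow> 'a) \<Rightarrow> bool" where
  "approx n D x \<longleftrightarrow> (\<exists>h \<in> F1. h [Z] = num (code D) \<and> deco n x h)"

abbreviation lfm :: pfm where "lfm \<equiv> local_fm sharp code coind Ds R lower T"
abbreviation afm :: "'d \<Rightarrow> pfm" where "afm \<equiv> approx_fm code lfm"
abbreviation tfm :: "'d \<Rightarrow> pfm" where "tfm \<equiv> type_fm code coind lfm"

lemma lfm_ok: "pfm_ok lfm" "pfm_fv lfm \<subseteq> {NumV 1, FunV 1 0, FunV 1 1}"
  by (rule local_fm_ok, erule lower_ok)+

lemma afm_ok [simp]: "pfm_ok (afm D)"
  using approx_fm_ok[OF lfm_ok] by simp

lemma sat_lfm: "sat M e u lfm \<longleftrightarrow> loc (e 1) (u 1 0) (u 1 1)"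
proof -
  have 1: "sat M e u (rule_fm sharp code \<rho>) \<longleftrightarrow> (case \<rho> of (c, Qs, D) \<Rightarrow>
      u 1 0 [Z] = num (sharp c) \<and> (\<forall>i < length Qs. u 1 1 [cons (num i) Z] = num (code (Qs ! i))))" for \<rho>
    by (auto simp: rule_fm_def fold_ops split: prod.splits)
  have 3: "sat M e u (PDisj (map (rule_fm sharp code) (filter (\<lambda>\<rho>. snd (snd \<rho>) = D) R))) \<longleftrightarrow>
      (\<exists>c Qs. (c, Qs, D) \<in> set R \<and> u 1 0 [Z] = num (sharp c) \<and>
        (\<forall>i < length Qs. u 1 1 [cons (num i) Z] = num (code (Qs ! i))))" for D
    by (force simp: 1)
  have 2: "sat M e u (T Q) \<longleftrightarrow> holds (T Q) (u 1 0)" if "Q \<in> set lower" for Q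
    using sat_type[OF lower_ok[OF that]] .
  show ?thesis
    unfolding local_fm_def loc_def by (simp add: 2 3 del: sat_PDisj)
qed

lemma sat_afm: "sat M e u (afm D) \<longleftrightarrow> approx (e 0) D (u 1 0)"
  by (simp add: approx_fm_def approx_def deco_fm_def deco_def sat_lfm fold_ops pushf_def eval_nat_numeral)

lemma holds_tfm: "holds (tfm D) x \<longleftrightarrow> (if coind then \<forall>n. approx n D x else \<exists>n. approx n D x)"
proof (cases coind)
  case True
  then have "tfm D = PAllN (afm D)" by (simp only: type_fm_def if_True)
  moreover have "holds (PAllN (afm D)) x \<longleftrightarrow> (\<forall>n. approx n D x)"
    by (simp add: holds_def sat_afm pushf_def)
  ultimately show ?thesis using True by simp
next
  case False
  then have "tfm D = PExN (afm D)" by (simp only: type_fm_def if_False)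
  moreover have "holds (PExN (afm D)) x \<longleftrightarrow> (\<exists>n. approx n D x)"
    by (simp add: holds_def sat_afm pushf_def)
  ultimately show ?thesis using False by simp
qed

lemma code_eq: "D \<in> set Ds \<union> set lower \<Longrightarrow> D' \<in> set Ds \<union> set lower \<Longrightarrow> code D = code D' \<longleftrightarrow> D = D'"
  using code_inj by (auto dest: inj_onD)

lemma code_lower: "D \<in> set Ds \<Longrightarrow> Q \<in> set lower \<Longrightarrow> code D \<noteq> code Q"
  using code_eq[of D Q] disjoint by auto

lemma num_code: "D \<in> set Ds \<union> set lower \<Longrightarrow> num (code D) \<noteq> Z"
  using code_pos num_inject[of "code D" 0] by simp

section \<open>Unfolding decorations\<close>

lemma deco_Z:
  assumes "x \<in> F1" "h \<in> F1"
  shows "deco Z x h \<longleftrightarrow> loc Z x h"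
proof
  assume L: "deco Z x h"
  show "loc Z x h"
    using L[unfolded deco_def, rule_format, of h x Z Z] assms by simp
next
  assume L: "loc Z x h"
  show "deco Z x h"
    unfolding deco_def
  proof (intro allI ballI impI)
    fix m j b k g assume kg: "k \<in> F1" "g \<in> F1" and mj: "add m j = Z"
      and x: "\<forall>a. x [app m b a] = g [a]" and h: "\<forall>a. h [app m b a] = k [a]"
    have m: "m = Z" "j = Z" using add_eq_Z[OF mj] by auto
    have "g = x" by (rule F1_ext) (use kg assms x m in auto)
    moreover have "k = h" by (rule F1_ext) (use kg assms h m in auto)
    ultimately show "loc j g k" using L m by simp
  qed
qed

text \<open>A nonempty address consists of a first entry, which leads to a child, and an address of
  that child. Its length and the total depth drop by one together, so the remaining depth
  \<open>j\<close> is unchanged.\<close>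

lemma deco_S:
  assumes xh: "x \<in> F1" "h \<in> F1"
  shows "deco (S n) x h \<longleftrightarrow> loc (S n) x h \<and> (\<forall>i. deco n (child x i) (child h i))"
proof
  assume L: "deco (S n) x h"
  have "loc (S n) x h"
    using L[unfolded deco_def, rule_format, of h x Z "S n"] xh by simp
  moreover have "deco n (child x i) (child h i)" for i
    unfolding deco_def
  proof (intro allI ballI impI)
    fix m j b k g assume kg: "k \<in> F1" "g \<in> F1" and mj: "add m j = n"
      and x: "\<forall>a. child x i [app m b a] = g [a]" and h: "\<forall>a. child h i [app m b a] = k [a]"
    show "loc j g k"
      by (rule L[unfolded deco_def, rule_format, of k g "S m" j "cons i b"])
        (use kg mj x h xh in \<open>simp_all add: app_S\<close>)
  qed
  ultimately show "loc (S n) x h \<and> (\<forall>i. deco n (child x i) (child h i))" by blast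
next
  assume R: "loc (S n) x h \<and> (\<forall>i. deco n (child x i) (child h i))"
  show "deco (S n) x h"
    unfolding deco_def
  proof (intro allI ballI impI)
    fix m j b k g assume kg: "k \<in> F1" "g \<in> F1" and mj: "add m j = S n"
      and x: "\<forall>a. x [app m b a] = g [a]" and h: "\<forall>a. h [app m b a] = k [a]"
    show "loc j g k"
    proof (cases m rule: num_cases)
      case 1
      have "g = x" by (rule F1_ext) (use kg xh x 1 in auto)
      moreover have "k = h" by (rule F1_ext) (use kg xh h 1 in auto)
      ultimately show "loc j g k" using R 1 mj by simp
    next
      case (2 m')
      have d: "deco n (child x (hd\<^sub>M b)) (child h (hd\<^sub>M b))" using R by blast
      show ?thesis
        by (rule d[unfolded deco_def, rule_format, of k g m' j "tl\<^sub>M b"])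
          (use kg mj x h xh 2 in \<open>simp_all add: app_S\<close>)
    qed
  qed
qed

lemma deco_loc: "x \<in> F1 \<Longrightarrow> h \<in> F1 \<Longrightarrow> deco n x h \<Longrightarrow> loc n x h"
  by (cases n rule: num_cases) (simp_all add: deco_Z deco_S)

text \<open>Since 0 is no code of a type, a blank subtree imposes no condition.\<close>

lemma deco_blank: "(\<And>a. h [a] = Z) \<Longrightarrow> deco n x h"
  unfolding deco_def loc_def using num_code by (metis Un_iff)

lemma deco_leaf:
  assumes x: "x \<in> F1" and v: "loc n x (node v [])"
  shows "deco n x (node v [])"
proof (cases n rule: num_cases)
  case 1
  then show ?thesis using assms by (simp add: deco_Z)
next
  case (2 m)
  have "deco m (child x i) (child (node v []) i)" for i
    by (rule deco_blank) (simp add: node_eq)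
  then show ?thesis using assms by (simp add: 2 deco_S)
qed

lemma loc_lower: "Q \<in> set lower \<Longrightarrow> holds (T Q) x \<Longrightarrow> loc n x (node (code Q) [])"
  unfolding loc_def using code_lower by (auto simp: code_eq)

text \<open>Puts the approximated types of the bundle and the exact earlier types on the same
  footing, as both occur among the premises of a rule.\<close>

definition level :: "'a \<Rightarrow> 'd \<Rightarrow> ('a list \<Rightarrow> 'a) \<Rightarrow> bool" where
  "level n Q x \<longleftrightarrow> (if Q \<in> set Ds then approx n Q x else holds (T Q) x)"

text \<open>For an earlier type a labelled root over blank subtrees is enough, since
  \<open>loc\<close> demands its truth right there.\<close>

lemma level_deco:
  assumes x: "x \<in> F1" and Q: "Q \<in> set Ds \<union> set lower"
  shows "level n Q x \<longleftrightarrow> (\<exists>h \<in> F1. h [Z] = num (code Q) \<and> deco n x h)"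
proof (cases "Q \<in> set Ds")
  case True
  then show ?thesis by (simp add: level_def approx_def)
next
  case False
  then have Q: "Q \<in> set lower" using Q by blast
  have "\<exists>h \<in> F1. h [Z] = num (code Q) \<and> deco n x h" if "holds (T Q) x"
    using deco_leaf[OF x loc_lower[OF Q that]] by (intro bexI[of _ "node (code Q) []"]) simp_all
  moreover have "holds (T Q) x" if "h \<in> F1" "h [Z] = num (code Q)" "deco n x h" for h
    using deco_loc[OF x that(1,3)] that(2) Q unfolding loc_def by blast
  ultimately show ?thesis using False unfolding level_def by auto
qed

text \<open>In one direction the children of a decoration decorate the children of \<open>x\<close>.
  In the other, decorations of the children are joined under a new root; only the finitely many
  argument places need one, so \<open>H\<close> can be chosen outside the model.\<close>

lemma approx_S:
  assumes D: "D \<in> set Ds" and x: "x \<in> F1"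
  shows "approx (S n) D x \<longleftrightarrow> (\<exists>c Qs. (c, Qs, D) \<in> set R \<and> x [Z] = num (sharp c) \<and>
    (\<forall>i < length Qs. level n (Qs ! i) (child x (num i))))"
proof
  assume "approx (S n) D x"
  then obtain h where h: "h \<in> F1" "h [Z] = num (code D)" "deco (S n) x h" by (auto simp: approx_def)
  then have l: "loc (S n) x h" and d: "\<And>i. deco n (child x i) (child h i)"
    using x by (simp_all add: deco_S)
  from l D h(2) obtain c Qs where cQs: "(c, Qs, D) \<in> set R" "x [Z] = num (sharp c)"
    "\<forall>i < length Qs. h [cons (num i) Z] = num (code (Qs ! i))"
    unfolding loc_def by (metis S_not_Z(1))
  have "level n (Qs ! i) (child x (num i))" if i: "i < length Qs" for i
  proof -
    have "Qs ! i \<in> set Ds \<union> set lower" using rules_ok[OF cQs(1)] nth_mem[OF i] by blast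
    then show ?thesis
      using h(1) cQs(3) i d x by (subst level_deco) (auto intro!: bexI[of _ "child h (num i)"])
  qed
  with cQs show "\<exists>c Qs. (c, Qs, D) \<in> set R \<and> x [Z] = num (sharp c) \<and>
    (\<forall>i < length Qs. level n (Qs ! i) (child x (num i)))" by blast
next
  assume "\<exists>c Qs. (c, Qs, D) \<in> set R \<and> x [Z] = num (sharp c) \<and>
    (\<forall>i < length Qs. level n (Qs ! i) (child x (num i)))"
  then obtain c Qs where cQs: "(c, Qs, D) \<in> set R" "x [Z] = num (sharp c)"
    and lev: "\<And>i. i < length Qs \<Longrightarrow> level n (Qs ! i) (child x (num i))" by blast
  have "\<exists>h. i < length Qs \<longrightarrow> h \<in> F1 \<and> h [Z] = num (code (Qs ! i)) \<and> deco n (child x (num i)) h" for i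
  proof (cases "i < length Qs")
    case True
    then have "Qs ! i \<in> set Ds \<union> set lower" using rules_ok[OF cQs(1)] nth_mem by blast
    then show ?thesis using lev[OF True] level_deco[of "child x (num i)" "Qs ! i"] x by auto
  qed simp
  then obtain H where H: "\<And>i. i < length Qs \<Longrightarrow> H i \<in> F1"
    "\<And>i. i < length Qs \<Longrightarrow> H i [Z] = num (code (Qs ! i))"
    "\<And>i. i < length Qs \<Longrightarrow> deco n (child x (num i)) (H i)" by metis
  define hs where "hs = map H [0..<length Qs]"
  have hs: "set hs \<subseteq> F1" "length hs = length Qs" "\<And>i. i < length Qs \<Longrightarrow> hs ! i = H i"
    using H(1) by (auto simp: hs_def)
  let ?h = "node (code D) hs"
  have "loc (S n) x ?h"
    unfolding loc_def
  proof (intro conjI ballI impI)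
    fix D' assume D': "D' \<in> set Ds" "?h [Z] = num (code D')"
    then have "D' = D" using D hs(1) by (simp add: code_eq)
    then show "\<exists>c Qs. (c, Qs, D') \<in> set R \<and> x [Z] = num (sharp c) \<and>
        (\<forall>i < length Qs. ?h [cons (num i) Z] = num (code (Qs ! i)))"
      using cQs hs H(2) by (intro exI[of _ c] exI[of _ Qs]) simp
  next
    fix Q assume "Q \<in> set lower" "?h [Z] = num (code Q)"
    then show "holds (T Q) x" using D hs(1) code_lower[of D Q] by simp
  qed simp
  moreover have "deco n (child x j) (child ?h j)" for j
  proof (cases "\<exists>i < length Qs. j = num i")
    case True
    then obtain i where i: "i < length Qs" "j = num i" by blast
    then show ?thesis using hs H(3) by (simp add: child_node)
  next
    \<comment> \<open>All other entries, nonstandard ones among them, lead to blank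
      subtrees.\<close>
    case False
    then show ?thesis
      using hs by (intro deco_blank) (auto simp: node_cons_other)
  qed
  ultimately have "deco (S n) x ?h" using x hs(1) by (simp add: deco_S)
  then show "approx (S n) D x"
    unfolding approx_def using hs(1) by (intro bexI[of _ ?h]) simp_all
qed

lemma approx_Z:
  assumes D: "D \<in> set Ds" and x: "x \<in> F1"
  shows "approx Z D x \<longleftrightarrow> coind"
proof
  assume "approx Z D x"
  then show coind using D x unfolding approx_def by (auto simp: deco_Z loc_def)
next
  assume coind
  then have "loc Z x (node (code D) [])"
    unfolding loc_def using D code_lower by (auto simp: code_eq)
  then show "approx Z D x"
    unfolding approx_def using x by (intro bexI[of _ "node (code D) []"]) (simp_all add: deco_Z)
qed

section \<open>Monotonicity and invariance of the approximations\<close>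

lemma sat_afm_subst:
  "sat M e u (pfm_subst \<sigma> FVar (afm D)) \<longleftrightarrow> approx (neval M e u (\<sigma> 0)) D (u 1 0)"
  by (simp add: sat_subst sat_afm)

abbreviation (input) upS :: "nat \<Rightarrow> ntm" where
  "upS \<equiv> \<lambda>n. case n of 0 \<Rightarrow> NSuc (NVar 0) | Suc m \<Rightarrow> NVar (Suc m)"

lemma upS_ok: "subst_ok upS FVar"
  by (auto simp: subst_ok_def split: nat.split)

lemma rule_child:
  assumes "(c, Qs, D) \<in> set R" "i < length Qs"
  shows "c \<in> set (ctors V)" "i < arity V c" "Qs ! i \<in> set Ds \<union> set lower"
  using rules_ok[OF assms(1)] nth_mem[OF assms(2)] assms(2) by (blast, simp, blast)

lemma holds_coind: "coind \<Longrightarrow> holds (tfm D) x \<longleftrightarrow> (\<forall>n. approx n D x)"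
  and holds_ind: "\<not> coind \<Longrightarrow> holds (tfm D) x \<longleftrightarrow> (\<exists>n. approx n D x)"
  unfolding holds_tfm by (erule if_P, erule if_not_P)

text \<open>Stage 0 is empty, and one unfolding by \<open>approx_S\<close> preserves inclusion. The
  types of the bundle depend on each other, so all of them enter one formula.\<close>

lemma approx_mono_step:
  assumes "\<not> coind"
  shows "\<forall>x \<in> F1. \<forall>D \<in> set Ds. approx n D x \<longrightarrow> approx (S n) D x"
proof -
  let ?\<phi> = "PAllF 1 (PConj (map (\<lambda>D. PImp (afm D) (pfm_subst upS FVar (afm D))) Ds))"
  have sat: "sat M (case_nat n e) u0 ?\<phi> \<longleftrightarrow>
      (\<forall>x \<in> F1. \<forall>D \<in> set Ds. approx n D x \<longrightarrow> approx (S n) D x)" for n e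
    by (simp add: sat_afm sat_afm_subst pushf_def)
  have "sat M (case_nat n e) u0 ?\<phi>" for e
  proof (rule sat_induct)
    show "pfm_ok ?\<phi>" by (simp add: pfm_ok_subst upS_ok)
    show "sat M (case_nat Z e) u0 ?\<phi>" unfolding sat using approx_Z assms by blast
    fix n assume IH: "sat M (case_nat n e) u0 ?\<phi>"
    \<comment> \<open>Premises over earlier types do not change with the depth, so the hypothesis
      covers all premises of a rule.\<close>
    have "level n Q y \<longrightarrow> level (S n) Q y" if "y \<in> F1" for Q y
      using IH that unfolding sat level_def by simp
    then show "sat M (case_nat (S n) e) u0 ?\<phi>"
      unfolding sat by (simp add: approx_S) (meson child_in_F1)
  qed simp
  then show ?thesis unfolding sat .
qed

lemma approx_anti_step:
  assumes coind
  shows "\<forall>x \<in> F1. \<forall>D \<in> set Ds. approx (S n) D x \<longrightarrow> approx n D x"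
proof -
  let ?\<phi> = "PAllF 1 (PConj (map (\<lambda>D. PImp (pfm_subst upS FVar (afm D)) (afm D)) Ds))"
  have sat: "sat M (case_nat n e) u0 ?\<phi> \<longleftrightarrow>
      (\<forall>x \<in> F1. \<forall>D \<in> set Ds. approx (S n) D x \<longrightarrow> approx n D x)" for n e
    by (simp add: sat_afm sat_afm_subst pushf_def)
  have "sat M (case_nat n e) u0 ?\<phi>" for e
  proof (rule sat_induct)
    show "pfm_ok ?\<phi>" by (simp add: pfm_ok_subst upS_ok)
    show "sat M (case_nat Z e) u0 ?\<phi>" unfolding sat using approx_Z assms by blast
    fix n assume IH: "sat M (case_nat n e) u0 ?\<phi>"
    have "level (S n) Q y \<longrightarrow> level n Q y" if "y \<in> F1" for Q y
      using IH that unfolding sat level_def by simp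
    then show "sat M (case_nat (S n) e) u0 ?\<phi>"
      unfolding sat by (simp add: approx_S) (meson child_in_F1)
  qed simp
  then show ?thesis unfolding sat .
qed

lemma approx_mono:
  assumes "\<not> coind" "x \<in> F1" "D \<in> set Ds" "le m n" "approx m D x"
  shows "approx n D x"
proof -
  obtain k where k: "n = add m k" using assms(4) by (auto simp: le_def)
  \<comment> \<open>The depth is the only free numeric variable of \<open>afm D\<close>, so the same
    term may be inserted for all indices.\<close>
  let ?\<phi> = "pfm_subst (\<lambda>n. Papp p_add [NVar 1, NVar 0]) FVar (afm D)"
  have sat: "sat M (case_nat k (\<lambda>_. m)) (pushf 1 x u0) ?\<phi> \<longleftrightarrow> approx (add m k) D x" for k
    by (simp add: sat_afm_subst fold_ops pushf_def)
  have "sat M (case_nat k (\<lambda>_. m)) (pushf 1 x u0) ?\<phi>"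
  proof (rule sat_induct)
    show "pfm_ok ?\<phi>" by (intro pfm_ok_subst) (simp_all add: subst_ok_def prfl_ok_arith)
    show "sat M (case_nat Z (\<lambda>_. m)) (pushf 1 x u0) ?\<phi>"
      unfolding sat add_Z_right by (rule assms(5))
    show "sat M (case_nat (S k) (\<lambda>_. m)) (pushf 1 x u0) ?\<phi>"
      if "sat M (case_nat k (\<lambda>_. m)) (pushf 1 x u0) ?\<phi>" for k
      using that approx_mono_step[OF assms(1)] assms(2,3) unfolding sat add_S_right by blast
  qed (simp add: assms(2))
  then show ?thesis unfolding sat k .
qed

lemma approx_anti:
  assumes coind "x \<in> F1" "D \<in> set Ds" "le m n" "approx n D x"
  shows "approx m D x"
proof -
  obtain k where k: "n = add m k" using assms(4) by (auto simp: le_def)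
  let ?\<phi> = "PImp (pfm_subst (\<lambda>n. Papp p_add [NVar 1, NVar 0]) FVar (afm D))
    (pfm_subst (\<lambda>n. NVar 1) FVar (afm D))"
  have sat: "sat M (case_nat k (\<lambda>_. m)) (pushf 1 x u0) ?\<phi> \<longleftrightarrow>
      (approx (add m k) D x \<longrightarrow> approx m D x)" for k
    by (simp add: sat_afm_subst fold_ops pushf_def)
  have "sat M (case_nat k (\<lambda>_. m)) (pushf 1 x u0) ?\<phi>"
  proof (rule sat_induct)
    show "pfm_ok ?\<phi>" by (auto intro!: pfm_ok_subst simp: subst_ok_def prfl_ok_arith)
    show "sat M (case_nat Z (\<lambda>_. m)) (pushf 1 x u0) ?\<phi>"
      unfolding sat add_Z_right by blast
    show "sat M (case_nat (S k) (\<lambda>_. m)) (pushf 1 x u0) ?\<phi>"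
      if "sat M (case_nat k (\<lambda>_. m)) (pushf 1 x u0) ?\<phi>" for k
      using that approx_anti_step[OF assms(1)] assms(2,3) unfolding sat add_S_right by blast
  qed (simp add: assms(2))
  then show ?thesis using assms(5) unfolding sat k by blast
qed

text \<open>An unfolding inspects the root and the children below the arity of its constructor, and
  \<open>same\<close> passes to these. Earlier types are invariant by
  \<open>lower_cong\<close>.\<close>

lemma approx_cong_all:
  "\<forall>x \<in> F1. \<forall>y \<in> F1. same x y \<longrightarrow> (\<forall>D \<in> set Ds. approx n D x \<longrightarrow> approx n D y)"
proof -
  \<comment> \<open>\<open>flift 1\<close> makes a copy of \<open>afm D\<close> speak of the outer
    function variable, which is \<open>x\<close>.\<close>
  let ?\<phi> = "PAllF 1 (PAllF 1 (PImp (SameHtm V sharp (FVar 1 1) (FVar 1 0))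
    (PConj (map (\<lambda>D. PImp (flift 1 (afm D)) (afm D)) Ds))))"
  have sat: "sat M (case_nat n e) u0 ?\<phi> \<longleftrightarrow>
      (\<forall>x \<in> F1. \<forall>y \<in> F1. same x y \<longrightarrow> (\<forall>D \<in> set Ds. approx n D x \<longrightarrow> approx n D y))" for n e
    by (simp add: sat_afm flift_def sat_subst fren_def pushf_def)
  have "sat M (case_nat n e) u0 ?\<phi>" for e
  proof (rule sat_induct)
    show "sat M (case_nat Z e) u0 ?\<phi>" unfolding sat using approx_Z by blast
    fix n assume IH: "sat M (case_nat n e) u0 ?\<phi>"
    show "sat M (case_nat (S n) e) u0 ?\<phi>"
      unfolding sat
    proof (intro ballI impI)
      fix x y D assume xy: "x \<in> F1" "y \<in> F1" "same x y" and D: "D \<in> set Ds" and "approx (S n) D x"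
      then obtain c Qs where cQs: "(c, Qs, D) \<in> set R" "x [Z] = num (sharp c)"
        and lev: "\<And>i. i < length Qs \<Longrightarrow> level n (Qs ! i) (child x (num i))"
        by (auto simp: approx_S)
      have "level n (Qs ! i) (child y (num i))" if i: "i < length Qs" for i
      proof -
        note r = rule_child[OF cQs(1) i]
        have s: "same (child x (num i)) (child y (num i))"
          by (rule same_child[OF xy r(1) cQs(2) r(2)])
        show ?thesis
        proof (cases "Qs ! i \<in> set Ds")
          case True
          then show ?thesis
            using IH[unfolded sat, rule_format, OF _ _ s True] lev[OF i] xy by (simp add: level_def)
        next
          case False
          then show ?thesis
            using lower_cong[OF _ _ _ s, of "Qs ! i"] lev[OF i] xy r(3) by (simp add: level_def)
        qed
      qed
      then show "approx (S n) D y"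
        using cQs D xy same_root[OF xy(3)] by (auto simp: approx_S)
    qed
  qed simp_all
  then show ?thesis unfolding sat .
qed

lemma tfm_cong:
  assumes "D \<in> set Ds" "x \<in> F1" "y \<in> F1" "same x y" "holds (tfm D) x"
  shows "holds (tfm D) y"
proof -
  have eq: "approx n D x \<longrightarrow> approx n D y" for n using approx_cong_all assms(1-4) by blast
  show ?thesis
  proof (cases coind)
    case True
    show ?thesis using assms(5) eq unfolding holds_coind[OF True] by blast
  next
    case False
    show ?thesis using assms(5) eq unfolding holds_ind[OF False] by blast
  qed
qed

section \<open>Rules, induction and coinduction for the interpreted types\<close>

definition final :: "'d \<Rightarrow> ('a list \<Rightarrow> 'a) \<Rightarrow> bool" where
  "final Q x \<longleftrightarrow> (if Q \<in> set Ds then holds (tfm Q) x else holds (T Q) x)"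

lemma final_ind:
  assumes "\<not> coind" "final Q x" shows "\<exists>n. level n Q x"
proof (cases "Q \<in> set Ds")
  case True
  with assms(2) have "holds (tfm Q) x" by (simp only: final_def if_True)
  then obtain n where "approx n Q x" unfolding holds_ind[OF assms(1)] by blast
  with True show ?thesis by (auto simp only: level_def if_True)
qed (use assms(2) in \<open>simp add: final_def level_def\<close>)

lemma final_coind:
  assumes "coind" "\<not> final Q x" shows "\<exists>n. \<not> level n Q x"
proof (cases "Q \<in> set Ds")
  case True
  with assms(2) have "\<not> holds (tfm Q) x" by (simp add: final_def)
  then obtain n where "\<not> approx n Q x" unfolding holds_coind[OF assms(1)] by blast
  with True show ?thesis by (auto simp only: level_def if_True)
qed (use assms(2) in \<open>simp add: final_def level_def\<close>)

text \<open>Each premise holds at some depth. As the approximations increase, all hold at a common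
  depth \<open>N\<close>, and the rule leads to \<open>N + 1\<close>.\<close>

lemma tfm_construct:
  assumes ind: "\<not> coind" and \<rho>: "(c, Qs, D) \<in> set R" and x: "x \<in> F1" "x [Z] = num (sharp c)"
    and fin: "\<And>i. i < length Qs \<Longrightarrow> final (Qs ! i) (child x (num i))"
  shows "holds (tfm D) x"
proof -
  have D: "D \<in> set Ds" using rules_ok[OF \<rho>] by blast
  have "\<exists>n. i < length Qs \<longrightarrow> level n (Qs ! i) (child x (num i))" for i
    using final_ind[OF ind fin[of i]] by blast
  then obtain f where f: "\<And>i. i < length Qs \<Longrightarrow> level (f i) (Qs ! i) (child x (num i))"
    using choice[of "\<lambda>i n. i < length Qs \<longrightarrow> level n (Qs ! i) (child x (num i))"] by blast
  obtain N where N: "\<forall>i \<in> set [0..<length Qs]. le (f i) N"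
    using le_bound[where f = f and xs = "[0..<length Qs]"] by blast
  have "level N (Qs ! i) (child x (num i))" if i: "i < length Qs" for i
  proof (cases "Qs ! i \<in> set Ds")
    case True
    have "le (f i) N" using N i by simp
    moreover have "approx (f i) (Qs ! i) (child x (num i))"
      using f[OF i] True by (simp only: level_def if_True)
    ultimately have "approx N (Qs ! i) (child x (num i))"
      by (rule approx_mono[OF ind child_in_F1[OF x(1)] True])
    with True show ?thesis by (simp only: level_def if_True)
  next
    case False
    then show ?thesis using f[OF i] by (simp only: level_def if_False)
  qed
  then have "approx (S N) D x" unfolding approx_S[OF D x(1)] using \<rho> x(2) by blast
  then show ?thesis unfolding holds_ind[OF ind] by blast
qed

text \<open>Suppose that each rule applicable at the root fails at some depth
  \<open>f \<rho>\<close>, and let \<open>N\<close> bound these depths. Membership at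
  \<open>N + 1\<close> yields a rule whose premises hold at \<open>N\<close>, hence at every smaller
  depth, contradicting the failure of this very rule.\<close>

lemma tfm_destruct:
  assumes co: coind and D: "D \<in> set Ds" and x: "x \<in> F1" "holds (tfm D) x"
  shows "\<exists>c Qs. (c, Qs, D) \<in> set R \<and> x [Z] = num (sharp c) \<and>
    (\<forall>i < length Qs. final (Qs ! i) (child x (num i)))"
proof (rule ccontr)
  assume contra: "\<not> ?thesis"
  let ?lev = "\<lambda>n (c, Qs, D'). \<forall>i < length Qs. level n (Qs ! i) (child x (num i))"
  have ap: "approx n D x" for n using x holds_coind[OF co] by blast
  have "\<exists>n. \<not> ?lev n \<rho>" if \<rho>: "\<rho> \<in> set R" "snd (snd \<rho>) = D" "x [Z] = num (sharp (fst \<rho>))" for \<rho>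
  proof -
    obtain c Qs where r: "\<rho> = (c, Qs, D)" using \<rho>(2) by (metis prod.collapse)
    then obtain i where "i < length Qs" "\<not> final (Qs ! i) (child x (num i))"
      using contra \<rho> by auto
    then have "\<exists>n. \<not> level n (Qs ! i) (child x (num i))"
      using final_coind[OF co] by blast
    then show ?thesis using \<open>i < length Qs\<close> r by auto
  qed
  then obtain f where f: "\<And>\<rho>. \<rho> \<in> set R \<Longrightarrow> snd (snd \<rho>) = D \<Longrightarrow> x [Z] = num (sharp (fst \<rho>)) \<Longrightarrow>
      \<not> ?lev (f \<rho>) \<rho>"
    using bchoice[of "{\<rho> \<in> set R. snd (snd \<rho>) = D \<and> x [Z] = num (sharp (fst \<rho>))}" "\<lambda>\<rho> n. \<not> ?lev n \<rho>"]
    by blast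
  obtain N where N: "\<forall>\<rho> \<in> set R. le (f \<rho>) N"
    using le_bound[where f = f and xs = R] by blast
  obtain c Qs where cQs: "(c, Qs, D) \<in> set R" "x [Z] = num (sharp c)"
    and lev: "\<And>i. i < length Qs \<Longrightarrow> level N (Qs ! i) (child x (num i))"
    using ap[of "S N"] D x by (auto simp: approx_S)
  have "level (f (c, Qs, D)) (Qs ! i) (child x (num i))" if i: "i < length Qs" for i
  proof (cases "Qs ! i \<in> set Ds")
    case True
    have "le (f (c, Qs, D)) N" using N cQs by simp
    moreover have "approx N (Qs ! i) (child x (num i))"
      using lev[OF i] True by (simp only: level_def if_True)
    ultimately have "approx (f (c, Qs, D)) (Qs ! i) (child x (num i))"
      by (rule approx_anti[OF co child_in_F1[OF x(1)] True])
    with True show ?thesis by (simp only: level_def if_True)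
  next
    case False
    then show ?thesis using lev[OF i] by (simp only: level_def if_False)
  qed
  then show False using f[OF cQs(1)] cQs by simp
qed

text \<open>The predicates \<open>P D\<close> are defined by formulas, so the induction on the depth
  can be carried out in the model. The conjunction over the bundle takes care of mutual dependence,
  and hyper-terms have hyper-terms as children.\<close>

lemma tfm_induct:
  assumes ind: "\<not> coind" and u: "fenv M u"
    and \<Phi>: "\<And>D. D \<in> set Ds \<Longrightarrow> pfm_ok (\<Phi> D)"
      "\<And>D e y. D \<in> set Ds \<Longrightarrow> y \<in> F1 \<Longrightarrow> sat M e (pushf 1 y u) (\<Phi> D) \<longleftrightarrow> P D y"
    and closed: "\<And>c Qs D x. (c, Qs, D) \<in> set R \<Longrightarrow> x \<in> F1 \<Longrightarrow> htm x \<Longrightarrow> x [Z] = num (sharp c) \<Longrightarrow>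
      (\<And>i. i < length Qs \<Longrightarrow> if Qs ! i \<in> set Ds then P (Qs ! i) (child x (num i))
        else holds (T (Qs ! i)) (child x (num i))) \<Longrightarrow> P D x"
    and x: "x \<in> F1" "htm x" and D: "D \<in> set Ds" and hold: "holds (tfm D) x"
  shows "P D x"
proof -
  let ?\<phi> = "PAllF 1 (PImp (Htm V sharp (FVar 1 0)) (PConj (map (\<lambda>D. PImp (afm D) (\<Phi> D)) Ds)))"
  have sat: "sat M (case_nat n e) u ?\<phi> \<longleftrightarrow>
      (\<forall>x \<in> F1. htm x \<longrightarrow> (\<forall>D \<in> set Ds. approx n D x \<longrightarrow> P D x))" for n e
    using \<Phi>(2) by (simp add: sat_afm) (simp add: pushf_def)
  have "sat M (case_nat n e) u ?\<phi>" for n e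
  proof (rule sat_induct)
    show "pfm_ok ?\<phi>" by (simp add: \<Phi>(1))
    show "sat M (case_nat Z e) u ?\<phi>" unfolding sat using ind approx_Z by blast
    fix n assume IH: "sat M (case_nat n e) u ?\<phi>"
    show "sat M (case_nat (S n) e) u ?\<phi>"
      unfolding sat
    proof (intro ballI impI)
      fix x D assume x: "x \<in> F1" "htm x" and D: "D \<in> set Ds" and "approx (S n) D x"
      then obtain c Qs where cQs: "(c, Qs, D) \<in> set R" "x [Z] = num (sharp c)"
        and lev: "\<And>i. i < length Qs \<Longrightarrow> level n (Qs ! i) (child x (num i))"
        by (auto simp: approx_S)
      show "P D x"
      proof (rule closed[OF cQs(1) x cQs(2)])
        fix i assume i: "i < length Qs"
        note r = rule_child[OF cQs(1) i]
        have h: "htm (child x (num i))" by (rule htm_child[OF x r(1) cQs(2) r(2)])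
        show "if Qs ! i \<in> set Ds then P (Qs ! i) (child x (num i))
          else holds (T (Qs ! i)) (child x (num i))"
          using lev[OF i] IH[unfolded sat, rule_format, OF _ h, of "Qs ! i"] x
          by (simp add: level_def split: if_splits)
      qed
    qed
  qed (rule u)
  moreover obtain n where "approx n D x" using hold unfolding holds_ind[OF ind] by blast
  ultimately show ?thesis using x D unfolding sat by blast
qed

text \<open>Dual to the previous one: at depth 0 everything qualifies, and opening \<open>P\<close>
  once leads to children for which the hypothesis at depth \<open>n\<close> is available.\<close>

lemma tfm_coinduct:
  assumes co: coind and u: "fenv M u"
    and \<Phi>: "\<And>D. D \<in> set Ds \<Longrightarrow> pfm_ok (\<Phi> D)"
      "\<And>D e y. D \<in> set Ds \<Longrightarrow> y \<in> F1 \<Longrightarrow> sat M e (pushf 1 y u) (\<Phi> D) \<longleftrightarrow> P D y"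
    and opened: "\<And>D x. D \<in> set Ds \<Longrightarrow> x \<in> F1 \<Longrightarrow> htm x \<Longrightarrow> P D x \<Longrightarrow>
      \<exists>c Qs. (c, Qs, D) \<in> set R \<and> x [Z] = num (sharp c) \<and>
      (\<forall>i < length Qs. if Qs ! i \<in> set Ds then P (Qs ! i) (child x (num i))
        else holds (T (Qs ! i)) (child x (num i)))"
    and x: "x \<in> F1" "htm x" and D: "D \<in> set Ds" and hold: "P D x"
  shows "holds (tfm D) x"
proof -
  let ?\<phi> = "PAllF 1 (PImp (Htm V sharp (FVar 1 0)) (PConj (map (\<lambda>D. PImp (\<Phi> D) (afm D)) Ds)))"
  have sat: "sat M (case_nat n e) u ?\<phi> \<longleftrightarrow>
      (\<forall>x \<in> F1. htm x \<longrightarrow> (\<forall>D \<in> set Ds. P D x \<longrightarrow> approx n D x))" for n e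
    using \<Phi>(2) by (simp add: sat_afm) (simp add: pushf_def)
  have "sat M (case_nat n e) u ?\<phi>" for n e
  proof (rule sat_induct)
    show "pfm_ok ?\<phi>" by (simp add: \<Phi>(1))
    show "sat M (case_nat Z e) u ?\<phi>" unfolding sat using co approx_Z by blast
    fix n assume IH: "sat M (case_nat n e) u ?\<phi>"
    show "sat M (case_nat (S n) e) u ?\<phi>"
      unfolding sat
    proof (intro ballI impI)
      fix x D assume x: "x \<in> F1" "htm x" and D: "D \<in> set Ds" and "P D x"
      then obtain c Qs where cQs: "(c, Qs, D) \<in> set R" "x [Z] = num (sharp c)"
        and lev: "\<And>i. i < length Qs \<Longrightarrow> if Qs ! i \<in> set Ds then P (Qs ! i) (child x (num i))
          else holds (T (Qs ! i)) (child x (num i))"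
        using opened by meson
      have "level n (Qs ! i) (child x (num i))" if i: "i < length Qs" for i
      proof -
        note r = rule_child[OF cQs(1) i]
        have h: "htm (child x (num i))" by (rule htm_child[OF x r(1) cQs(2) r(2)])
        show ?thesis
          using lev[OF i] IH[unfolded sat, rule_format, OF _ h, of "Qs ! i"] x
          by (simp add: level_def split: if_splits)
      qed
      then show "approx (S n) D x" using cQs x D by (auto simp: approx_S)
    qed
  qed (rule u)
  then have "approx n D x" for n using x D hold unfolding sat by blast
  then show ?thesis unfolding holds_coind[OF co] by blast
qed

end

section \<open>The types of a data-system\<close>

fun bundle_coind :: "('c, 'd) ty_bundle \<Rightarrow> bool" where
  "bundle_coind (Inductive Ds R) = False"
| "bundle_coind (Coinductive R) = True"

text \<open>A disjunct of a deconstruction rule is stored like a construction rule. Both kinds of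
  bundle then share all definitions, up to the condition at depth 0 and the quantifier over the
  depth.\<close>

fun bundle_rules :: "('c, 'd) ty_bundle \<Rightarrow> ('c, 'd) rule list" where
  "bundle_rules (Inductive Ds R) = R"
| "bundle_rules (Coinductive R) = concat (map (\<lambda>(D, \<psi>s). map (\<lambda>(c, Qs). (c, Qs, D)) \<psi>s) R)"

text \<open>The last bundle of the data-system comes first in the list.\<close>

primrec interp :: "('c \<Rightarrow> nat) \<Rightarrow> ('d \<Rightarrow> nat) \<Rightarrow> ('c, 'd) ty_bundle list \<Rightarrow> 'd \<Rightarrow> pfm" where
  "interp sharp code [] = (\<lambda>_. PFalse)"
| "interp sharp code (B # Bs) = (\<lambda>D.
     if D \<in> set (bundle_types B)
     then type_fm code (bundle_coind B) (local_fm sharp code (bundle_coind B) (bundle_types B)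
       (bundle_rules B) (concat (map bundle_types Bs)) (interp sharp code Bs)) D
     else interp sharp code Bs D)"

text \<open>The form of a data-system that suits recursion: each bundle is checked against itself
  and the bundles behind it, which are the earlier ones.\<close>

fun layered :: "'c vocabulary \<Rightarrow> ('c, 'd) ty_bundle list \<Rightarrow> bool" where
  "layered V [] = True"
| "layered V (B # Bs) \<longleftrightarrow> layered V Bs \<and> bundle_ok V (types (B # Bs)) B \<and>
     set (bundle_types B) \<inter> types Bs = {}"

lemma types_Cons: "types (B # Bs) = set (bundle_types B) \<union> types Bs"
  by (auto simp: types_def)

lemma layered_take:
  assumes "data_system V S"
  shows "i \<le> length S \<Longrightarrow> layered V (rev (take i S))"
proof (induction i)
  case (Suc i)
  then have i: "i < length S" by simp
  have rev: "rev (take (Suc i) S) = S ! i # rev (take i S)"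
    by (simp add: take_Suc_conv_app_nth[OF i])
  have types: "types (S ! i # rev (take i S)) = types (take (Suc i) S)"
    by (auto simp: take_Suc_conv_app_nth[OF i] types_def)
  have "distinct (concat (map bundle_types (take (Suc i) S @ drop (Suc i) S)))"
    using assms by (simp add: data_system_def)
  then have "distinct (concat (map bundle_types (take (Suc i) S)))"
    by (simp del: append_take_drop_id)
  then have "set (bundle_types (S ! i)) \<inter> types (rev (take i S)) = {}"
    by (auto simp: take_Suc_conv_app_nth[OF i] types_def)
  then show ?case
    using Suc.IH i assms types by (simp add: rev data_system_def)
qed simp

lemma layered_data_system: "data_system V S \<Longrightarrow> layered V (rev S)"
  using layered_take[of V S "length S"] by simp

lemma bundle_rules_ok:
  assumes "bundle_ok V Ts B" "(c, Qs, D) \<in> set (bundle_rules B)"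
  shows "D \<in> set (bundle_types B) \<and> c \<in> set (ctors V) \<and> length Qs = arity V c \<and> set Qs \<subseteq> Ts"
proof (cases B)
  case (Inductive Ds R)
  then show ?thesis using assms by fastforce
next
  case (Coinductive R)
  with assms(2) obtain \<psi>s where \<psi>: "(D, \<psi>s) \<in> set R" "(c, Qs) \<in> set \<psi>s" by auto
  then have "c \<in> set (ctors V) \<and> length Qs = arity V c \<and> set Qs \<subseteq> Ts"
    using assms(1) Coinductive by fastforce
  moreover have "D \<in> fst ` set R" using \<psi>(1) by force
  ultimately show ?thesis using Coinductive by simp
qed

lemma interp_ok: "type_ok (interp sharp code Bs D)"
proof (induction Bs arbitrary: D)
  case Nil
  then show ?case by (simp add: type_ok_def)
next
  case (Cons B Bs)
  have "type_ok (type_fm code (bundle_coind B) (local_fm sharp code (bundle_coind B) (bundle_types B)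
       (bundle_rules B) (concat (map bundle_types Bs)) (interp sharp code Bs)) D)"
    by (intro type_fm_ok local_fm_ok Cons.IH)
  then show ?case using Cons.IH by simp
qed

context hyper
begin

text \<open>Invariance under \<open>same\<close> and the locale conditions depend on each other: the
  locale for \<open>B\<close> presupposes invariance of the earlier types, and
  \<open>tfm_cong\<close> inside it gives invariance for \<open>B\<close>. Each bundle keeps the
  \<open>lower\<close> and \<open>T\<close> of its own stage, since disjointness prevents later
  bundles from altering them.\<close>

lemma interp_props:
  assumes "layered V Bs" "inj_on code (types Bs)" "\<And>D. D \<in> types Bs \<Longrightarrow> code D \<noteq> 0"
  shows "(\<forall>Q g h. g \<in> F1 \<longrightarrow> h \<in> F1 \<longrightarrow> same g h \<longrightarrow>
      holds (interp sharp code Bs Q) g \<longrightarrow> holds (interp sharp code Bs Q) h) \<and>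
    (\<forall>B \<in> set Bs. \<exists>lower T.
      type_bundle M V sharp code (bundle_types B) (bundle_rules B) lower T \<and> set lower \<subseteq> types Bs \<and>
      (\<forall>Q \<in> set lower. T Q = interp sharp code Bs Q) \<and>
      (\<forall>D \<in> set (bundle_types B). interp sharp code Bs D = type_fm code (bundle_coind B)
        (local_fm sharp code (bundle_coind B) (bundle_types B) (bundle_rules B) lower T) D))"
  using assms
proof (induction Bs)
  case Nil
  then show ?case by (simp add: holds_def)
next
  case (Cons B Bs)
  let ?T = "interp sharp code" and ?lower = "concat (map bundle_types Bs)"
  have lower: "set ?lower = types Bs" by (simp add: types_def)
  have "inj_on code (types Bs)" "\<And>D. D \<in> types Bs \<Longrightarrow> code D \<noteq> 0"
    using Cons.prems(2,3) by (auto simp: types_Cons intro: inj_on_subset)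
  then have IH: "g \<in> F1 \<Longrightarrow> h \<in> F1 \<Longrightarrow> same g h \<Longrightarrow> holds (?T Bs Q) g \<Longrightarrow> holds (?T Bs Q) h"
    "\<forall>B \<in> set Bs. \<exists>lower T.
      type_bundle M V sharp code (bundle_types B) (bundle_rules B) lower T \<and> set lower \<subseteq> types Bs \<and>
      (\<forall>Q \<in> set lower. T Q = ?T Bs Q) \<and>
      (\<forall>D \<in> set (bundle_types B). ?T Bs D = type_fm code (bundle_coind B)
        (local_fm sharp code (bundle_coind B) (bundle_types B) (bundle_rules B) lower T) D)" for Q g h
    using Cons.IH Cons.prems(1) by simp_all
  have tb: "type_bundle M V sharp code (bundle_types B) (bundle_rules B) ?lower (?T Bs)"
  proof unfold_locales
    show "inj_on code (set (bundle_types B) \<union> set ?lower)"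
      using Cons.prems(2) by (simp only: types_Cons lower)
    show "code D \<noteq> 0" if "D \<in> set (bundle_types B) \<union> set ?lower" for D
      using Cons.prems(3)[of D] that unfolding types_Cons lower by blast
    show "set (bundle_types B) \<inter> set ?lower = {}"
      using Cons.prems(1) by (simp only: layered.simps lower)
    show "D \<in> set (bundle_types B) \<and> c \<in> set (ctors V) \<and> length Qs = arity V c \<and>
        set Qs \<subseteq> set (bundle_types B) \<union> set ?lower"
      if "(c, Qs, D) \<in> set (bundle_rules B)" for c Qs D
      using bundle_rules_ok[OF _ that, of V "types (B # Bs)"] Cons.prems(1)
      unfolding lower types_Cons[symmetric] by simp
    show "type_ok (?T Bs Q)" for Q by (rule interp_ok)
    show "holds (?T Bs Q) h" if "g \<in> F1" "h \<in> F1" "same g h" "holds (?T Bs Q) g" for Q g h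
      by (rule IH(1)[OF that])
  qed
  interpret type_bundle M V sharp code "bundle_coind B" "bundle_types B" "bundle_rules B" ?lower "?T Bs"
    by (rule tb)
  have "holds (?T (B # Bs) Q) h" if "g \<in> F1" "h \<in> F1" "same g h" "holds (?T (B # Bs) Q) g" for Q g h
  proof (cases "Q \<in> set (bundle_types B)")
    case True
    then show ?thesis using that tfm_cong[OF True that(1-3)] by simp
  next
    case False
    then show ?thesis using that IH(1)[OF that(1-3)] by simp
  qed
  moreover have "\<exists>lower T.
      type_bundle M V sharp code (bundle_types B') (bundle_rules B') lower T \<and> set lower \<subseteq> types (B # Bs) \<and>
      (\<forall>Q \<in> set lower. T Q = ?T (B # Bs) Q) \<and>
      (\<forall>D \<in> set (bundle_types B'). ?T (B # Bs) D = type_fm code (bundle_coind B')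
        (local_fm sharp code (bundle_coind B') (bundle_types B') (bundle_rules B') lower T) D)"
    if B': "B' \<in> set (B # Bs)" for B'
  proof (cases "B' = B")
    case True
    have "\<forall>Q \<in> set ?lower. ?T Bs Q = ?T (B # Bs) Q"
      using disjoint by auto
    moreover have "set ?lower \<subseteq> types (B # Bs)" unfolding lower types_Cons by blast
    ultimately show ?thesis
      unfolding True using tb by (intro exI[of _ ?lower] exI[of _ "?T Bs"]) simp
  next
    case False
    then obtain lower T where
      l: "type_bundle M V sharp code (bundle_types B') (bundle_rules B') lower T" "set lower \<subseteq> types Bs"
      "\<forall>Q \<in> set lower. T Q = ?T Bs Q"
      "\<forall>D \<in> set (bundle_types B'). ?T Bs D = type_fm code (bundle_coind B')
        (local_fm sharp code (bundle_coind B') (bundle_types B') (bundle_rules B') lower T) D"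
      using B' IH(2) by auto
    have eq: "?T (B # Bs) Q = ?T Bs Q" if "Q \<in> types Bs" for Q
      using that disjoint lower by auto
    have "set (bundle_types B') \<subseteq> types Bs"
      using B' False by (auto simp: types_def)
    then show ?thesis
      using l eq by (intro exI[of _ lower] exI[of _ T]) (auto simp: types_Cons simp del: interp.simps)
  qed
  ultimately show ?case by blast
qed

end

section \<open>Soundness of the interpretation\<close>

lemma itm_ok_subst: "(\<And>n. itm_ok V (\<sigma> n)) \<Longrightarrow> itm_ok V (itm_subst \<sigma> t) \<longleftrightarrow> itm_ok V t"
  by (induction t) auto

lemma itm_ok_iup: "(\<And>n. itm_ok V (\<sigma> n)) \<Longrightarrow> itm_ok V (iup \<sigma> n)"
  by (simp add: iup_def itm_ok_subst split: nat.split)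

lemma ifm_ok_subst: "(\<And>n. itm_ok V (\<sigma> n)) \<Longrightarrow> ifm_ok V S (ifm_subst \<sigma> \<phi>) \<longleftrightarrow> ifm_ok V S \<phi>"
proof (induction \<phi> arbitrary: \<sigma>)
  case (IAll \<phi>)
  show ?case using IAll.IH[OF itm_ok_iup[OF IAll.prems]] by simp
next
  case (IEx \<phi>)
  show ?case using IEx.IH[OF itm_ok_iup[OF IEx.prems]] by simp
qed (simp_all add: itm_ok_subst)

lemma ifm_ok_iinst: "itm_ok V t \<Longrightarrow> ifm_ok V S (iinst r \<phi> t) \<longleftrightarrow> ifm_ok V S \<phi>"
  unfolding iinst_def by (rule ifm_ok_subst) (simp split: nat.split)

lemma ifm_ok_ilift [simp]: "ifm_ok V S (ilift \<phi>) \<longleftrightarrow> ifm_ok V S \<phi>"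
  unfolding ilift_def by (rule ifm_ok_subst) simp

lemma ifm_ok_IAlls [simp]: "ifm_ok V S (IAlls r \<phi>) \<longleftrightarrow> ifm_ok V S \<phi>"
  unfolding IAlls_def by (induction r) simp_all

lemma ifm_ok_IExs [simp]: "ifm_ok V S (IExs r \<phi>) \<longleftrightarrow> ifm_ok V S \<phi>"
  unfolding IExs_def by (induction r) simp_all

lemma ifm_ok_IConj [simp]: "ifm_ok V S (IConj \<phi>s) \<longleftrightarrow> (\<forall>\<phi> \<in> set \<phi>s. ifm_ok V S \<phi>)"
  unfolding IConj_def by (induction \<phi>s) simp_all

lemma ifm_ok_IDisj [simp]: "ifm_ok V S (IDisj \<phi>s) \<longleftrightarrow> (\<forall>\<phi> \<in> set \<phi>s. ifm_ok V S \<phi>)"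
  unfolding IDisj_def by (induction \<phi>s) simp_all

lemma construction_rule_ok:
  assumes "c \<in> set (ctors V)" "length Qs = arity V c" "ifm_ok V S (\<Phi> D)"
    "\<And>Q. Q \<in> set Qs \<Longrightarrow> ifm_ok V S (\<Phi> Q)"
  shows "ifm_ok V S (construction_rule \<Phi> (c, Qs, D))"
  using assms by (auto simp: construction_rule_def Let_def ifm_ok_iinst set_zip)

lemma constructor_statement_ok:
  assumes "c \<in> set (ctors V)" "length Qs = arity V c" "\<And>Q. Q \<in> set Qs \<Longrightarrow> ifm_ok V S (\<Phi> Q)"
  shows "ifm_ok V S (constructor_statement \<Phi> (c, Qs))"
  using assms by (auto simp: constructor_statement_def Let_def ifm_ok_iinst set_zip)

lemma deconstruction_rule_ok:
  assumes "ifm_ok V S (\<Phi> D)"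
    "\<And>c Qs. (c, Qs) \<in> set \<psi>s \<Longrightarrow> c \<in> set (ctors V) \<and> length Qs = arity V c \<and>
      (\<forall>Q \<in> set Qs. ifm_ok V S (\<Phi> Q))"
  shows "ifm_ok V S (deconstruction_rule \<Phi> (D, \<psi>s))"
  using assms by (auto simp: deconstruction_rule_def ifm_ok_iinst intro!: constructor_statement_ok)

lemma data_system_rules:
  assumes "data_system V S" "B \<in> set S" "(c, Qs, D) \<in> set (bundle_rules B)"
  shows "D \<in> set (bundle_types B)" "c \<in> set (ctors V)" "length Qs = arity V c" "set Qs \<subseteq> types S"
proof -
  obtain i where i: "i < length S" "B = S ! i" using assms(2) by (auto simp: in_set_conv_nth)
  then have "bundle_ok V (types (take (Suc i) S)) B" using assms(1) by (simp add: data_system_def)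
  moreover have "types (take (Suc i) S) \<subseteq> types S" by (auto simp: types_def dest: in_set_takeD)
  ultimately
  show "D \<in> set (bundle_types B)" "c \<in> set (ctors V)" "length Qs = arity V c" "set Qs \<subseteq> types S"
    using bundle_rules_ok[OF _ assms(3)] by blast+
qed

lemma bundle_types_subset: "B \<in> set S \<Longrightarrow> set (bundle_types B) \<subseteq> types S"
  by (auto simp: types_def)

lemma it_axiom_ok:
  assumes S: "data_system V S" and ax: "it_axiom V S \<phi>"
  shows "ifm_ok V S \<phi>"
  using ax
proof cases
  case (sep_injective c r xs ys)
  then show ?thesis by (auto simp: set_zip)
next
  case (sep_disjoint c c' r r' xs ys)
  then show ?thesis by auto
next
  case (construction Ds R \<rho>)
  obtain c Qs D where \<rho>: "\<rho> = (c, Qs, D)" by (metis prod.exhaust)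
  show ?thesis
    unfolding construction(1) \<rho>
    using data_system_rules[OF S construction(2), of c Qs D] bundle_types_subset[OF construction(2)]
      construction(3) \<rho>
    by (intro construction_rule_ok) (auto simp: type_atom_def)
next
  case (deconstruction R \<rho>)
  obtain D \<psi>s where \<rho>: "\<rho> = (D, \<psi>s)" by (metis prod.exhaust)
  have r: "(c, Qs, D) \<in> set (bundle_rules (Coinductive R))" if "(c, Qs) \<in> set \<psi>s" for c Qs
    using deconstruction(3) that \<rho> by force
  have D: "D \<in> types S" using bundle_types_subset[OF deconstruction(2)] deconstruction(3) \<rho> by force
  have Q: "Q \<in> types S" if "(c, Qs) \<in> set \<psi>s" "Q \<in> set Qs" for c Qs Q
    using data_system_rules(4)[OF S deconstruction(2) r[OF that(1)]] that(2) by blast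
  show ?thesis
    unfolding deconstruction(1) \<rho>
    using data_system_rules(2,3)[OF S deconstruction(2) r] D
    by (intro deconstruction_rule_ok) (auto simp: type_atom_def intro: Q)
next
  case (induction Ds R \<Phi>)
  have ok: "ifm_ok V S (replacing Ds \<Phi> Q)" if "Q \<in> types S" for Q
    using induction(3) that by (auto simp: replacing_def type_atom_def)
  have "ifm_ok V S (construction_rule (replacing Ds \<Phi>) \<rho>)" if "\<rho> \<in> set R" for \<rho>
  proof -
    obtain c Qs D where \<rho>: "\<rho> = (c, Qs, D)" by (metis prod.exhaust)
    show ?thesis
      unfolding \<rho>
      using data_system_rules[OF S induction(2), of c Qs D] bundle_types_subset[OF induction(2)] that \<rho>
      by (intro construction_rule_ok) (auto intro!: ok)
  qed
  then show ?thesis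
    using bundle_types_subset[OF induction(2)] induction(3) by (auto simp: induction(1))
next
  case (coinduction R Ds \<Phi>)
  have ok: "ifm_ok V S (replacing Ds \<Phi> Q)" if "Q \<in> types S" for Q
    using coinduction(4) that by (auto simp: replacing_def type_atom_def)
  have "ifm_ok V S (deconstruction_rule (replacing Ds \<Phi>) \<rho>)" if "\<rho> \<in> set R" for \<rho>
  proof -
    obtain D \<psi>s where \<rho>: "\<rho> = (D, \<psi>s)" by (metis prod.exhaust)
    have r: "(c, Qs, D) \<in> set (bundle_rules (Coinductive R))" if "(c, Qs) \<in> set \<psi>s" for c Qs
      using \<open>\<rho> \<in> set R\<close> that \<rho> by force
    have D: "D \<in> types S" using bundle_types_subset[OF coinduction(2)] \<open>\<rho> \<in> set R\<close> \<rho> by force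
    have Q: "Q \<in> types S" if "(c, Qs) \<in> set \<psi>s" "Q \<in> set Qs" for c Qs Q
      using data_system_rules(4)[OF S coinduction(2) r[OF that(1)]] that(2) by blast
    show ?thesis
      unfolding \<rho> using data_system_rules(2,3)[OF S coinduction(2) r] D
      by (intro deconstruction_rule_ok) (auto intro: ok Q)
  qed
  then show ?thesis
    using bundle_types_subset[OF coinduction(2)] coinduction(3,4) by (auto simp: coinduction(1))
qed

text \<open>Completeness applies to well-formed formulas only; moreover, soundness of replacement
  needs the two terms to be well-formed.\<close>

lemma it_proves_ok:
  assumes S: "data_system V S"
  shows "it_proves V S \<Gamma> \<phi> \<Longrightarrow> ifm_ok V S \<phi>"
  by (induction rule: it_proves.induct) (simp_all add: it_axiom_ok[OF S] ifm_ok_iinst)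

definition ctor_prfl :: "'c vocabulary \<Rightarrow> ('c \<Rightarrow> nat) \<Rightarrow> 'c \<Rightarrow> prfl" where
  "ctor_prfl V sharp c = p_node (sharp c) (arity V c)"

lemma farity_tr_tm [simp]: "farity (tr_tm K N t) = 1"
  by (cases t) simp_all

lemma ftm_ok_tr_tm:
  assumes "\<And>c. prfl_ok (replicate (arity V c) 1) 1 (K c)" "prfl_ok [1] 1 N"
  shows "itm_ok V t \<Longrightarrow> ftm_ok (tr_tm K N t)"
  using assms by (induction t) (auto simp: map_replicate_const comp_def)

lemma pfm_ok_tr_fm:
  assumes "\<And>c. prfl_ok (replicate (arity V c) 1) 1 (K c)" "prfl_ok [1] 1 N" "\<And>D. pfm_ok (T D)"
  shows "ifm_ok V S \<phi> \<Longrightarrow> pfm_ok (tr_fm V sharp K N T \<phi>)"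
  using ftm_ok_tr_tm[of V K N, OF assms(1,2)] assms(3) by (induction \<phi>) simp_all

locale interp_model = hyper M V sharp for M :: "'a pra_struct" and V :: "'c vocabulary" and sharp +
  fixes S :: "('c, 'd) ty_bundle list" and code :: "'d \<Rightarrow> nat" and c0 :: 'c
  assumes data_system: "data_system V S"
    and c0: "c0 \<in> set (ctors V)"
    and code: "inj_on code (types S)" "\<And>D. D \<in> types S \<Longrightarrow> code D \<noteq> 0"
begin

abbreviation T :: "'d \<Rightarrow> pfm" where "T \<equiv> interp sharp code (rev S)"
abbreviation K :: "'c \<Rightarrow> prfl" where "K \<equiv> ctor_prfl V sharp"
abbreviation N :: prfl where "N \<equiv> norm_prfl V sharp c0"
abbreviation tr :: "('c, 'd) ifm \<Rightarrow> pfm" where "tr \<equiv> tr_fm V sharp K N T"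

lemma types_rev: "types (rev S) = types S"
  by (auto simp: types_def)

lemma T_cong: "g \<in> F1 \<Longrightarrow> h \<in> F1 \<Longrightarrow> same g h \<Longrightarrow> holds (T Q) g \<Longrightarrow> holds (T Q) h"
  using interp_props[OF layered_data_system[OF data_system], of code] code by (simp add: types_rev)

lemma T_bundle:
  assumes "B \<in> set S"
  obtains lower T' where
    "type_bundle M V sharp code (bundle_types B) (bundle_rules B) lower T'"
    "\<And>Q. Q \<in> set lower \<Longrightarrow> T' Q = T Q"
    "\<And>D. D \<in> set (bundle_types B) \<Longrightarrow> T D = type_fm code (bundle_coind B)
      (local_fm sharp code (bundle_coind B) (bundle_types B) (bundle_rules B) lower T') D"
proof -
  have "\<forall>B \<in> set (rev S). \<exists>lower T'.
      type_bundle M V sharp code (bundle_types B) (bundle_rules B) lower T' \<and> set lower \<subseteq> types (rev S) \<and>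
      (\<forall>Q \<in> set lower. T' Q = T Q) \<and>
      (\<forall>D \<in> set (bundle_types B). T D = type_fm code (bundle_coind B)
        (local_fm sharp code (bundle_coind B) (bundle_types B) (bundle_rules B) lower T') D)"
    using interp_props[OF layered_data_system[OF data_system], of code] code by (simp add: types_rev)
  with assms that show thesis by fastforce
qed

text \<open>Intrinsic terms and formulas receive a direct semantics in the model, in which axioms
  and rules are checked without the variable bookkeeping of the translation.\<close>

fun ieval :: "(nat \<Rightarrow> 'a list \<Rightarrow> 'a) \<Rightarrow> 'c itm \<Rightarrow> 'a list \<Rightarrow> 'a" where
  "ieval v (IVar n) = v n"
| "ieval v (Con c ts) = prim M (K c) (replicate (length ts) 1) 1 (map (ieval v) ts)"
| "ieval v (Fn f ts) = nrm c0 (fnl M f (replicate (length ts) 1) 1 (map (\<lambda>t. nrm c0 (ieval v t)) ts))"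

primrec isat :: "(nat \<Rightarrow> 'a list \<Rightarrow> 'a) \<Rightarrow> ('c, 'd) ifm \<Rightarrow> bool" where
  "isat v IFalse \<longleftrightarrow> False"
| "isat v (IEq s t) \<longleftrightarrow> same (ieval v s) (ieval v t)"
| "isat v (ITy D t) \<longleftrightarrow> holds (T D) (ieval v t)"
| "isat v (IImp \<phi> \<psi>) \<longleftrightarrow> (isat v \<phi> \<longrightarrow> isat v \<psi>)"
| "isat v (IAnd \<phi> \<psi>) \<longleftrightarrow> isat v \<phi> \<and> isat v \<psi>"
| "isat v (IOr \<phi> \<psi>) \<longleftrightarrow> isat v \<phi> \<or> isat v \<psi>"
| "isat v (IAll \<phi>) \<longleftrightarrow> (\<forall>g \<in> F1. htm g \<longrightarrow> isat (case_nat g v) \<phi>)"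
| "isat v (IEx \<phi>) \<longleftrightarrow> (\<exists>g \<in> F1. htm g \<and> isat (case_nat g v) \<phi>)"

lemma feval_tr_tm: "feval M u (tr_tm K N t) = ieval (u 1) t"
  by (induction t) (simp_all add: nrm_def comp_def cong: map_cong)

lemma pushf_case_nat [simp]: "pushf k g u k = case_nat g (u k)"
  by (rule ext) (simp add: pushf_def)

lemma sat_tr: "sat M e u (tr \<phi>) \<longleftrightarrow> isat (u 1) \<phi>"
proof (induction \<phi> arbitrary: e u)
  case (ITy D t)
  then show ?case
    by (simp add: sat_finst sat_type[OF interp_ok] feval_tr_tm)
qed (simp_all add: feval_tr_tm pushf_def[of _ _ _ _ 0])

lemma ieval_subst: "ieval v (itm_subst \<sigma> t) = ieval (\<lambda>n. ieval v (\<sigma> n)) t"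
  by (induction t) (simp_all add: comp_def cong: map_cong)

lemma isat_subst: "isat v (ifm_subst \<sigma> \<phi>) \<longleftrightarrow> isat (\<lambda>n. ieval v (\<sigma> n)) \<phi>"
proof (induction \<phi> arbitrary: v \<sigma>)
  case (IAll \<phi>)
  have "(\<lambda>n. ieval (case_nat g v) (iup \<sigma> n)) = case_nat g (\<lambda>n. ieval v (\<sigma> n))" for g
    by (rule ext) (simp add: iup_def ieval_subst split: nat.split)
  then show ?case by (simp add: IAll)
next
  case (IEx \<phi>)
  have "(\<lambda>n. ieval (case_nat g v) (iup \<sigma> n)) = case_nat g (\<lambda>n. ieval v (\<sigma> n))" for g
    by (rule ext) (simp add: iup_def ieval_subst split: nat.split)
  then show ?case by (simp add: IEx)
qed (simp_all add: ieval_subst)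

lemma isat_iinst: "isat v (iinst r \<phi> t) \<longleftrightarrow> isat (case_nat (ieval v t) (\<lambda>m. v (m + r))) \<phi>"
proof -
  have "(\<lambda>n. ieval v (case n of 0 \<Rightarrow> t | Suc m \<Rightarrow> IVar (m + r))) = case_nat (ieval v t) (\<lambda>m. v (m + r))"
    by (rule ext) (simp split: nat.split)
  then show ?thesis by (simp add: iinst_def isat_subst)
qed

lemma isat_ilift: "isat (case_nat g v) (ilift \<phi>) \<longleftrightarrow> isat v \<phi>"
  by (simp add: ilift_def isat_subst)

definition henv :: "(nat \<Rightarrow> 'a list \<Rightarrow> 'a) \<Rightarrow> bool" where
  "henv v \<longleftrightarrow> (\<forall>n. v n \<in> F1 \<and> htm (v n))"

lemma henv_case_nat: "henv v \<Longrightarrow> g \<in> F1 \<Longrightarrow> htm g \<Longrightarrow> henv (case_nat g v)"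
  by (simp add: henv_def split: nat.split)

lemma ieval_Con: "length ts = arity V c \<Longrightarrow> ieval v (Con c ts) = node (sharp c) (map (ieval v) ts)"
  by (simp add: node_def ctor_prfl_def)

lemma fnl_in_F1: "set gs \<subseteq> F1 \<Longrightarrow> r = length gs \<Longrightarrow> fnl M f (replicate r 1) 1 gs \<in> F1"
  using typed_F1[of gs r] fnl_closed[of gs "replicate r 1" f 1] by (simp add: typed_def)

lemma ieval_htm: "henv v \<Longrightarrow> itm_ok V t \<Longrightarrow> ieval v t \<in> F1 \<and> htm (ieval v t)"
proof (induction t)
  case (IVar n)
  then show ?case by (simp add: henv_def)
next
  case (Con c ts)
  then have "set (map (ieval v) ts) \<subseteq> F1" "\<forall>g \<in> set (map (ieval v) ts). htm g" by auto
  then show ?case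
    using Con.prems by (simp only: ieval_Con itm_ok.simps node_in_F1 htm_node length_map simp_thms)
next
  case (Fn f ts)
  then have "set (map (\<lambda>t. nrm c0 (ieval v t)) ts) \<subseteq> F1" by auto
  then have "fnl M f (replicate (length ts) 1) 1 (map (\<lambda>t. nrm c0 (ieval v t)) ts) \<in> F1"
    by (rule fnl_in_F1) simp
  then show ?case using c0 by (simp add: htm_nrm)
qed

text \<open>Under a constructor, agreement passes from the subtrees to the whole tree. For a program
  function the normalized arguments are even equal, so the functional is applied to identical
  functions.\<close>

lemma ieval_cong:
  assumes v: "henv v" "henv w" and eq: "\<And>n. same (v n) (w n)"
  shows "itm_ok V t \<Longrightarrow> same (ieval v t) (ieval w t)"
proof (induction t)
  case (Con c ts)
  let ?X = "map (ieval v) ts" and ?Y = "map (ieval w) ts"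
  have ok: "c \<in> set (ctors V)" "length ts = arity V c" "\<forall>t \<in> set ts. itm_ok V t" using Con.prems by auto
  have X: "set ?X \<subseteq> F1" "set ?Y \<subseteq> F1" using ieval_htm v ok by auto
  have "same (node (sharp c) ?X) (node (sharp c) ?Y)"
  proof (rule same_node[OF ok(1)])
    fix i assume "i < arity V c"
    then show "same (child (node (sharp c) ?X) (num i)) (?Y ! i)"
      using X ok Con.IH by (simp add: child_node del: child_app)
  qed (use X ok in simp_all)
  then show ?case using ok by (simp only: ieval_Con)
next
  case (Fn f ts)
  have "nrm c0 (ieval v t) = nrm c0 (ieval w t)" if "t \<in> set ts" for t
    using Fn that ieval_htm v by (intro nrm_cong) auto
  then have "map (\<lambda>t. nrm c0 (ieval v t)) ts = map (\<lambda>t. nrm c0 (ieval w t)) ts" by simp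
  then show ?case by (simp only: ieval.simps same_refl)
qed (simp add: eq)

text \<open>Equality means \<open>same\<close>, so soundness of replacement and the transport of
  induction formulas between representations rest on this invariance.\<close>

lemma isat_cong:
  "henv v \<Longrightarrow> henv w \<Longrightarrow> (\<And>n. same (v n) (w n)) \<Longrightarrow> ifm_ok V S \<phi> \<Longrightarrow> isat v \<phi> \<longleftrightarrow> isat w \<phi>"
proof (induction \<phi> arbitrary: v w)
  case (IEq s t)
  have ok: "itm_ok V s" "itm_ok V t" using IEq.prems(4) by simp_all
  have st: "same (ieval v s) (ieval w s)" "same (ieval v t) (ieval w t)"
    by (rule ieval_cong[OF IEq.prems(1-3)], rule ok)+
  have F: "ieval v s \<in> F1" "ieval w s \<in> F1" "ieval v t \<in> F1" "ieval w t \<in> F1"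
    using ieval_htm[OF IEq.prems(1)] ieval_htm[OF IEq.prems(2)] ok by blast+
  have "same (ieval w s) (ieval w t)" if "same (ieval v s) (ieval v t)"
    by (rule same_trans[OF F(2,1) same_sym[OF F(1,2) st(1)] same_trans[OF F(1,3) that st(2)]])
  moreover have "same (ieval v s) (ieval v t)" if "same (ieval w s) (ieval w t)"
    by (rule same_trans[OF F(1,2) st(1) same_trans[OF F(2,4) that same_sym[OF F(3,4) st(2)]]])
  ultimately show ?case unfolding isat.simps by blast
next
  case (ITy D t)
  have ok: "itm_ok V t" using ITy.prems(4) by simp
  have t: "same (ieval v t) (ieval w t)" by (rule ieval_cong[OF ITy.prems(1-3) ok])
  have F: "ieval v t \<in> F1" "ieval w t \<in> F1"
    using ieval_htm[OF ITy.prems(1) ok] ieval_htm[OF ITy.prems(2) ok] by blast+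
  show ?case
    unfolding isat.simps using T_cong[OF F t] T_cong[OF F(2,1) same_sym[OF F t]] by blast
next
  case (IImp \<phi> \<psi>)
  show ?case
    using IImp.IH(1)[OF IImp.prems(1-3)] IImp.IH(2)[OF IImp.prems(1-3)] IImp.prems(4) by simp
next
  case (IAnd \<phi> \<psi>)
  show ?case
    using IAnd.IH(1)[OF IAnd.prems(1-3)] IAnd.IH(2)[OF IAnd.prems(1-3)] IAnd.prems(4) by simp
next
  case (IOr \<phi> \<psi>)
  show ?case
    using IOr.IH(1)[OF IOr.prems(1-3)] IOr.IH(2)[OF IOr.prems(1-3)] IOr.prems(4) by simp
next
  case (IAll \<phi>)
  have "isat (case_nat g v) \<phi> \<longleftrightarrow> isat (case_nat g w) \<phi>" if "g \<in> F1" "htm g" for g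
  proof (rule IAll.IH)
    show "same (case_nat g v n) (case_nat g w n)" for n
      using IAll.prems(3) by (simp split: nat.split)
  qed (use that IAll.prems in \<open>simp_all add: henv_case_nat\<close>)
  then show ?case unfolding isat.simps by blast
next
  case (IEx \<phi>)
  have "isat (case_nat g v) \<phi> \<longleftrightarrow> isat (case_nat g w) \<phi>" if "g \<in> F1" "htm g" for g
  proof (rule IEx.IH)
    show "same (case_nat g v n) (case_nat g w n)" for n
      using IEx.prems(3) by (simp split: nat.split)
  qed (use that IEx.prems in \<open>simp_all add: henv_case_nat\<close>)
  then show ?case unfolding isat.simps by blast
qed simp

section \<open>Meaning of the rules of a bundle\<close>

lemma isat_IConj [simp]: "isat v (IConj \<phi>s) \<longleftrightarrow> (\<forall>\<phi> \<in> set \<phi>s. isat v \<phi>)"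
  unfolding IConj_def by (induction \<phi>s) auto

lemma isat_IDisj [simp]: "isat v (IDisj \<phi>s) \<longleftrightarrow> (\<exists>\<phi> \<in> set \<phi>s. isat v \<phi>)"
  unfolding IDisj_def by (induction \<phi>s) auto

abbreviation (input) htms :: "('a list \<Rightarrow> 'a) list \<Rightarrow> nat \<Rightarrow> bool" where
  "htms ys r \<equiv> length ys = r \<and> set ys \<subseteq> F1 \<and> (\<forall>y \<in> set ys. htm y)"

text \<open>The last function of the list belongs to the innermost quantifier and gets index 0, in
  accordance with \<open>rev [0..<r]\<close> in the rules.\<close>

definition pushs :: "('a list \<Rightarrow> 'a) list \<Rightarrow> (nat \<Rightarrow> 'a list \<Rightarrow> 'a) \<Rightarrow> nat \<Rightarrow> 'a list \<Rightarrow> 'a" where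
  "pushs ys v n = (if n < length ys then ys ! (length ys - Suc n) else v (n - length ys))"

lemma pushs_Cons: "pushs ys (case_nat y v) = pushs (y # ys) v"
proof
  fix n
  consider "n < length ys" | "n = length ys" | "n > length ys" by linarith
  then show "pushs ys (case_nat y v) n = pushs (y # ys) v n"
  proof cases
    case 1
    then have "length (y # ys) - Suc n = Suc (length ys - Suc n)" by simp
    with 1 show ?thesis by (simp add: pushs_def)
  next
    case 3
    then have "n - length ys = Suc (n - Suc (length ys))" by simp
    with 3 show ?thesis by (simp add: pushs_def)
  qed (simp add: pushs_def)
qed

lemma pushs_Nil [simp]: "pushs [] v = v"
  by (rule ext) (simp add: pushs_def)

lemma pushs_ge [simp]: "r = length ys \<Longrightarrow> pushs ys v (m + r) = v m"
  by (simp add: pushs_def)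

lemma map_pushs: "r = length ys \<Longrightarrow> map (pushs ys v) (rev [0..<r]) = ys"
  by (auto simp: pushs_def rev_nth intro!: nth_equalityI)

lemma isat_IAlls: "isat v (IAlls r \<phi>) \<longleftrightarrow> (\<forall>ys. htms ys r \<longrightarrow> isat (pushs ys v) \<phi>)"
proof -
  have "isat v ((IAll ^^ r) \<phi>) \<longleftrightarrow> (\<forall>ys. htms ys r \<longrightarrow> isat (pushs ys v) \<phi>)"
  proof (induction r arbitrary: v)
    case (Suc r)
    have "isat v ((IAll ^^ Suc r) \<phi>) \<longleftrightarrow>
        (\<forall>g \<in> F1. htm g \<longrightarrow> (\<forall>ys. htms ys r \<longrightarrow> isat (pushs (g # ys) v) \<phi>))"
      by (simp add: Suc pushs_Cons)
    also have "\<dots> \<longleftrightarrow> (\<forall>ys. htms ys (Suc r) \<longrightarrow> isat (pushs ys v) \<phi>)"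
      by (auto simp: length_Suc_conv)
    finally show ?case .
  qed simp
  then show ?thesis by (simp add: IAlls_def)
qed

lemma isat_IExs: "isat v (IExs r \<phi>) \<longleftrightarrow> (\<exists>ys. htms ys r \<and> isat (pushs ys v) \<phi>)"
proof -
  have "isat v ((IEx ^^ r) \<phi>) \<longleftrightarrow> (\<exists>ys. htms ys r \<and> isat (pushs ys v) \<phi>)"
  proof (induction r arbitrary: v)
    case (Suc r)
    have "isat v ((IEx ^^ Suc r) \<phi>) \<longleftrightarrow>
        (\<exists>g \<in> F1. htm g \<and> (\<exists>ys. htms ys r \<and> isat (pushs (g # ys) v) \<phi>))"
      by (simp add: Suc pushs_Cons)
    also have "\<dots> \<longleftrightarrow> (\<exists>ys. htms ys (Suc r) \<and> isat (pushs ys v) \<phi>)"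
      by (fastforce simp: length_Suc_conv)
    finally show ?case .
  qed simp
  then show ?thesis by (simp add: IExs_def)
qed

lemma henv_pushs: "henv v \<Longrightarrow> htms ys r \<Longrightarrow> henv (pushs ys v)"
  by (auto simp: henv_def pushs_def subset_iff)

lemma pushs_rev: "i < r \<Longrightarrow> r = length ys \<Longrightarrow> pushs ys v (r - Suc i) = ys ! i"
proof -
  assume *: "i < r" "r = length ys"
  then have "r - Suc i < length ys" "length ys - Suc (r - Suc i) = i" by auto
  then show "pushs ys v (r - Suc i) = ys ! i" by (simp add: pushs_def)
qed

lemma isat_IConj_map2:
  "length xs = length ys \<Longrightarrow>
   isat v (IConj (map2 f xs ys)) \<longleftrightarrow> (\<forall>i < length xs. isat v (f (xs ! i) (ys ! i)))"
  by (simp add: all_set_conv_all_nth)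

lemma isat_construction_rule:
  assumes r: "length Qs = arity V c"
  shows "isat v (construction_rule \<Phi> (c, Qs, D)) \<longleftrightarrow>
    (\<forall>ys. htms ys (length Qs) \<longrightarrow> (\<forall>i < length Qs. isat (case_nat (ys ! i) v) (\<Phi> (Qs ! i))) \<longrightarrow>
      isat (case_nat (node (sharp c) ys) v) (\<Phi> D))"
proof -
  let ?r = "length Qs" and ?ys = "map IVar (rev [0..<length Qs])"
  have "isat (pushs ys v) (IConj (map2 (\<lambda>Q y. iinst ?r (\<Phi> Q) y) Qs ?ys)) \<longleftrightarrow>
      (\<forall>i < ?r. isat (case_nat (ys ! i) v) (\<Phi> (Qs ! i)))"
    "isat (pushs ys v) (iinst ?r (\<Phi> D) (Con c ?ys)) \<longleftrightarrow>
      isat (case_nat (node (sharp c) ys) v) (\<Phi> D)"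
    if ys: "length ys = ?r" for ys
  proof -
    have ext: "pushs ys v (?r - Suc i) = ys ! i" if "i < ?r" for i
      using that ys by (simp only: pushs_rev)
    show "isat (pushs ys v) (IConj (map2 (\<lambda>Q y. iinst ?r (\<Phi> Q) y) Qs ?ys)) \<longleftrightarrow>
      (\<forall>i < ?r. isat (case_nat (ys ! i) v) (\<Phi> (Qs ! i)))"
      using ys by (simp add: isat_IConj_map2 isat_iinst rev_nth ext del: isat_IConj)
    have "ieval (pushs ys v) (Con c ?ys) = node (sharp c) ys"
      using r map_pushs[of ?r ys v] ys by (simp only: ieval_Con length_map length_rev length_upt)
        (simp add: comp_def)
    then show "isat (pushs ys v) (iinst ?r (\<Phi> D) (Con c ?ys)) \<longleftrightarrow>
      isat (case_nat (node (sharp c) ys) v) (\<Phi> D)"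
      using ys by (simp only: isat_iinst pushs_ge)
  qed
  then show ?thesis
    by (simp add: construction_rule_def Let_def isat_IAlls)
qed

lemma isat_constructor_statement:
  assumes r: "length Qs = arity V c"
  shows "isat (case_nat x v) (constructor_statement \<Phi> (c, Qs)) \<longleftrightarrow>
    (\<exists>ys. htms ys (length Qs) \<and> same x (node (sharp c) ys) \<and>
      (\<forall>i < length Qs. isat (case_nat (ys ! i) v) (\<Phi> (Qs ! i))))"
proof -
  let ?r = "length Qs" and ?ys = "map IVar (rev [0..<length Qs])" and ?v = "case_nat x v"
  have "isat (pushs ys ?v) (IConj (map2 (\<lambda>Q y. iinst (Suc ?r) (\<Phi> Q) y) Qs ?ys)) \<longleftrightarrow>
      (\<forall>i < ?r. isat (case_nat (ys ! i) v) (\<Phi> (Qs ! i)))"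
    "isat (pushs ys ?v) (IEq (IVar ?r) (Con c ?ys)) \<longleftrightarrow> same x (node (sharp c) ys)"
    if ys: "length ys = ?r" for ys
  proof -
    have ext: "pushs ys ?v (?r - Suc i) = ys ! i" if "i < ?r" for i
      using that ys by (simp only: pushs_rev)
    have "pushs ys ?v (m + Suc ?r) = v m" for m
      using ys by (simp add: pushs_def)
    then show "isat (pushs ys ?v) (IConj (map2 (\<lambda>Q y. iinst (Suc ?r) (\<Phi> Q) y) Qs ?ys)) \<longleftrightarrow>
      (\<forall>i < ?r. isat (case_nat (ys ! i) v) (\<Phi> (Qs ! i)))"
      using ys by (simp add: isat_IConj_map2 isat_iinst rev_nth ext del: isat_IConj add_Suc_right)
    have "ieval (pushs ys ?v) (Con c ?ys) = node (sharp c) ys"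
      using r map_pushs[of ?r ys ?v] ys by (simp only: ieval_Con length_map length_rev length_upt)
        (simp add: comp_def)
    moreover have "pushs ys ?v ?r = x" using ys by (simp add: pushs_def)
    ultimately show "isat (pushs ys ?v) (IEq (IVar ?r) (Con c ?ys)) \<longleftrightarrow> same x (node (sharp c) ys)"
      by (simp only: isat.simps ieval.simps(1))
  qed
  then show ?thesis
    by (auto simp: constructor_statement_def Let_def isat_IExs simp del: isat.simps(2) isat_IConj)
qed

lemma isat_deconstruction_rule:
  assumes r: "\<forall>(c, Qs) \<in> set \<psi>s. length Qs = arity V c"
  shows "isat v (deconstruction_rule \<Phi> (D, \<psi>s)) \<longleftrightarrow>
    (\<forall>x \<in> F1. htm x \<longrightarrow> isat (case_nat x v) (\<Phi> D) \<longrightarrow>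
      (\<exists>c Qs ys. (c, Qs) \<in> set \<psi>s \<and> htms ys (length Qs) \<and> same x (node (sharp c) ys) \<and>
        (\<forall>i < length Qs. isat (case_nat (ys ! i) v) (\<Phi> (Qs ! i)))))"
proof -
  have "isat (case_nat x v) (iinst 1 (\<Phi> D) (IVar 0)) \<longleftrightarrow> isat (case_nat x v) (\<Phi> D)" for x
    by (simp add: isat_iinst)
  moreover have "isat (case_nat x v) (IDisj (map (constructor_statement \<Phi>) \<psi>s)) \<longleftrightarrow>
      (\<exists>c Qs ys. (c, Qs) \<in> set \<psi>s \<and> htms ys (length Qs) \<and> same x (node (sharp c) ys) \<and>
        (\<forall>i < length Qs. isat (case_nat (ys ! i) v) (\<Phi> (Qs ! i))))" for x
  proof -
    have "isat (case_nat x v) (IDisj (map (constructor_statement \<Phi>) \<psi>s)) \<longleftrightarrow>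
        (\<exists>c Qs. (c, Qs) \<in> set \<psi>s \<and> isat (case_nat x v) (constructor_statement \<Phi> (c, Qs)))"
      by auto
    moreover have "isat (case_nat x v) (constructor_statement \<Phi> (c, Qs)) \<longleftrightarrow> (\<exists>ys. htms ys (length Qs) \<and>
        same x (node (sharp c) ys) \<and> (\<forall>i < length Qs. isat (case_nat (ys ! i) v) (\<Phi> (Qs ! i))))"
      if "(c, Qs) \<in> set \<psi>s" for c Qs
      by (rule isat_constructor_statement) (use that r in auto)
    ultimately have "isat (case_nat x v) (IDisj (map (constructor_statement \<Phi>) \<psi>s)) \<longleftrightarrow>
        (\<exists>c Qs. (c, Qs) \<in> set \<psi>s \<and> (\<exists>ys. htms ys (length Qs) \<and>
        same x (node (sharp c) ys) \<and> (\<forall>i < length Qs. isat (case_nat (ys ! i) v) (\<Phi> (Qs ! i)))))"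
      by (simp only:) (intro ex_cong1 conj_cong refl)
    then show ?thesis by blast
  qed
  ultimately show ?thesis
    by (simp only: deconstruction_rule_def prod.case isat.simps)
qed

lemma isat_type_atom [simp]: "isat v (type_atom D) \<longleftrightarrow> holds (T D) (v 0)"
  by (simp add: type_atom_def)

definition children :: "'c \<Rightarrow> ('a list \<Rightarrow> 'a) \<Rightarrow> ('a list \<Rightarrow> 'a) list" where
  "children c x = map (\<lambda>i. child x (num i)) [0..<arity V c]"

lemma children:
  assumes "c \<in> set (ctors V)" "x \<in> F1" "htm x" "x [Z] = num (sharp c)"
  shows "htms (children c x) (arity V c)" "same x (node (sharp c) (children c x))"
proof -
  show h: "htms (children c x) (arity V c)"
    using htm_child[OF assms(2,3,1,4)] assms(2) by (auto simp: children_def)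
  show "same x (node (sharp c) (children c x))"
    by (rule same_node) (use assms h in \<open>auto simp: children_def simp del: child_app\<close>)
qed

lemma same_node_root:
  assumes c: "c \<in> set (ctors V)" and x: "x \<in> F1" "same x (node (sharp c) ys)"
    and ys: "htms ys (arity V c)"
  shows "x [Z] = num (sharp c)" "i < arity V c \<Longrightarrow> same (child x (num i)) (ys ! i)"
proof -
  show root: "x [Z] = num (sharp c)" using same_root[OF x(2)] ys by simp
  show "i < arity V c \<Longrightarrow> same (child x (num i)) (ys ! i)"
    using same_child[OF x(1) _ x(2) c root, of i] ys by (simp add: child_node del: child_app)
qed

lemma isat_cong_head:
  assumes "henv v" "x \<in> F1" "htm x" "y \<in> F1" "htm y" "same x y" "ifm_ok V S \<phi>" "isat (case_nat x v) \<phi>"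
  shows "isat (case_nat y v) \<phi>"
proof -
  have "same (case_nat x v n) (case_nat y v n)" for n using assms(6) by (simp split: nat.split)
  then show ?thesis
    using isat_cong[OF henv_case_nat[OF assms(1-3)] henv_case_nat[OF assms(1,4,5)] _ assms(7)] assms(8)
    by blast
qed

definition fun_env :: "(nat \<Rightarrow> 'a list \<Rightarrow> 'a) \<Rightarrow> nat \<Rightarrow> nat \<Rightarrow> 'a list \<Rightarrow> 'a" where
  "fun_env v k = (if k = 1 then v else (\<lambda>_. dflt k))"

lemma fenv_fun_env: "henv v \<Longrightarrow> fenv M (fun_env v)"
  by (auto simp: fenv_def fun_env_def henv_def dflt_in_funs)

lemma sat_fun_env: "sat M e (pushf 1 y (fun_env v)) (tr \<phi>) \<longleftrightarrow> isat (case_nat y v) \<phi>"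
  by (simp add: sat_tr) (simp add: fun_env_def)

lemma pfm_ok_tr: "ifm_ok V S \<phi> \<Longrightarrow> pfm_ok (tr \<phi>)"
proof (rule pfm_ok_tr_fm)
  show "pfm_ok (T D)" for D using interp_ok[of sharp code "rev S" D] by (simp add: type_ok_def)
qed (simp_all add: prfl_ok_node prfl_ok_norm ctor_prfl_def norm_prfl_def)

section \<open>Truth of the axioms of the intrinsic theory\<close>

lemma isat_sep_injective:
  assumes v: "henv v" and c: "c \<in> set (ctors V)" and r: "r = arity V c"
    and xs: "xs = map IVar [0..<r]" and ys: "ys = map IVar [r..<r + r]"
  shows "isat v (IAlls (r + r) (IImp (IEq (Con c xs) (Con c ys)) (IConj (map2 IEq xs ys))))"
  unfolding isat_IAlls
proof (intro allI impI)
  fix zs assume "htms zs (r + r)"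
  then have w: "henv (pushs zs v)" using v henv_pushs by blast
  let ?w = "pushs zs v"
  let ?X = "map ?w [0..<r]" and ?Y = "map ?w [r..<r + r]"
  have F: "set ?X \<subseteq> F1" "set ?Y \<subseteq> F1" using w by (auto simp: henv_def)
  have "same (?w i) (?w (r + i))"
    if eq: "same (node (sharp c) ?X) (node (sharp c) ?Y)" and i: "i < r" for i
    using same_child[OF _ _ eq c, of i] F i r by (simp add: child_node del: child_app)
  then show "isat ?w (IImp (IEq (Con c xs) (Con c ys)) (IConj (map2 IEq xs ys)))"
    using r by (auto simp: xs ys ieval_Con set_zip comp_def simp del: ieval.simps(2))
qed

lemma isat_sep_disjoint:
  assumes v: "henv v" and c: "c \<in> set (ctors V)" "c' \<in> set (ctors V)" "c \<noteq> c'"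
    and r: "r = arity V c" "r' = arity V c'"
    and xs: "xs = map IVar [0..<r]" and ys: "ys = map IVar [r..<r + r']"
  shows "isat v (IAlls (r + r') (INot (IEq (Con c xs) (Con c' ys))))"
  unfolding isat_IAlls
proof (intro allI impI)
  fix zs assume "htms zs (r + r')"
  then have w: "henv (pushs zs v)" using v henv_pushs by blast
  let ?w = "pushs zs v"
  let ?X = "map ?w [0..<r]" and ?Y = "map ?w [r..<r + r']"
  have F: "set ?X \<subseteq> F1" "set ?Y \<subseteq> F1" using w by (auto simp: henv_def)
  have "\<not> same (node (sharp c) ?X) (node (sharp c') ?Y)"
    using same_root[of "node (sharp c) ?X" "node (sharp c') ?Y"] F c sharp_inj by (auto dest: inj_onD)
  then show "isat ?w (INot (IEq (Con c xs) (Con c' ys)))"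
    using r by (simp add: xs ys ieval_Con comp_def del: ieval.simps(2))
qed

lemma isat_construction:
  assumes v: "henv v" and S: "Inductive Ds R \<in> set S" and \<rho>: "(c, Qs, D) \<in> set R"
  shows "isat v (construction_rule type_atom (c, Qs, D))"
proof -
  obtain lower T' where tb: "type_bundle M V sharp code Ds R lower T'"
    and lower: "\<And>Q. Q \<in> set lower \<Longrightarrow> T' Q = T Q"
    and T: "\<And>D. D \<in> set Ds \<Longrightarrow> T D = type_fm code False (local_fm sharp code False Ds R lower T') D"
    using T_bundle[OF S] by auto
  interpret tb: type_bundle M V sharp code False Ds R lower T' by (rule tb)
  note ok = tb.rules_ok[OF \<rho>]
  have len: "length Qs = arity V c" using ok by blast
  show ?thesis
    unfolding isat_construction_rule[OF len]
  proof (intro allI impI)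
    fix ys assume ys: "htms ys (length Qs)"
      and Q: "\<forall>i < length Qs. isat (case_nat (ys ! i) v) (type_atom (Qs ! i))"
    have "holds (tb.tfm D) (node (sharp c) ys)"
    proof (rule tb.tfm_construct[OF _ \<rho>])
      fix i assume i: "i < length Qs"
      then have "Qs ! i \<in> set Ds \<union> set lower" using ok nth_mem[OF i] by blast
      then show "tb.final (Qs ! i) (child (node (sharp c) ys) (num i))"
        using Q i ys T[of "Qs ! i"] lower[of "Qs ! i"]
        by (auto simp: tb.final_def child_node simp del: child_app)
    qed (use ys in simp_all)
    then show "isat (case_nat (node (sharp c) ys) v) (type_atom D)"
      using T ok by simp
  qed
qed

lemma isat_deconstruction:
  assumes v: "henv v" and S: "Coinductive R \<in> set S" and \<rho>: "(D, \<psi>s) \<in> set R"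
  shows "isat v (deconstruction_rule type_atom (D, \<psi>s))"
proof -
  let ?Ds = "bundle_types (Coinductive R)" and ?R = "bundle_rules (Coinductive R)"
  \<comment> \<open>Since a type is listed only once, all rules of the bundle for \<open>D\<close>
    stem from the disjuncts \<psi>s at hand.\<close>
  have dist: "distinct (map fst R)"
    using data_system S unfolding data_system_def by (auto simp: distinct_concat_iff)
  obtain lower T' where tb: "type_bundle M V sharp code ?Ds ?R lower T'"
    and lower: "\<And>Q. Q \<in> set lower \<Longrightarrow> T' Q = T Q"
    and T: "\<And>D. D \<in> set ?Ds \<Longrightarrow> T D = type_fm code True (local_fm sharp code True ?Ds ?R lower T') D"
    using T_bundle[OF S] by (auto simp del: bundle_types.simps bundle_rules.simps)
  interpret tb: type_bundle M V sharp code True ?Ds ?R lower T' by (rule tb)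
  have D: "D \<in> set ?Ds" using \<rho> by force
  have r: "(c, Qs) \<in> set \<psi>s \<longleftrightarrow> (c, Qs, D) \<in> set ?R" for c Qs
    using \<rho> dist by (force dest: eq_key_imp_eq_value)
  have len: "\<forall>(c, Qs) \<in> set \<psi>s. length Qs = arity V c"
    using tb.rules_ok[of _ _ D] r by blast
  show ?thesis
    unfolding isat_deconstruction_rule[OF len]
  proof (intro ballI impI)
    fix x assume x: "x \<in> F1" "htm x" "isat (case_nat x v) (type_atom D)"
    then have hold: "holds (tb.tfm D) x" using T[OF D] by simp
    then obtain c Qs where cQs: "(c, Qs, D) \<in> set ?R" "x [Z] = num (sharp c)"
      and fin: "\<And>i. i < length Qs \<Longrightarrow> tb.final (Qs ! i) (child x (num i))"
      using tb.tfm_destruct[OF TrueI D x(1) hold] by blast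
    note ok = tb.rules_ok[OF cQs(1)]
    have c: "c \<in> set (ctors V)" "length Qs = arity V c" using ok by blast+
    have "isat (case_nat (children c x ! i) v) (type_atom (Qs ! i))" if i: "i < length Qs" for i
    proof -
      have "Qs ! i \<in> set ?Ds \<union> set lower" using ok nth_mem[OF i] by blast
      then show ?thesis
        using fin[OF i] i c T[of "Qs ! i"] lower[of "Qs ! i"]
        by (auto simp: tb.final_def children_def simp del: child_app bundle_types.simps bundle_rules.simps split: if_splits)
    qed
    then show "\<exists>c Qs ys. (c, Qs) \<in> set \<psi>s \<and> htms ys (length Qs) \<and> same x (node (sharp c) ys) \<and>
        (\<forall>i < length Qs. isat (case_nat (ys ! i) v) (type_atom (Qs ! i)))"
      using children[OF c(1) x(1,2) cQs(2)] cQs(1) c(2) unfolding r by metis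
  qed
qed

text \<open>A hyper-term and the node built from its children agree on addresses only. So \<phi> is
  obtained for that node first and then carried over to \<open>x\<close>.\<close>

lemma isat_induction:
  assumes v: "henv v" and S: "Inductive Ds R \<in> set S"
    and ok: "\<And>D. D \<in> set Ds \<Longrightarrow> ifm_ok V S (\<phi> D)"
    and const: "\<And>\<rho>. \<rho> \<in> set R \<Longrightarrow> isat v (construction_rule (replacing Ds \<phi>) \<rho>)"
    and D: "D \<in> set Ds" and x: "x \<in> F1" "htm x" "holds (T D) x"
  shows "isat (case_nat x v) (\<phi> D)"
proof -
  obtain lower T' where tb: "type_bundle M V sharp code Ds R lower T'"
    and lower: "\<And>Q. Q \<in> set lower \<Longrightarrow> T' Q = T Q"
    and T: "\<And>D. D \<in> set Ds \<Longrightarrow> T D = type_fm code False (local_fm sharp code False Ds R lower T') D"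
    using T_bundle[OF S] by auto
  interpret tb: type_bundle M V sharp code False Ds R lower T' by (rule tb)
  show ?thesis
  proof (rule tb.tfm_induct[where \<Phi> = "\<lambda>D. tr (\<phi> D)" and P = "\<lambda>D y. isat (case_nat y v) (\<phi> D)"
        and u = "fun_env v"])
    fix c Qs D x
    assume \<rho>: "(c, Qs, D) \<in> set R" and x: "x \<in> F1" "htm x" "x [Z] = num (sharp c)"
      and ch: "\<And>i. i < length Qs \<Longrightarrow> if Qs ! i \<in> set Ds then isat (case_nat (child x (num i)) v) (\<phi> (Qs ! i))
        else holds (T' (Qs ! i)) (child x (num i))"
    note rok = tb.rules_ok[OF \<rho>]
    have c: "D \<in> set Ds" "c \<in> set (ctors V)" "length Qs = arity V c" using rok by blast+
    note chi = children[OF c(2) x]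
    have "isat (case_nat (children c x ! i) v) (replacing Ds \<phi> (Qs ! i))" if i: "i < length Qs" for i
    proof -
      have "Qs ! i \<in> set Ds \<union> set lower" using rok nth_mem[OF i] by blast
      then show ?thesis
        using ch[OF i] i c lower[of "Qs ! i"]
        by (auto simp: replacing_def children_def simp del: child_app split: if_splits)
    qed
    then have "isat (case_nat (node (sharp c) (children c x)) v) (replacing Ds \<phi> D)"
      using const[OF \<rho>] chi(1) unfolding isat_construction_rule[OF c(3)] c(3) by blast
    then have "isat (case_nat (node (sharp c) (children c x)) v) (\<phi> D)"
      using c(1) by (simp add: replacing_def)
    moreover have n: "node (sharp c) (children c x) \<in> F1" "htm (node (sharp c) (children c x))"
      using chi(1) c by (auto intro!: htm_node)
    moreover have "same (node (sharp c) (children c x)) x"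
      by (rule same_sym[OF x(1) n(1) chi(2)])
    ultimately show "isat (case_nat x v) (\<phi> D)"
      using isat_cong_head[OF v n x(1,2) _ ok[OF c(1)]] by blast
  qed (use D x T[OF D] v ok in \<open>simp_all add: sat_fun_env[unfolded One_nat_def] fenv_fun_env pfm_ok_tr\<close>)
qed

text \<open>The trees \<open>ys\<close> provided by the decomposition represent the same hyper-terms
  as the children of \<open>x\<close> without being equal to them. Both \<phi> and the earlier types
  are therefore carried over along \<open>same\<close>.\<close>

lemma isat_coinduction:
  assumes v: "henv v" and S: "Coinductive R \<in> set S" and Ds: "Ds = map fst R"
    and ok: "\<And>D. D \<in> set Ds \<Longrightarrow> ifm_ok V S (\<phi> D)"
    and dec: "\<And>\<rho>. \<rho> \<in> set R \<Longrightarrow> isat v (deconstruction_rule (replacing Ds \<phi>) \<rho>)"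
    and D: "D \<in> set Ds" and x: "x \<in> F1" "htm x" "isat (case_nat x v) (\<phi> D)"
  shows "holds (T D) x"
proof -
  let ?R = "bundle_rules (Coinductive R)"
  have Ds': "bundle_types (Coinductive R) = Ds" by (simp add: Ds)
  obtain lower T' where tb: "type_bundle M V sharp code Ds ?R lower T'"
    and lower: "\<And>Q. Q \<in> set lower \<Longrightarrow> T' Q = T Q"
    and T: "\<And>D. D \<in> set Ds \<Longrightarrow> T D = type_fm code True (local_fm sharp code True Ds ?R lower T') D"
    using T_bundle[OF S] unfolding Ds' by (auto simp del: bundle_rules.simps)
  interpret tb: type_bundle M V sharp code True Ds ?R lower T' by (rule tb)
  have "holds (tb.tfm D) x"
  proof (rule tb.tfm_coinduct[where \<Phi> = "\<lambda>D. tr (\<phi> D)" and P = "\<lambda>D y. isat (case_nat y v) (\<phi> D)"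
        and u = "fun_env v"])
    fix D x
    assume D: "D \<in> set Ds" and x: "x \<in> F1" "htm x" "isat (case_nat x v) (\<phi> D)"
    obtain \<psi>s where \<rho>: "(D, \<psi>s) \<in> set R" using D by (auto simp: Ds)
    have r: "(c, Qs, D) \<in> set ?R" if "(c, Qs) \<in> set \<psi>s" for c Qs
      using \<rho> that by force
    have len: "\<forall>(c, Qs) \<in> set \<psi>s. length Qs = arity V c"
      using tb.rules_ok[OF r] by blast
    have "isat (case_nat x v) (replacing Ds \<phi> D)" using x D by (simp add: replacing_def)
    then obtain c Qs ys where cQs: "(c, Qs) \<in> set \<psi>s" and ys: "htms ys (length Qs)"
      and eq: "same x (node (sharp c) ys)"
      and Q: "\<And>i. i < length Qs \<Longrightarrow> isat (case_nat (ys ! i) v) (replacing Ds \<phi> (Qs ! i))"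
      using dec[OF \<rho>] x unfolding isat_deconstruction_rule[OF len] by blast
    note rok = tb.rules_ok[OF r[OF cQs]]
    have c: "c \<in> set (ctors V)" "length Qs = arity V c" using rok by blast+
    note n = same_node_root[OF c(1) x(1) eq ys[unfolded c(2)]]
    have "if Qs ! i \<in> set Ds then isat (case_nat (child x (num i)) v) (\<phi> (Qs ! i))
        else holds (T' (Qs ! i)) (child x (num i))" if i: "i < length Qs" for i
    proof -
      have ia: "i < arity V c" using i c by simp
      have y: "ys ! i \<in> F1" "htm (ys ! i)" using ys i by (auto simp: subset_iff)
      have h: "child x (num i) \<in> F1" "htm (child x (num i))"
        using x htm_child[OF x(1,2) c(1) n(1) ia] by simp_all
      have s: "same (ys ! i) (child x (num i))" by (rule same_sym[OF h(1) y(1) n(2)[OF ia]])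
      show ?thesis
      proof (cases "Qs ! i \<in> set Ds")
        case True
        then have "isat (case_nat (ys ! i) v) (\<phi> (Qs ! i))" using Q[OF i] by (simp add: replacing_def)
        then show ?thesis using isat_cong_head[OF v y h s ok[OF True]] True by simp
      next
        case False
        then have "Qs ! i \<in> set lower" using rok nth_mem[OF i] by blast
        moreover have "holds (T (Qs ! i)) (ys ! i)" using Q[OF i] False by (simp add: replacing_def)
        ultimately show ?thesis using False lower T_cong[OF y(1) h(1) s] by simp
      qed
    qed
    then show "\<exists>c Qs. (c, Qs, D) \<in> set ?R \<and> x [Z] = num (sharp c) \<and>
      (\<forall>i < length Qs. if Qs ! i \<in> set Ds then isat (case_nat (child x (num i)) v) (\<phi> (Qs ! i))
        else holds (T' (Qs ! i)) (child x (num i)))"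
      using r[OF cQs] n(1) by blast
  qed (use D x v ok in \<open>simp_all add: sat_fun_env[unfolded One_nat_def] fenv_fun_env pfm_ok_tr\<close>)
  then show ?thesis using T[OF D] by simp
qed

lemma it_axiom_sound: "it_axiom V S \<phi> \<Longrightarrow> henv v \<Longrightarrow> isat v \<phi>"
proof (induction rule: it_axiom.induct)
  case (sep_injective c r xs ys)
  then show ?case by (intro isat_sep_injective)
next
  case (sep_disjoint c c' r r' xs ys)
  then show ?case by (intro isat_sep_disjoint)
next
  case (construction Ds R \<rho>)
  then show ?case by (cases \<rho>) (auto intro: isat_construction)
next
  case (deconstruction R \<rho>)
  then show ?case by (cases \<rho>) (auto intro: isat_deconstruction)
next
  case (induction Ds R \<phi>)
  have "isat (case_nat x v) (\<phi> D)"
    if "\<forall>\<rho> \<in> set R. isat v (construction_rule (replacing Ds \<phi>) \<rho>)"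
      "D \<in> set Ds" "x \<in> F1" "htm x" "holds (T D) x" for D x
    by (rule isat_induction[OF induction.prems induction.hyps(1)]) (use that induction.hyps(2) in auto)
  then show ?case by simp
next
  case (coinduction R Ds \<phi>)
  have "holds (T D) x"
    if "\<forall>\<rho> \<in> set R. isat v (deconstruction_rule (replacing Ds \<phi>) \<rho>)"
      "D \<in> set Ds" "x \<in> F1" "htm x" "isat (case_nat x v) (\<phi> D)" for D x
    by (rule isat_coinduction[OF coinduction.prems coinduction.hyps(1,2), of \<phi>])
      (use that coinduction.hyps(3) in auto)
  then show ?case by simp
qed

lemma it_proves_sound:
  "it_proves V S \<Gamma> \<phi> \<Longrightarrow> henv v \<Longrightarrow> (\<forall>\<gamma> \<in> set \<Gamma>. isat v \<gamma>) \<Longrightarrow> isat v \<phi>"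
proof (induction arbitrary: v rule: it_proves.induct)
  case (I_axiom \<phi> \<Gamma>)
  then show ?case by (intro it_axiom_sound)
next
  case (I_allI \<Gamma> \<phi>)
  show ?case
    unfolding isat.simps
  proof (intro ballI impI)
    fix g assume "g \<in> F1" "htm g"
    then show "isat (case_nat g v) \<phi>"
      using I_allI.prems by (intro I_allI.IH henv_case_nat) (simp_all add: isat_ilift)
  qed
next
  case (I_allE \<Gamma> \<phi> t)
  have "isat v (IAll \<phi>)" by (rule I_allE.IH[OF I_allE.prems])
  then show ?case using ieval_htm[OF I_allE.prems(1) I_allE.hyps(2)] by (simp add: isat_iinst)
next
  case (I_exI \<phi> t \<Gamma>)
  have "isat v (iinst 0 \<phi> t)" by (rule I_exI.IH[OF I_exI.prems])
  then show ?case using ieval_htm[OF I_exI.prems(1) I_exI.hyps(2)] by (auto simp: isat_iinst)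
next
  case (I_exE \<Gamma> \<phi> \<psi>)
  have "isat v (IEx \<phi>)" by (rule I_exE.IH(1)[OF I_exE.prems])
  then obtain g where g: "g \<in> F1" "htm g" "isat (case_nat g v) \<phi>" by auto
  have "isat (case_nat g v) (ilift \<psi>)"
    using I_exE.prems g by (intro I_exE.IH(2) henv_case_nat) (simp_all add: isat_ilift)
  then show ?case by (simp add: isat_ilift)
next
  case (I_replace \<phi> \<Gamma> s t)
  have "ifm_ok V S (IEq s t)" by (rule it_proves_ok[OF data_system I_replace.hyps(2)])
  then have st: "itm_ok V s" "itm_ok V t" by simp_all
  have "same (ieval v s) (ieval v t)" using I_replace.IH(1)[OF I_replace.prems] by simp
  moreover have "isat (case_nat (ieval v s) v) \<phi>"
    using I_replace.IH(2)[OF I_replace.prems] by (simp add: isat_iinst)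
  ultimately show ?case
    using isat_cong_head[OF I_replace.prems(1), of "ieval v s" "ieval v t" \<phi>] I_replace.hyps(1)
      ieval_htm[OF I_replace.prems(1) st(1)] ieval_htm[OF I_replace.prems(1) st(2)]
    by (simp add: isat_iinst)
next
  case (I_classical \<phi> \<Gamma>)
  show ?case using I_classical.IH[OF I_classical.prems(1)] I_classical.prems(2) by auto
next
  case (I_impI \<phi> \<Gamma> \<psi>)
  show ?case using I_impI.IH[OF I_impI.prems(1)] I_impI.prems(2) by auto
next
  case (I_impE \<Gamma> \<phi> \<psi>)
  show ?case using I_impE.IH[OF I_impE.prems] by simp
next
  case (I_orE \<Gamma> \<phi> \<psi> \<chi>)
  show ?case
    using I_orE.IH(1)[OF I_orE.prems] I_orE.IH(2,3)[OF I_orE.prems(1)] I_orE.prems(2) by auto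
next
  case (I_andI \<Gamma> \<phi> \<psi>)
  show ?case using I_andI.IH[OF I_andI.prems] by simp
next
  case (I_andE1 \<Gamma> \<phi> \<psi>)
  show ?case using I_andE1.IH[OF I_andE1.prems] by simp
next
  case (I_andE2 \<Gamma> \<phi> \<psi>)
  show ?case using I_andE2.IH[OF I_andE2.prems] by simp
next
  case (I_orI1 \<psi> \<Gamma> \<phi>)
  show ?case using I_orI1.IH[OF I_orI1.prems] by simp
next
  case (I_orI2 \<phi> \<Gamma> \<psi>)
  show ?case using I_orI2.IH[OF I_orI2.prems] by simp
qed simp_all

lemma ieval_cong_fv: "(\<And>n. n \<in> itm_fv t \<Longrightarrow> v n = w n) \<Longrightarrow> ieval v t = ieval w t"
proof (induction t)
  case (Con c ts)
  have "map (ieval v) ts = map (ieval w) ts" using Con by (intro map_cong) auto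
  then show ?case by (simp only: ieval.simps)
next
  case (Fn f ts)
  have "map (\<lambda>t. nrm c0 (ieval v t)) ts = map (\<lambda>t. nrm c0 (ieval w t)) ts"
    using Fn by (intro map_cong refl arg_cong[where f = "nrm c0"]) auto
  then show ?case by (simp only: ieval.simps)
qed simp

lemma isat_cong_fv: "(\<And>n. n \<in> ifm_fv \<phi> \<Longrightarrow> v n = w n) \<Longrightarrow> isat v \<phi> \<longleftrightarrow> isat w \<phi>"
proof (induction \<phi> arbitrary: v w)
  case (IEq s t)
  then show ?case using ieval_cong_fv[of s v w] ieval_cong_fv[of t v w] by simp
next
  case (ITy D t)
  then show ?case using ieval_cong_fv[of t v w] by simp
next
  case (IImp \<phi> \<psi>)
  show ?case using IImp.IH[of v w] IImp.prems by simp
next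
  case (IAnd \<phi> \<psi>)
  show ?case using IAnd.IH[of v w] IAnd.prems by simp
next
  case (IOr \<phi> \<psi>)
  show ?case using IOr.IH[of v w] IOr.prems by simp
next
  case (IAll \<phi>)
  have "isat (case_nat g v) \<phi> \<longleftrightarrow> isat (case_nat g w) \<phi>" for g
  proof (rule IAll.IH)
    show "case_nat g v n = case_nat g w n" if "n \<in> ifm_fv \<phi>" for n
      using IAll.prems that by (cases n) auto
  qed
  then show ?case by simp
next
  case (IEx \<phi>)
  have "isat (case_nat g v) \<phi> \<longleftrightarrow> isat (case_nat g w) \<phi>" for g
  proof (rule IEx.IH)
    show "case_nat g v n = case_nat g w n" if "n \<in> ifm_fv \<phi>" for n
      using IEx.prems that by (cases n) auto
  qed
  then show ?case by simp
qed simp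

lemma sat_tr_closed:
  assumes "it_proves V S [] \<phi>" "iclosed \<phi>"
  shows "sat M e u (tr \<phi>)"
proof -
  \<comment> \<open>The functions in \<open>u\<close> need not represent hyper-terms. A closed
    formula does not depend on them, so a normal form can stand for every variable.\<close>
  have "henv (\<lambda>_. nrm c0 (dflt (Suc 0)))"
    using c0 by (simp add: henv_def htm_nrm dflt_in_funs)
  then have "isat (\<lambda>_. nrm c0 (dflt (Suc 0))) \<phi>"
    using it_proves_sound[OF assms(1)] by simp
  then show ?thesis
    using isat_cong_fv[of \<phi>] assms(2) unfolding sat_tr iclosed_def by blast
qed

end

section \<open>The constructors, the normalization and the interpretation\<close>

context hyper
begin

lemma feval_ctor:
  "feval M u (Prim (ctor_prfl V sharp c) (replicate (arity V c) 1) 1 (map (FVar 1) [0..<arity V c])) =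
   node (sharp c) (map (u 1) [0..<arity V c])"
  by (simp add: node_def ctor_prfl_def comp_def)

end

text \<open>By completeness, evaluating the tree at its root and below each child in every model
  replaces a formal derivation.\<close>

lemma ctor_prfl_interprets:
  assumes "inj_on sharp (set (ctors V))"
  shows "interprets_constructor V sharp c (ctor_prfl V sharp c)"
proof -
  let ?r = "arity V c"
  let ?h = "Prim (ctor_prfl V sharp c) (replicate ?r 1) 1 (map (FVar 1) [0..<?r])"
  have ok: "prfl_ok (replicate ?r 1) 1 (ctor_prfl V sharp c)"
    using prfl_ok_node by (simp add: ctor_prfl_def)
  then have h: "ftm_ok ?h" by (auto intro: nth_equalityI)
  have "pra_proves [] (PEq (NApp ?h [NZero]) (numeral_tm (sharp c)))"
  proof (rule completeness)
    show "pfm_ok (PEq (NApp ?h [NZero]) (numeral_tm (sharp c)))" using h by simp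
    fix M :: "nat pra_struct" and e u assume M: "pra_model M" "fenv M u"
    interpret hyper M V sharp using M(1) assms by (intro hyper.intro hyper_axioms.intro)
    have "set (map (u 1) [0..<?r]) \<subseteq> F1" using M(2) by (auto simp: fenv_def)
    then show "sat M e u (PEq (NApp ?h [NZero]) (numeral_tm (sharp c)))"
      by (simp only: sat.simps neval.simps feval_ctor list.map neval_NZero neval_numeral node_root)
  qed
  moreover have "pra_proves []
      (PAllN (PEq (NApp ?h [Papp p_cons [numeral_tm i, NVar 0]]) (NApp (FVar 1 i) [NVar 0])))"
    if i: "i < ?r" for i
  proof (rule completeness)
    show "pfm_ok (PAllN (PEq (NApp ?h [Papp p_cons [numeral_tm i, NVar 0]]) (NApp (FVar 1 i) [NVar 0])))"
      using h by (simp add: prfl_ok_arith)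
    fix M :: "nat pra_struct" and e u assume M: "pra_model M" "fenv M u"
    interpret hyper M V sharp using M(1) assms by (intro hyper.intro hyper_axioms.intro)
    have "set (map (u 1) [0..<?r]) \<subseteq> F1" using M(2) by (auto simp: fenv_def)
    then have "node (sharp c) (map (u 1) [0..<?r]) [cons (num i) b] = u 1 i [b]" for b
      using i by (subst node_cons_num) simp_all
    then show "sat M e u
        (PAllN (PEq (NApp ?h [Papp p_cons [numeral_tm i, NVar 0]]) (NApp (FVar 1 i) [NVar 0])))"
      by (simp only: sat.simps neval.simps feval_ctor feval.simps(1) list.map neval_Papp neval_numeral
          fold_ops nat.case simp_thms)
  qed
  ultimately show ?thesis
    unfolding interprets_constructor_def Let_def using ok by blast
qed

lemma norm_prfl_normalizes:
  assumes "inj_on sharp (set (ctors V))" "c \<in> set (ctors V)"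
  shows "normalizes V sharp (norm_prfl V sharp c)"
proof -
  let ?g = "FVar 1 0" and ?h = "Prim (norm_prfl V sharp c) [1] 1 [FVar 1 0]"
  have ok: "prfl_ok [1] 1 (norm_prfl V sharp c)"
    using prfl_ok_norm by (simp add: norm_prfl_def)
  have "pra_proves [] (Htm V sharp ?h)"
  proof (rule completeness)
    show "pfm_ok (Htm V sharp ?h)" using ok by simp
    fix M :: "nat pra_struct" and e u assume M: "pra_model M" "fenv M u"
    interpret hyper M V sharp using M(1) assms by (intro hyper.intro hyper_axioms.intro)
    have "u (Suc 0) 0 \<in> F1" using M(2) by (simp add: fenv_def)
    then show "sat M e u (Htm V sharp ?h)"
      using htm_nrm[OF _ assms(2)] by (simp add: nrm_def)
  qed
  moreover have "pra_proves [] (PImp (Htm V sharp ?g) (SameHtm V sharp ?h ?g))"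
  proof (rule completeness)
    show "pfm_ok (PImp (Htm V sharp ?g) (SameHtm V sharp ?h ?g))" using ok by simp
    fix M :: "nat pra_struct" and e u assume M: "pra_model M" "fenv M u"
    interpret hyper M V sharp using M(1) assms by (intro hyper.intro hyper_axioms.intro)
    have "u (Suc 0) 0 \<in> F1" using M(2) by (simp add: fenv_def)
    then show "sat M e u (PImp (Htm V sharp ?g) (SameHtm V sharp ?h ?g))"
      using same_nrm by (simp add: nrm_def)
  qed
  ultimately show ?thesis
    unfolding normalizes_def Let_def using ok by blast
qed

theorem theorem6p2:
  fixes V :: "'c vocabulary" and S :: "('c, 'd) ty_bundle list" and sharp :: "'c \<Rightarrow> nat"
  assumes "ctors V \<noteq> []"
    and "inj_on sharp (set (ctors V))"
    and "data_system V S"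
  shows "\<exists>K N T. interpretation_of V S sharp K N T \<and>
           (\<forall>\<phi>. iclosed \<phi> \<and> it_proves V S [] \<phi> \<longrightarrow>
                 pra_proves [] (tr_fm V sharp K N T \<phi>))"
proof -
  have "finite (types S)" by (simp add: types_def)
  then obtain f :: "'d \<Rightarrow> nat" where f: "inj_on f (types S)"
    using finite_imp_inj_to_nat_seg by metis
  \<comment> \<open>The successor reserves 0 for undecorated addresses.\<close>
  define code where "code D = Suc (f D)" for D
  have code: "inj_on code (types S)" "\<And>D. code D \<noteq> 0"
    using f by (auto simp: code_def inj_on_def)
  \<comment> \<open>Some constructor must exist to replace the invalid labels of a function.\<close>
  obtain c0 where c0: "c0 \<in> set (ctors V)" using assms(1) by (cases "ctors V") auto
  let ?K = "ctor_prfl V sharp" and ?N = "norm_prfl V sharp c0" and ?T = "interp sharp code (rev S)"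
  have "interpretation_of V S sharp ?K ?N ?T"
    unfolding interpretation_of_def
    using ctor_prfl_interprets[OF assms(2)] norm_prfl_normalizes[OF assms(2) c0]
      interp_ok[of sharp code "rev S", unfolded type_ok_def] by blast
  moreover have "pra_proves [] (tr_fm V sharp ?K ?N ?T \<phi>)"
    if \<phi>: "iclosed \<phi>" "it_proves V S [] \<phi>" for \<phi>
  proof (rule completeness)
    show "pfm_ok (tr_fm V sharp ?K ?N ?T \<phi>)"
    proof (rule pfm_ok_tr_fm)
      show "ifm_ok V S \<phi>" by (rule it_proves_ok[OF assms(3) \<phi>(2)])
      show "pfm_ok (?T D)" for D using interp_ok[of sharp code "rev S" D] by (simp add: type_ok_def)
    qed (simp_all add: prfl_ok_node prfl_ok_norm ctor_prfl_def norm_prfl_def)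
    fix M :: "nat pra_struct" and e u assume M: "pra_model M" "fenv M u"
    interpret interp_model M V sharp S code c0
      by (intro interp_model.intro hyper.intro hyper_axioms.intro interp_model_axioms.intro
          M(1) assms(2,3) c0 code)
    show "sat M e u (tr_fm V sharp ?K ?N ?T \<phi>)" by (rule sat_tr_closed[OF \<phi>(2,1)])
  qed
  ultimately show ?thesis by blast
qed

end
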